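(* For each integer $n\geq 2$, there is an embedded mean curvature self-shrinker $\Sigma^{2n-1}\subset \mathbb{R}^{2n}$ (a smooth embedded hypersurface) which is diffeomorphic to $S^{n-1}\times S^{n-1}\times S^1$ and invariant under the action of $SO(n)\times SO(n)$ on $\mathbb{R}^{2n}=\mathbb{R}^n\oplus\mathbb{R}^n$.
   Context: A smooth hypersurface $\Sigma^{k-1}\subset\mathbb{R}^{k}$ is called a mean curvature self-shrinker if it satisfies $$H=\frac{\langle \vec X,\vec\nu\rangle}{2},$$ where $\vec X$ is the position vector, $\vec\nu$ is a unit normal, and the scalar mean curvature $H$ (the sum of the principal curvatures) is defined with the sign convention $\vec H=-H\vec\nu$, $\vec H$ being the mean curvature vector (so, for example, the sphere of radius $\sqrt{2(k-1)}$ centered at the origin in $\mathbb{R}^k$ is a self-shrinker). The group $SO(n)\times SO(n)$ acts on $\mathbb{R}^{2n}=\mathbb{R}^n\oplus\mathbb{R}^n=\{(\vec x,\vec y)\}$ by the product action $(A,B)\cdot(\vec x,\vec y)=(A\vec x,B\vec y)$. A hypersurface $\Sigma$ is invariant if this action maps $\Sigma$ to itself. *)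

theory Defs
  imports "HOL-Analysis.Analysis"
begin

text \<open>The classes \<open>C\<^sup>k\<close> and \<open>C\<^sup>\<infinity>\<close> of maps on an open set; all uses below are for open sets.\<close>

primrec Ck_on :: "nat \<Rightarrow> 'a::euclidean_space set \<Rightarrow> ('a \<Rightarrow> 'b::euclidean_space) \<Rightarrow> bool" where
  "Ck_on 0 U f \<longleftrightarrow> continuous_on U f"
| "Ck_on (Suc k) U f \<longleftrightarrow>
     (\<forall>x\<in>U. f differentiable (at x)) \<and>
     (\<forall>v. Ck_on k U (\<lambda>x. frechet_derivative f (at x) v))"

definition smooth_on :: "'a::euclidean_space set \<Rightarrow> ('a \<Rightarrow> 'b::euclidean_space) \<Rightarrow> bool" where
  "smooth_on U f \<longleftrightarrow> (\<forall>k. Ck_on k U f)"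

text \<open>Following Milnor, a map on an arbitrary subset of a Euclidean space is smooth if near each
  point of the subset it extends to a smooth map on an open set of the ambient space.\<close>

definition smooth_map_on :: "'a::euclidean_space set \<Rightarrow> ('a \<Rightarrow> 'b::euclidean_space) \<Rightarrow> bool" where
  "smooth_map_on S f \<longleftrightarrow>
     (\<forall>p\<in>S. \<exists>U g. open U \<and> p \<in> U \<and> smooth_on U g \<and> (\<forall>x\<in>S \<inter> U. f x = g x))"

definition diffeomorphic :: "'a::euclidean_space set \<Rightarrow> 'b::euclidean_space set \<Rightarrow> bool" where
  "diffeomorphic S T \<longleftrightarrow>
     (\<exists>f g. homeomorphism S T f g \<and> smooth_map_on S f \<and> smooth_map_on T g)"

text \<open>A smooth embedded hypersurface: a subset that is locally diffeomorphic to open subsets of a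
  linear space of codimension one. The neighbourhoods \<open>S \<inter> U\<close> carry the subspace topology,
  so this excludes images of immersions that are not embeddings.\<close>

definition smooth_hypersurface :: "'a::euclidean_space set \<Rightarrow> bool" where
  "smooth_hypersurface S \<longleftrightarrow>
     (\<forall>p\<in>S. \<exists>U (L::'a set) W. open U \<and> p \<in> U \<and>
        subspace L \<and> dim L = DIM('a) - 1 \<and> openin (top_of_set L) W \<and>
        diffeomorphic (S \<inter> U) W)"

definition tangent_space :: "'a::euclidean_space set \<Rightarrow> 'a \<Rightarrow> 'a set" where
  "tangent_space S p =
     {v. \<exists>(\<gamma>::real \<Rightarrow> 'a) \<epsilon>. \<epsilon> > 0 \<and> smooth_on {-\<epsilon><..<\<epsilon>} \<gamma> \<and> \<gamma> ` {-\<epsilon><..<\<epsilon>} \<subseteq> S \<and>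
         \<gamma> 0 = p \<and> (\<gamma> has_vector_derivative v) (at 0)}"

text \<open>The field \<open>\<nu>\<close> is defined on an open subset of the ambient space, but is a unit normal
  only along \<open>S\<close>. Its derivatives in directions tangent to \<open>S\<close> depend only on its values
  on \<open>S\<close>.\<close>

definition unit_normal_on :: "'a::euclidean_space set \<Rightarrow> 'a set \<Rightarrow> ('a \<Rightarrow> 'a) \<Rightarrow> bool" where
  "unit_normal_on S U \<nu> \<longleftrightarrow>
     smooth_on U \<nu> \<and>
     (\<forall>q\<in>S \<inter> U. norm (\<nu> q) = 1 \<and> (\<forall>v\<in>tangent_space S q. \<nu> q \<bullet> v = 0))"

text \<open>The principal curvatures are the eigenvalues of the shape operator \<open>v \<mapsto> D\<^sub>v \<nu>\<close> on the
  tangent space, and the mean curvature is their sum with multiplicities. The second fundamental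
  form is \<open>(v, w) \<mapsto> - (D\<^sub>v \<nu> \<bullet> w) \<nu>\<close>, so the mean curvature vector is \<open>- H \<nu>\<close>; the sphere of
  radius \<open>r\<close> with its outward normal has all principal curvatures equal to \<open>1 / r\<close>.\<close>

definition principal_directions ::
    "'a::euclidean_space set \<Rightarrow> ('a \<Rightarrow> 'a) \<Rightarrow> 'a \<Rightarrow> real \<Rightarrow> 'a set" where
  "principal_directions S \<nu> p \<kappa> =
     {v \<in> tangent_space S p. frechet_derivative \<nu> (at p) v = \<kappa> *\<^sub>R v}"

definition principal_curvatures ::
    "'a::euclidean_space set \<Rightarrow> ('a \<Rightarrow> 'a) \<Rightarrow> 'a \<Rightarrow> real set" where
  "principal_curvatures S \<nu> p = {\<kappa>. \<exists>v\<in>principal_directions S \<nu> p \<kappa>. v \<noteq> 0}"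

definition mean_curvature :: "'a::euclidean_space set \<Rightarrow> ('a \<Rightarrow> 'a) \<Rightarrow> 'a \<Rightarrow> real" where
  "mean_curvature S \<nu> p =
     (\<Sum>\<kappa>\<in>principal_curvatures S \<nu> p. real (dim (principal_directions S \<nu> p \<kappa>)) * \<kappa>)"

text \<open>Along \<open>S\<close> near each point the unit normal is unique up to sign, and the equation
  is unchanged when \<open>\<nu>\<close> is replaced by \<open>-\<nu>\<close>, so the choice of \<open>\<nu>\<close> is immaterial.\<close>

definition self_shrinker :: "'a::euclidean_space set \<Rightarrow> bool" where
  "self_shrinker S \<longleftrightarrow>
     smooth_hypersurface S \<and>
     (\<forall>p\<in>S. \<exists>U \<nu>. open U \<and> p \<in> U \<and> unit_normal_on S U \<nu> \<and>
        mean_curvature S \<nu> p = (p \<bullet> \<nu> p) / 2)"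

text \<open>\<open>\<real>\<^sup>2\<^sup>n = \<real>\<^sup>n \<oplus> \<real>\<^sup>n\<close> is the type \<open>(real^'n) \<times> (real^'n)\<close>, whose inner product is the sum of
  those of the two factors.\<close>

definition SO_SO_invariant :: "((real^'n) \<times> (real^'n)) set \<Rightarrow> bool" where
  "SO_SO_invariant S \<longleftrightarrow>
     (\<forall>A B :: real^'n^'n. rotation_matrix A \<and> rotation_matrix B \<longrightarrow>
        (\<lambda>(x, y). (A *v x, B *v y)) ` S = S)"

end

theory Submission
  imports Defs
begin

text \<open>
  Write \<open>\<bar>x\<bar> = r cos \<theta>\<close>, \<open>\<bar>y\<bar> = r sin \<theta>\<close>, \<open>r = sqrt (2 (2n - 1)) e\<^sup>X\<close>, \<open>\<theta> = Y + \<pi>/4\<close> and \<open>m = n - 1\<close>. An invariant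
  hypersurface is a self-shrinker iff its profile curve in the strip \<open>\<bar>Y\<bar> < \<pi>/4\<close> is a geodesic of the
  conformal metric \<open>E(X) cos (2Y)\<^sup>2\<^sup>m (dX\<^sup>2 + dY\<^sup>2)\<close>, \<open>E(X) = exp (2cX - c e\<^sup>2\<^sup>X)\<close>, \<open>c = 2n - 1\<close>. Geodesics
  are the zero-energy orbits of a Hamiltonian system whose vector field is globally Lipschitz.

  Shoot from \<open>(a, 0)\<close>, \<open>a > 0\<close>, orthogonally to the axis \<open>Y = 0\<close>, and follow the orbit while \<open>X\<close>
  decreases and \<open>Y > 0\<close>. If it returns to the axis orthogonally, the reflection in the axis closes it up
  to an embedded curve around \<open>0\<close>. For large \<open>a\<close> the orbit stays close to the axis (the cone) and
  crosses it while \<open>X\<close> is still decreasing; these \<open>a\<close> form an open set. For small \<open>a\<close>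
  the orbit follows the sphere \<open>X = 0\<close>, is reflected near \<open>Y = \<pi>/4\<close>, and then \<open>X\<close> stops decreasing
  before the axis is reached. If no orbit returned orthogonally, the set of the \<open>a\<close> of the second
  kind would be open as well, contradicting connectedness. The delicate limits are orbits that converge
  to the boundary \<open>Y = \<pi>/4\<close>; there the quantity \<open>J = X'/sqrt E\<close>, the horizontal momentum, is monotone
  on each side of \<open>X = 0\<close>, and its size at the turning point of \<open>Y\<close> decides what happens next.
\<close>

section \<open>Smooth maps\<close>

text \<open>Self-shrinkers are the critical points of the area weighted by exp (- |p|^2 / 4). On an
  invariant hypersurface this becomes, up to a constant, the integral of (|x| |y|)^m exp (- r^2 / 4)
  along the profile curve. As |x| |y| = r^2 cos (2Y) / 2 and lengths in the quarter plane are r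
  times lengths in the (X, Y) strip, the square of the weight is the stated conformal factor up to a
  constant. The scaling of r puts the shrinking sphere at the maximum of E.

  The obstacle is the openness of the starting points that do not cross. Continuous dependence
  controls orbits over bounded times only, whereas an orbit close to one that converges to the
  boundary can turn only after an arbitrarily long time. Most estimates therefore compare J, P or Q
  with X and Y along the orbit, by the monotonicity of suitable combinations, so that the time spent
  does not enter.\<close>

lemma Ck_on_cong:
  assumes "open U" "\<And>x. x \<in> U \<Longrightarrow> f x = g x"
  shows "Ck_on k U f \<longleftrightarrow> Ck_on k U g"
  using assms(2)
proof (induction k arbitrary: f g)
  case 0
  then show ?case by (auto intro: continuous_on_cong)
next
  case (Suc k)
  have d: "(f has_derivative D) (at x) \<longleftrightarrow> (g has_derivative D) (at x)" if "x \<in> U" for x D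
    using has_derivative_transform_within_open[OF _ assms(1) that] Suc.prems by metis
  have fd: "frechet_derivative f (at x) = frechet_derivative g (at x)" if "x \<in> U" for x
    unfolding frechet_derivative_def using d[OF that] by simp
  have "Ck_on k U (\<lambda>x. frechet_derivative f (at x) v) \<longleftrightarrow> Ck_on k U (\<lambda>x. frechet_derivative g (at x) v)" for v
    by (rule Suc.IH) (simp add: fd)
  moreover have "f differentiable (at x) \<longleftrightarrow> g differentiable (at x)" if "x \<in> U" for x
    using d[OF that] by (simp add: differentiable_def)
  ultimately show ?case by auto
qed

lemma Ck_on_subset: "Ck_on k U f \<Longrightarrow> V \<subseteq> U \<Longrightarrow> Ck_on k V f"
  by (induction k arbitrary: f) (auto intro: continuous_on_subset)

lemma Ck_on_SucI:
  assumes "open U" "\<And>x. x \<in> U \<Longrightarrow> (f has_derivative D x) (at x)"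
    and "\<And>v. Ck_on k U (\<lambda>x. D x v)"
  shows "Ck_on (Suc k) U f"
proof -
  have "frechet_derivative f (at x) = D x" if "x \<in> U" for x
    using frechet_derivative_at[OF assms(2)[OF that]] by simp
  then have "Ck_on k U (\<lambda>x. frechet_derivative f (at x) v)" for v
    using Ck_on_cong[OF assms(1), of "\<lambda>x. D x v" "\<lambda>x. frechet_derivative f (at x) v"] assms(3) by auto
  moreover have "\<forall>x\<in>U. f differentiable (at x)" using assms(2) by (auto simp: differentiable_def)
  ultimately show ?thesis by simp
qed

lemma Ck_on_Suc_has_derivative:
  assumes "Ck_on (Suc k) U f" "x \<in> U"
  shows "(f has_derivative frechet_derivative f (at x)) (at x)"
  using assms by (simp add: frechet_derivative_works)

lemma Ck_on_SucD: "Ck_on (Suc k) U f \<Longrightarrow> Ck_on k U f"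
proof (induction k arbitrary: f)
  case 0
  then show ?case
    by (auto intro!: continuous_at_imp_continuous_on differentiable_imp_continuous_within)
next
  case (Suc k)
  have "Ck_on k U (\<lambda>x. frechet_derivative f (at x) v)" for v
    using Suc.IH Suc.prems by (metis Ck_on.simps(2))
  with Suc.prems show ?case by (simp only: Ck_on.simps(2)) blast
qed

lemma Ck_on_const: "open U \<Longrightarrow> Ck_on k U (\<lambda>x. a)"
proof (induction k arbitrary: a)
  case (Suc k)
  show ?case by (rule Ck_on_SucI[where D = "\<lambda>_ _. 0"]) (use Suc in auto)
qed simp

lemma Ck_on_compose_linear:
  assumes "open U" "bounded_linear L"
  shows "Ck_on k U f \<Longrightarrow> Ck_on k U (\<lambda>x. L (f x))"
proof (induction k arbitrary: f)
  case 0
  then show ?case using assms(2) by (auto intro: bounded_linear.continuous_on)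
next
  case (Suc k)
  show ?case
  proof (rule Ck_on_SucI[where D = "\<lambda>x v. L (frechet_derivative f (at x) v)"])
    fix x assume "x \<in> U"
    then show "((\<lambda>x. L (f x)) has_derivative (\<lambda>v. L (frechet_derivative f (at x) v))) (at x)"
      using Ck_on_Suc_has_derivative[OF Suc.prems] by (intro bounded_linear.has_derivative[OF assms(2)]) auto
  qed (use Suc assms in auto)
qed

lemma Ck_on_id: "open U \<Longrightarrow> Ck_on k U (\<lambda>x. x)"
proof (cases k)
  case (Suc j)
  assume "open U"
  then show ?thesis unfolding Suc
    by (intro Ck_on_SucI[where D = "\<lambda>x v. v"] Ck_on_const) auto
qed auto

lemma Ck_on_add:
  assumes "open U"
  shows "Ck_on k U f \<Longrightarrow> Ck_on k U g \<Longrightarrow> Ck_on k U (\<lambda>x. f x + g x)"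
proof (induction k arbitrary: f g)
  case 0
  then show ?case by (auto intro: continuous_on_add)
next
  case (Suc k)
  show ?case
  proof (rule Ck_on_SucI[where D = "\<lambda>x v. frechet_derivative f (at x) v + frechet_derivative g (at x) v"])
    fix x assume "x \<in> U"
    then show "((\<lambda>x. f x + g x) has_derivative
        (\<lambda>v. frechet_derivative f (at x) v + frechet_derivative g (at x) v)) (at x)"
      using Suc.prems by (intro has_derivative_add Ck_on_Suc_has_derivative)
  qed (use Suc assms in auto)
qed

lemma Ck_on_bilinear:
  assumes "open U" "bounded_bilinear B"
  shows "Ck_on k U f \<Longrightarrow> Ck_on k U g \<Longrightarrow> Ck_on k U (\<lambda>x. B (f x) (g x))"
proof (induction k arbitrary: f g)
  case 0
  then show ?case using assms(2) by (auto intro: bounded_bilinear.continuous_on)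
next
  case (Suc k)
  have fk: "Ck_on k U f" "Ck_on k U g" using Suc.prems by (blast dest: Ck_on_SucD)+
  show ?case
  proof (rule Ck_on_SucI[where D = "\<lambda>x v. B (f x) (frechet_derivative g (at x) v) + B (frechet_derivative f (at x) v) (g x)"])
    fix x assume "x \<in> U"
    then show "((\<lambda>x. B (f x) (g x)) has_derivative
        (\<lambda>v. B (f x) (frechet_derivative g (at x) v) + B (frechet_derivative f (at x) v) (g x))) (at x)"
      using Suc.prems by (intro bounded_bilinear.FDERIV[OF assms(2)] Ck_on_Suc_has_derivative)
  next
    fix v show "Ck_on k U (\<lambda>x. B (f x) (frechet_derivative g (at x) v) + B (frechet_derivative f (at x) v) (g x))"
      using Suc.prems fk by (intro Ck_on_add Suc.IH assms(1)) auto
  qed (use assms in auto)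
qed

lemma Ck_on_sum:
  assumes "open U" "\<And>i. i \<in> I \<Longrightarrow> Ck_on k U (f i)"
  shows "Ck_on k U (\<lambda>x. \<Sum>i\<in>I. f i x)"
  using assms(2)
  by (induction I rule: infinite_finite_induct) (auto intro: Ck_on_add Ck_on_const assms(1))

lemma Ck_on_compose:
  assumes "open U" "open V"
  shows "Ck_on k U f \<Longrightarrow> Ck_on k V g \<Longrightarrow> f ` U \<subseteq> V \<Longrightarrow> Ck_on k U (\<lambda>x. g (f x))"
proof (induction k arbitrary: f g)
  case 0
  then show ?case by (auto intro: continuous_on_compose2)
next
  case (Suc k)
  \<comment> \<open>\<open>Ck_on\<close> speaks of derivatives in fixed directions, whereas the
    chain rule differentiates \<open>g\<close> in the direction f'(x) v, which moves with x.
    Expanding that direction in the basis leaves fixed directions with scalar coefficients of class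
    C^k.\<close>
  define D where "D = (\<lambda>x v. \<Sum>b\<in>Basis. (frechet_derivative f (at x) v \<bullet> b) *\<^sub>R frechet_derivative g (at (f x)) b)"
  show ?case
  proof (rule Ck_on_SucI[where D = D])
    fix x assume x: "x \<in> U"
    then have fx: "f x \<in> V" using Suc.prems by auto
    have lin: "linear (frechet_derivative g (at (f x)))"
      using Ck_on_Suc_has_derivative[OF Suc.prems(2) fx] by (rule has_derivative_linear)
    have "((\<lambda>x. g (f x)) has_derivative (\<lambda>v. frechet_derivative g (at (f x)) (frechet_derivative f (at x) v))) (at x)"
      using Ck_on_Suc_has_derivative[OF Suc.prems(2) fx] Ck_on_Suc_has_derivative[OF Suc.prems(1) x]
      by (rule has_derivative_compose[rotated])
    also have "(\<lambda>v. frechet_derivative g (at (f x)) (frechet_derivative f (at x) v)) = D x"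
    proof
      fix v
      let ?w = "frechet_derivative f (at x) v"
      have "frechet_derivative g (at (f x)) ?w = frechet_derivative g (at (f x)) (\<Sum>b\<in>Basis. (?w \<bullet> b) *\<^sub>R b)"
        by (simp add: euclidean_representation)
      also have "\<dots> = D x v" unfolding D_def by (simp add: linear_sum[OF lin] linear_scale[OF lin])
      finally show "frechet_derivative g (at (f x)) ?w = D x v" .
    qed
    finally show "((\<lambda>x. g (f x)) has_derivative D x) (at x)" .
  next
    fix v
    have 1: "Ck_on k U (\<lambda>x. frechet_derivative g (at (f x)) b)" for b
      using Suc.IH[of f "\<lambda>y. frechet_derivative g (at y) b"] Suc.prems(2,3) Ck_on_SucD[OF Suc.prems(1)] by simp
    have 2: "Ck_on k U (\<lambda>x. frechet_derivative f (at x) v \<bullet> b)" for b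
      using Suc.prems by (intro Ck_on_compose_linear[OF assms(1) bounded_linear_inner_left]) auto
    show "Ck_on k U (\<lambda>x. D x v)" unfolding D_def
      using 1 2 by (intro Ck_on_sum assms(1) Ck_on_bilinear[OF assms(1) bounded_bilinear_scaleR])
  qed (use assms in auto)
qed

lemma Ck_on_SucI_real:
  fixes f :: "real \<Rightarrow> 'a::euclidean_space"
  assumes "open U" "\<And>x. x \<in> U \<Longrightarrow> (f has_vector_derivative f' x) (at x)" "Ck_on k U f'"
  shows "Ck_on (Suc k) U f"
proof (rule Ck_on_SucI[where D = "\<lambda>x v. v *\<^sub>R f' x"])
  show "Ck_on k U (\<lambda>x. v *\<^sub>R f' x)" for v
    by (rule Ck_on_compose_linear[OF assms(1) bounded_linear_scaleR_right assms(3)])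
qed (use assms in \<open>auto simp: has_vector_derivative_def\<close>)

lemma smooth_on_cong:
  "open U \<Longrightarrow> (\<And>x. x \<in> U \<Longrightarrow> f x = g x) \<Longrightarrow> smooth_on U f \<longleftrightarrow> smooth_on U g"
  unfolding smooth_on_def using Ck_on_cong by metis

lemma smooth_on_subset: "smooth_on U f \<Longrightarrow> V \<subseteq> U \<Longrightarrow> smooth_on V f"
  unfolding smooth_on_def using Ck_on_subset by blast

lemma smooth_on_imp_continuous_on: "smooth_on U f \<Longrightarrow> continuous_on U f"
  unfolding smooth_on_def using Ck_on.simps(1) by metis

lemma smooth_on_has_derivative:
  "smooth_on U f \<Longrightarrow> x \<in> U \<Longrightarrow> (f has_derivative frechet_derivative f (at x)) (at x)"
  unfolding smooth_on_def using Ck_on_Suc_has_derivative by blast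

lemma smooth_on_const: "open U \<Longrightarrow> smooth_on U (\<lambda>x. a)"
  by (simp add: smooth_on_def Ck_on_const)

lemma smooth_on_id: "open U \<Longrightarrow> smooth_on U (\<lambda>x. x)"
  by (simp add: smooth_on_def Ck_on_id)

lemma smooth_on_compose_linear:
  "bounded_linear L \<Longrightarrow> open U \<Longrightarrow> smooth_on U f \<Longrightarrow> smooth_on U (\<lambda>x. L (f x))"
  by (simp add: smooth_on_def Ck_on_compose_linear)

lemma smooth_on_add:
  "open U \<Longrightarrow> smooth_on U f \<Longrightarrow> smooth_on U g \<Longrightarrow> smooth_on U (\<lambda>x. f x + g x)"
  by (simp add: smooth_on_def Ck_on_add)

lemma smooth_on_bilinear:
  "bounded_bilinear B \<Longrightarrow> open U \<Longrightarrow> smooth_on U f \<Longrightarrow> smooth_on U g \<Longrightarrow> smooth_on U (\<lambda>x. B (f x) (g x))"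
  by (simp add: smooth_on_def Ck_on_bilinear)

lemmas smooth_on_scaleR = smooth_on_bilinear[OF bounded_bilinear_scaleR]
lemmas smooth_on_inner = smooth_on_bilinear[OF bounded_bilinear_inner]
lemmas smooth_on_fst = smooth_on_compose_linear[OF bounded_linear_fst]
lemmas smooth_on_snd = smooth_on_compose_linear[OF bounded_linear_snd]

lemma smooth_on_mult:
  fixes f g :: "'a::euclidean_space \<Rightarrow> real"
  shows "open U \<Longrightarrow> smooth_on U f \<Longrightarrow> smooth_on U g \<Longrightarrow> smooth_on U (\<lambda>x. f x * g x)"
  by (rule smooth_on_bilinear[OF bounded_bilinear_mult])

lemma smooth_on_minus: "open U \<Longrightarrow> smooth_on U f \<Longrightarrow> smooth_on U (\<lambda>x. - f x)"
  by (rule smooth_on_compose_linear[OF bounded_linear_minus[OF bounded_linear_ident]])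

lemma smooth_on_diff:
  "open U \<Longrightarrow> smooth_on U f \<Longrightarrow> smooth_on U g \<Longrightarrow> smooth_on U (\<lambda>x. f x - g x)"
  using smooth_on_add[of U f "\<lambda>x. - g x"] smooth_on_minus[of U g] by simp

lemma smooth_on_Pair:
  assumes "open U" "smooth_on U f" "smooth_on U g"
  shows "smooth_on U (\<lambda>x. (f x, g x))"
proof -
  have "smooth_on U (\<lambda>x. (f x, 0) + (0, g x))"
    using assms bounded_linear_Pair[OF bounded_linear_ident bounded_linear_zero]
      bounded_linear_Pair[OF bounded_linear_zero bounded_linear_ident]
    by (intro smooth_on_add smooth_on_compose_linear[of "\<lambda>x. (x, 0)" U f] smooth_on_compose_linear[of "\<lambda>x. (0, x)" U g])
  then show ?thesis by simp
qed

lemma smooth_on_compose: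
  "open U \<Longrightarrow> open V \<Longrightarrow> smooth_on U f \<Longrightarrow> smooth_on V g \<Longrightarrow> (\<And>x. x \<in> U \<Longrightarrow> f x \<in> V) \<Longrightarrow>
    smooth_on U (\<lambda>x. g (f x))"
  unfolding smooth_on_def using Ck_on_compose[of U V _ f g] by blast

text \<open>Bootstrapping: when the derivative is always at least as regular as the function, as for
  solutions of autonomous equations, each order of regularity yields the next.\<close>

lemma smooth_on_realI:
  fixes f :: "real \<Rightarrow> 'a::euclidean_space"
  assumes "open U" "\<And>x. x \<in> U \<Longrightarrow> (f has_vector_derivative f' x) (at x)"
    and "\<And>k. Ck_on k U f \<Longrightarrow> Ck_on k U f'"
  shows "smooth_on U f"
proof -
  have "Ck_on k U f" for k
  proof (induction k)
    case 0
    then show ?case using assms(2)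
      by (auto intro!: continuous_at_imp_continuous_on dest: has_vector_derivative_continuous)
  next
    case (Suc k)
    show ?case by (rule Ck_on_SucI_real[OF assms(1,2) assms(3)[OF Suc]])
  qed
  then show ?thesis by (simp add: smooth_on_def)
qed

lemma smooth_on_deriv_real:
  fixes f :: "real \<Rightarrow> 'a::euclidean_space"
  assumes "open U" "smooth_on U f" "\<And>x. x \<in> U \<Longrightarrow> (f has_vector_derivative f' x) (at x)"
  shows "smooth_on U f'"
proof -
  have "f' x = frechet_derivative f (at x) 1" if "x \<in> U" for x
    using frechet_derivative_at[of f "\<lambda>v. v *\<^sub>R f' x" x] assms(3)[OF that] unfolding has_vector_derivative_def by (metis scaleR_one)
  moreover have "smooth_on U (\<lambda>x. frechet_derivative f (at x) 1)"
    using assms(2) unfolding smooth_on_def by (metis Ck_on.simps(2))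
  ultimately show ?thesis using smooth_on_cong[OF assms(1)] by (metis (no_types, lifting))
qed

section \<open>Elementary real functions and closure rules\<close>

lemma smooth_on_exp': "smooth_on UNIV (exp :: real \<Rightarrow> real)"
  by (rule smooth_on_realI[where f' = exp]) (auto simp flip: has_real_derivative_iff_has_vector_derivative)

text \<open>The derivative of the pair is a linear image of the pair, so bootstrapping applies to
  both functions at once.\<close>

lemma smooth_on_sin_cos':
  "smooth_on UNIV (sin :: real \<Rightarrow> real)" "smooth_on UNIV (cos :: real \<Rightarrow> real)"
proof -
  have "smooth_on UNIV (\<lambda>t::real. (sin t, cos t))"
  proof (rule smooth_on_realI[where f' = "\<lambda>t. (cos t, - sin t)"])
    fix k assume "Ck_on k UNIV (\<lambda>t::real. (sin t, cos t))"
    moreover have "bounded_linear (\<lambda>z::real \<times> real. (snd z, - fst z))"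
      by (intro bounded_linear_Pair bounded_linear_minus bounded_linear_fst bounded_linear_snd)
    ultimately show "Ck_on k UNIV (\<lambda>t::real. (cos t, - sin t))"
      using Ck_on_compose_linear[of UNIV "\<lambda>z. (snd z, - fst z)" k "\<lambda>t::real. (sin t, cos t)"] by simp
    next
    fix t :: real
    have "(sin has_vector_derivative cos t) (at t)" "(cos has_vector_derivative - sin t) (at t)"
      unfolding has_real_derivative_iff_has_vector_derivative[symmetric]
      by (auto intro!: derivative_eq_intros)
    then show "((\<lambda>t. (sin t, cos t)) has_vector_derivative (cos t, - sin t)) (at t)"
      by (rule has_vector_derivative_Pair)
  qed auto
  from smooth_on_fst[OF _ this] smooth_on_snd[OF _ this]
  show "smooth_on UNIV (sin :: real \<Rightarrow> real)" "smooth_on UNIV (cos :: real \<Rightarrow> real)" by simp_all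
qed

lemma smooth_on_inverse': "smooth_on (- {0}) (inverse :: real \<Rightarrow> real)"
proof (rule smooth_on_realI[where f' = "\<lambda>x. - (inverse x * inverse x)"])
  fix k assume k: "Ck_on k (- {0}) (inverse :: real \<Rightarrow> real)"
  show "Ck_on k (- {0}) (\<lambda>x::real. - (inverse x * inverse x))"
    by (rule Ck_on_compose_linear[OF _ bounded_linear_minus[OF bounded_linear_ident]
          Ck_on_bilinear[OF _ bounded_bilinear_mult k k]]) auto
next
  fix x :: real assume "x \<in> -{0}"
  then show "(inverse has_vector_derivative - (inverse x * inverse x)) (at x)"
    unfolding has_real_derivative_iff_has_vector_derivative[symmetric] using DERIV_inverse'[OF DERIV_ident, of x UNIV] by simp
qed auto

lemma smooth_on_sqrt': "smooth_on {0<..} sqrt"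
proof (rule smooth_on_realI[where f' = "\<lambda>x. inverse (sqrt x) * (1/2)"])
  fix k assume k: "Ck_on k {0<..} sqrt"
  have "Ck_on k (-{0}) (inverse :: real \<Rightarrow> real)" using smooth_on_inverse' by (simp add: smooth_on_def)
  then have "Ck_on k {0<..} (\<lambda>x. inverse (sqrt x))"
    by (intro Ck_on_compose[OF _ _ k, of "-{0}" inverse]) auto
  then show "Ck_on k {0<..} (\<lambda>x. inverse (sqrt x) * (1/2))"
    by (intro Ck_on_bilinear[OF _ bounded_bilinear_mult] Ck_on_const) auto
next
  fix x :: real assume "x \<in> {0<..}"
  then show "(sqrt has_vector_derivative inverse (sqrt x) * (1/2)) (at x)"
    unfolding has_real_derivative_iff_has_vector_derivative[symmetric] using DERIV_real_sqrt[of x] by (simp add: field_simps)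
qed auto

lemma smooth_on_exp: "open U \<Longrightarrow> smooth_on U f \<Longrightarrow> smooth_on U (\<lambda>x. exp (f x :: real))"
  by (rule smooth_on_compose[OF _ open_UNIV _ smooth_on_exp']) auto

lemma smooth_on_sin: "open U \<Longrightarrow> smooth_on U f \<Longrightarrow> smooth_on U (\<lambda>x. sin (f x :: real))"
  by (rule smooth_on_compose[OF _ open_UNIV _ smooth_on_sin_cos'(1)]) auto

lemma smooth_on_cos: "open U \<Longrightarrow> smooth_on U f \<Longrightarrow> smooth_on U (\<lambda>x. cos (f x :: real))"
  by (rule smooth_on_compose[OF _ open_UNIV _ smooth_on_sin_cos'(2)]) auto

lemma smooth_on_inverse:
  "open U \<Longrightarrow> smooth_on U f \<Longrightarrow> (\<And>x. x \<in> U \<Longrightarrow> f x \<noteq> 0) \<Longrightarrow> smooth_on U (\<lambda>x. inverse (f x :: real))"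
  by (rule smooth_on_compose[OF _ _ _ smooth_on_inverse']) auto

lemma smooth_on_divide:
  "open U \<Longrightarrow> smooth_on U f \<Longrightarrow> smooth_on U g \<Longrightarrow> (\<And>x. x \<in> U \<Longrightarrow> g x \<noteq> 0) \<Longrightarrow> smooth_on U (\<lambda>x. f x / g x :: real)"
  unfolding divide_inverse by (intro smooth_on_mult smooth_on_inverse)

lemma smooth_on_sqrt:
  "open U \<Longrightarrow> smooth_on U f \<Longrightarrow> (\<And>x. x \<in> U \<Longrightarrow> f x > 0) \<Longrightarrow> smooth_on U (\<lambda>x. sqrt (f x))"
  by (rule smooth_on_compose[OF _ _ _ smooth_on_sqrt']) auto

lemma smooth_on_norm:
  "open U \<Longrightarrow> smooth_on U f \<Longrightarrow> (\<And>x. x \<in> U \<Longrightarrow> f x \<noteq> 0) \<Longrightarrow> smooth_on U (\<lambda>x. norm (f x))"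
  unfolding norm_eq_sqrt_inner by (intro smooth_on_sqrt smooth_on_inner) auto

lemma smooth_on_power:
  "open U \<Longrightarrow> smooth_on U f \<Longrightarrow> smooth_on U (\<lambda>x. (f x :: real) ^ k)"
  by (induction k) (auto intro: smooth_on_const smooth_on_mult)

lemmas smooth_on_intros = smooth_on_const smooth_on_id smooth_on_add smooth_on_diff smooth_on_minus
  smooth_on_mult smooth_on_scaleR smooth_on_inner smooth_on_Pair smooth_on_fst smooth_on_snd
  smooth_on_exp smooth_on_sin smooth_on_cos smooth_on_divide smooth_on_sqrt smooth_on_norm smooth_on_power

lemma smooth_on_autonomous_solution:
  assumes "smooth_on UNIV F" "\<And>t. (u has_vector_derivative F (u t)) (at t)"
  shows "smooth_on UNIV u"
proof (rule smooth_on_realI[where f' = "\<lambda>t. F (u t)"])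
  show "Ck_on k UNIV (\<lambda>t. F (u t))" if "Ck_on k UNIV u" for k
    using assms(1) that unfolding smooth_on_def by (intro Ck_on_compose[OF open_UNIV open_UNIV, of k u F]) auto
qed (use assms(2) in auto)

text \<open>The derivative of the inverse is inverse (f' (g v)), a smooth function of
  \<open>g\<close> itself, so bootstrapping starts from mere continuity of \<open>g\<close>.\<close>

lemma smooth_on_inverse_function:
  fixes f g :: "real \<Rightarrow> real"
  assumes "open I" "open V" "smooth_on I f" "\<And>t. t \<in> I \<Longrightarrow> (f has_real_derivative f' t) (at t)"
    and nz: "\<And>t. t \<in> I \<Longrightarrow> f' t \<noteq> 0" and gI: "\<And>v. v \<in> V \<Longrightarrow> g v \<in> I"
    and fg: "\<And>v. v \<in> V \<Longrightarrow> f (g v) = v" and "continuous_on V g"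
  shows "smooth_on V g"
proof (rule smooth_on_realI[where f' = "\<lambda>v. inverse (f' (g v))"])
  fix v assume v: "v \<in> V"
  then obtain e where e: "e > 0" "ball v e \<subseteq> V" using assms(2) open_contains_ball by blast
  have "isCont g v" using assms(2,8) v continuous_on_eq_continuous_at by blast
  then have "(g has_real_derivative inverse (f' (g v))) (at v)"
    using e v by (intro DERIV_inverse_function[where a = "v - e" and b = "v + e" and f = f])
      (auto intro!: assms(4) nz gI fg simp: subset_eq dist_real_def)
  then show "(g has_vector_derivative inverse (f' (g v))) (at v)"
    by (simp add: has_real_derivative_iff_has_vector_derivative)
next
  fix k assume k: "Ck_on k V g"
  have "smooth_on I f'"
    by (rule smooth_on_deriv_real[OF assms(1,3)]) (use assms(4) in \<open>simp add: has_real_derivative_iff_has_vector_derivative\<close>)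
  then have "smooth_on I (\<lambda>t. inverse (f' t))" by (intro smooth_on_inverse assms(1) nz)
  then have "Ck_on k I (\<lambda>t. inverse (f' t))" by (simp add: smooth_on_def)
  then show "Ck_on k V (\<lambda>v. inverse (f' (g v)))"
    by (intro Ck_on_compose[OF assms(2,1) k, of "\<lambda>t. inverse (f' t)"]) (auto simp: gI)
qed (use assms in auto)

lemma smooth_map_onI: "open U \<Longrightarrow> smooth_on U f \<Longrightarrow> S \<subseteq> U \<Longrightarrow> smooth_map_on S f"
  unfolding smooth_map_on_def by blast

section \<open>Flows of Lipschitz vector fields\<close>

text \<open>Banach's fixed point theorem for \<open>v t = exp (- K t) u t\<close>: in this weighted norm the Picard
  operator contracts on the whole half-line.\<close>

lemma lipschitz_forward_solution:
  fixes F :: "'a::euclidean_space \<Rightarrow> 'a"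
  assumes "L-lipschitz_on UNIV F"
  obtains u where "u 0 = z" "\<And>t. t \<ge> 0 \<Longrightarrow> (u has_vector_derivative F (u t)) (at t within {0..})"
proof -
  have L0: "L \<ge> 0" and lip: "\<And>a b. norm (F a - F b) \<le> L * norm (a - b)"
    using assms by (auto simp: lipschitz_on_def dist_norm)
  \<comment> \<open>The weight exp (- K t) replaces the Lipschitz constant by L / K, at most 1/2 for
    this K. Moreover K \<ge> 1 gives t \<le> exp (K t), which absorbs the linear growth caused by
    \<open>F 0\<close>.\<close>
  define K where "K = 2 * L + 1"
  have K: "K > 0" "L / K \<le> 1/2" "K \<ge> 1" using L0 by (auto simp: K_def field_simps)
  have cF: "continuous_on UNIV F" by (rule lipschitz_on_continuous_on[OF assms])
  define G where "G = (\<lambda>v t. exp (- (K * t)) *\<^sub>R (z + integral {0..t} (\<lambda>r. F (exp (K * r) *\<^sub>R v r))))"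
  have cint: "continuous_on UNIV (\<lambda>r. F (exp (K * r) *\<^sub>R v r))" if "continuous_on UNIV v" for v
    using that by (intro continuous_on_compose2[OF cF] continuous_intros) auto
  have cfin: "(\<lambda>r. F (exp (K * r) *\<^sub>R v r)) integrable_on {a..b}" if "continuous_on UNIV v" for v a b
    using cint[OF that] by (intro integrable_continuous_interval) (auto intro: continuous_on_subset)
  have expint: "((\<lambda>r. C * exp (K * r)) has_integral (C / K) * (exp (K * t) - 1)) {0..t}" if "t \<ge> 0" for C t
  proof -
    have "((\<lambda>r. C * exp (K * r)) has_integral ((C / K) * exp (K * t) - (C / K) * exp (K * 0))) {0..t}"
      using K that by (intro fundamental_theorem_of_calculus)
        (auto intro!: derivative_eq_intros simp flip: has_real_derivative_iff_has_vector_derivative)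
    then show ?thesis by (simp add: algebra_simps)
  qed
  have bd: "norm (G v t) \<le> norm z + norm (F 0) + (L / K) * M"
    if cv: "continuous_on UNIV v" and M: "\<And>r. norm (v r) \<le> M" and t: "t \<ge> 0" for v t M
  proof -
    have M0: "M \<ge> 0" using M[of 0] norm_ge_zero order_trans by blast
    have "norm (integral {0..t} (\<lambda>r. F (exp (K * r) *\<^sub>R v r))) \<le>
        integral {0..t} (\<lambda>r. norm (F 0) + (L * M) * exp (K * r))"
    proof (rule integral_norm_bound_integral)
      show "(\<lambda>r. norm (F 0) + L * M * exp (K * r)) integrable_on {0..t}"
        by (intro integrable_continuous_interval continuous_intros)
      fix r
      have "norm (F (exp (K * r) *\<^sub>R v r)) \<le> norm (F 0) + norm (F (exp (K * r) *\<^sub>R v r) - F 0)"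
        by (metis add.commute diff_add_cancel norm_triangle_ineq)
      also have "norm (F (exp (K * r) *\<^sub>R v r) - F 0) \<le> L * (exp (K * r) * norm (v r))"
        using lip[of "exp (K * r) *\<^sub>R v r" 0] by simp
      also have "\<dots> \<le> L * (exp (K * r) * M)" using M[of r] L0 by (intro mult_left_mono) auto
      finally show "norm (F (exp (K * r) *\<^sub>R v r)) \<le> norm (F 0) + L * M * exp (K * r)"
        by (simp add: mult_ac)
    qed (rule cfin[OF cv])
    also have "\<dots> = t * norm (F 0) + (L * M / K) * (exp (K * t) - 1)"
      using has_integral_add[OF has_integral_const_real[of "norm (F 0)" 0 t] expint[OF t, of "L * M"]] t
      by (intro integral_unique) (simp add: mult_ac)
    finally have A: "norm (integral {0..t} (\<lambda>r. F (exp (K * r) *\<^sub>R v r))) \<le> t * norm (F 0) + (L * M / K) * (exp (K * t) - 1)" .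
    have e: "exp (- (K * t)) * exp (K * t) = 1" by (simp flip: exp_add)
    have e1: "exp (- (K * t)) \<le> 1" using K t by simp
    have "t \<le> exp (K * t)"
    proof -
      have "1 + K * t \<le> exp (K * t)" by (rule exp_ge_add_one_self)
      moreover have "t \<le> K * t" using K(3) t by (simp add: mult_le_cancel_right1)
      ultimately show ?thesis by linarith
    qed
    then have e2: "exp (- (K * t)) * t \<le> 1" using e by (metis exp_ge_zero mult_left_mono)
    have "norm (G v t) \<le> exp (- (K * t)) * (norm z + norm (integral {0..t} (\<lambda>r. F (exp (K * r) *\<^sub>R v r))))"
      unfolding G_def by (simp add: norm_triangle_ineq)
    also have "\<dots> \<le> exp (- (K * t)) * (norm z + (t * norm (F 0) + (L * M / K) * (exp (K * t) - 1)))"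
      using A by (intro mult_left_mono) auto
    also have "\<dots> = exp (- (K * t)) * norm z + (exp (- (K * t)) * t) * norm (F 0)
        + (L * M / K) * (exp (- (K * t)) * exp (K * t) - exp (- (K * t)))" by (simp add: algebra_simps)
    also have "\<dots> \<le> 1 * norm z + 1 * norm (F 0) + (L * M / K) * 1"
      using e1 e2 L0 K M0 unfolding e by (intro add_mono mult_right_mono mult_left_mono) auto
    finally show ?thesis by simp
  qed
  have cG: "continuous_on {0..} (G v)" if "continuous_on UNIV v" for v
  proof -
    have cI: "continuous_on {0..b} (\<lambda>t. integral {0..t} (\<lambda>r. F (exp (K * r) *\<^sub>R v r)))" for b
      by (rule indefinite_integral_continuous_1[OF cfin[OF that]])
    then have "continuous (at t within {0..}) (\<lambda>t. integral {0..t} (\<lambda>r. F (exp (K * r) *\<^sub>R v r)))" if "t \<ge> 0" for t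
    proof -
      have "continuous (at t within {0..t+1}) (\<lambda>t. integral {0..t} (\<lambda>r. F (exp (K * r) *\<^sub>R v r)))"
        using cI[of "t+1"] that by (simp add: continuous_on_eq_continuous_within)
      moreover have "at t within {0..t+1} = at t within {0..}"
        by (rule at_within_nhd[of t "{..<t+1}"]) auto
      ultimately show ?thesis by simp
    qed
    then show ?thesis unfolding G_def
      by (intro continuous_intros) (auto simp: continuous_on_eq_continuous_within)
  qed
  \<comment> \<open>Elements of the bounded continuous function space live on all of the reals.
    Clamping the time at 0 extends the Picard image constantly to negative times; only t \<ge> 0 is
    read off later.\<close>
  define H where "H = (\<lambda>v::real \<Rightarrow>\<^sub>C 'a. Bcontfun (\<lambda>t. G (apply_bcontfun v) (max 0 t)))"
  have bc: "(\<lambda>t. G (apply_bcontfun v) (max 0 t)) \<in> bcontfun" for v :: "real \<Rightarrow>\<^sub>C 'a"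
  proof (rule bcontfun_normI)
    show "continuous_on UNIV (\<lambda>t. G (apply_bcontfun v) (max 0 t))"
      by (rule continuous_on_compose2[OF cG]) (auto intro!: continuous_intros)
    show "norm (G (apply_bcontfun v) (max 0 t)) \<le> norm z + norm (F 0) + (L / K) * norm v" for t
      by (rule bd) (auto simp: norm_bounded)
  qed
  have Happ: "apply_bcontfun (H v) t = G (apply_bcontfun v) (max 0 t)" for v t
    unfolding H_def using Bcontfun_inverse[OF bc] by metis
  have contr: "dist (H v) (H w) \<le> 1/2 * dist v w" for v w
  proof (rule dist_bound)
    fix t0 :: real define t where "t = max 0 t0"
    have t: "t \<ge> 0" by (simp add: t_def)
    let ?f = "\<lambda>v r. F (exp (K * r) *\<^sub>R apply_bcontfun v r)"
    have "G v t - G w t = exp (- (K * t)) *\<^sub>R (integral {0..t} (?f v) - integral {0..t} (?f w))"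
      by (simp add: G_def algebra_simps)
    also have "\<dots> = exp (- (K * t)) *\<^sub>R integral {0..t} (\<lambda>r. ?f v r - ?f w r)"
      using cfin by (subst integral_diff) auto
    finally have "norm (G v t - G w t) = exp (- (K * t)) * norm (integral {0..t} (\<lambda>r. ?f v r - ?f w r))"
      by simp
    also have "norm (integral {0..t} (\<lambda>r. ?f v r - ?f w r)) \<le> integral {0..t} (\<lambda>r. (L * dist v w) * exp (K * r))"
    proof (rule integral_norm_bound_integral)
      show "(\<lambda>r. ?f v r - ?f w r) integrable_on {0..t}"
        by (intro integrable_diff cfin) auto
      show "(\<lambda>r. L * dist v w * exp (K * r)) integrable_on {0..t}"
        by (intro integrable_continuous_interval continuous_intros)
      fix r
      have "norm (?f v r - ?f w r) \<le> L * norm (exp (K * r) *\<^sub>R (apply_bcontfun v r - apply_bcontfun w r))"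
        using lip by (simp add: scaleR_diff_right)
      also have "\<dots> = L * (exp (K * r) * dist (apply_bcontfun v r) (apply_bcontfun w r))" by (simp add: dist_norm)
      also have "\<dots> \<le> L * (exp (K * r) * dist v w)"
        using L0 by (intro mult_left_mono dist_bounded) auto
      finally show "norm (?f v r - ?f w r) \<le> L * dist v w * exp (K * r)" by (simp add: mult_ac)
    qed
    also have "integral {0..t} (\<lambda>r. (L * dist v w) * exp (K * r)) = (L * dist v w / K) * (exp (K * t) - 1)"
      by (rule integral_unique[OF expint[OF t]])
    finally have "norm (G v t - G w t) \<le> exp (- (K * t)) * ((L * dist v w / K) * (exp (K * t) - 1))"
      by (simp add: mult_left_mono)
    also have "\<dots> = (L / K) * dist v w * (exp (- (K * t)) * exp (K * t) - exp (- (K * t)))"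
      by (simp add: right_diff_distrib diff_divide_distrib mult_ac)
    also have "\<dots> \<le> (L / K) * dist v w * 1"
      using L0 K by (intro mult_left_mono) (auto simp flip: exp_add)
    also have "\<dots> \<le> 1/2 * dist v w" using mult_right_mono[OF K(2), of "dist v w"] by simp
    finally show "dist (apply_bcontfun (H v) t0) (apply_bcontfun (H w) t0) \<le> 1/2 * dist v w"
      unfolding Happ dist_norm t_def .
  qed
  obtain v where v: "H v = v"
    using banach_fix_type[of "1/2" H] contr by auto
  define u where "u = (\<lambda>t. exp (K * t) *\<^sub>R apply_bcontfun v t)"
  have ueq: "u t = z + integral {0..t} (\<lambda>r. F (u r))" if "t \<ge> 0" for t
  proof -
    have "apply_bcontfun v t = G v t" using Happ[of v t] v that by simp
    then show ?thesis unfolding u_def G_def by (simp flip: exp_add)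
  qed
  show ?thesis
  proof
    show "u 0 = z" using ueq[of 0] by simp
    fix t :: real assume t: "t \<ge> 0"
    have cu: "continuous_on UNIV (\<lambda>r. F (u r))" unfolding u_def by (rule cint) simp
    have "((\<lambda>t. z + integral {0..t} (\<lambda>r. F (u r))) has_vector_derivative F (u t)) (at t within {0..t+1})"
      using integral_has_vector_derivative[OF continuous_on_subset[OF cu], of 0 "t+1" t] t
      by (auto intro!: derivative_eq_intros)
    then have "(u has_vector_derivative F (u t)) (at t within {0..t+1})"
      using t by (rule_tac has_vector_derivative_transform[rotated 2]) (auto simp: ueq)
    moreover have "at t within {0..t+1} = at t within {0..}"
      by (rule at_within_nhd[of t "{..<t+1}"]) auto
    ultimately show "(u has_vector_derivative F (u t)) (at t within {0..})" by simp
  qed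
qed

text \<open>The past of an orbit is the future of the orbit of - F through the same point. At time 0
  the two one-sided derivatives agree and combine to a two-sided one.\<close>

lemma lipschitz_solution:
  fixes F :: "'a::euclidean_space \<Rightarrow> 'a"
  assumes "L-lipschitz_on UNIV F"
  obtains u where "u 0 = z" "\<And>t. (u has_vector_derivative F (u t)) (at t)"
proof -
  obtain u where u: "u 0 = z" "\<And>t. t \<ge> 0 \<Longrightarrow> (u has_vector_derivative F (u t)) (at t within {0..})"
    using lipschitz_forward_solution[OF assms] by blast
  have "L-lipschitz_on UNIV (\<lambda>x. - F x)" using assms by (simp add: lipschitz_on_def dist_norm norm_minus_commute)
  then obtain v where v: "v 0 = z" "\<And>t. t \<ge> 0 \<Longrightarrow> (v has_vector_derivative - F (v t)) (at t within {0..})"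
    using lipschitz_forward_solution[of L "\<lambda>x. - F x"] by blast
  define w where "w = (\<lambda>t. if t \<ge> 0 then u t else v (- t))"
  have right: "(w has_vector_derivative F (w t)) (at t within {0..})" if "t \<ge> 0" for t
    using that u(2)[OF that] by (auto simp: w_def intro: has_vector_derivative_transform[rotated 2])
  have left: "(w has_vector_derivative F (w t)) (at t within {..0})" if "t \<le> 0" for t
  proof -
    have "(v has_vector_derivative - F (v (-t))) (at (-t) within uminus ` {..0})"
      using v(2)[of "-t"] that by simp
    then have "((\<lambda>t. v (- t)) has_vector_derivative F (v (-t))) (at t within {..0})"
      using vector_diff_chain_within[of uminus "-1" t "{..0}" v "- F (v (- t))"]
        has_vector_derivative_minus[OF has_vector_derivative_id[of "at t within {..0}"]] by (simp add: o_def)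
    moreover have "v (- s) = w s" if "s \<le> 0" for s using that v(1) u(1) by (auto simp: w_def)
    ultimately show ?thesis using that by (auto intro: has_vector_derivative_transform[rotated 2])
  qed
  have "(w has_vector_derivative F (w t)) (at t)" for t
  proof -
    consider "t > 0" | "t < 0" | "t = 0" by linarith
    then show ?thesis
    proof cases
      case 1
      then have "at t within {0..} = at t" by (intro at_within_interior) auto
      then show ?thesis using right[of t] 1 by simp
    next
      case 2
      then have "at t within {..0} = at t" by (intro at_within_interior) auto
      then show ?thesis using left[of t] 2 by simp
    next
      case 3
      have "(w has_derivative (\<lambda>h. h *\<^sub>R F (w 0))) (at 0 within ({..0} \<union> {0..}))"
        using left[of 0] right[of 0] unfolding has_vector_derivative_def has_derivative_within by (auto intro: Lim_Un)
      moreover have "{..0::real} \<union> {0..} = UNIV" by auto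
      ultimately show ?thesis using 3 by (simp add: has_vector_derivative_def)
    qed
  qed
  moreover have "w 0 = z" using u by (simp add: w_def)
  ultimately show ?thesis using that by blast
qed

text \<open>Gronwall's estimate. The squared distance is used because it is differentiable even
  where the solutions meet; multiplied by exp (- 2 L t) it is nonincreasing by the Cauchy-Schwarz
  inequality.\<close>

lemma lipschitz_solutions_dist_forward:
  fixes F :: "'a::euclidean_space \<Rightarrow> 'a"
  assumes "L-lipschitz_on UNIV F" "s \<le> t"
    and u: "\<And>t. (u has_vector_derivative F (u t)) (at t)"
    and v: "\<And>t. (v has_vector_derivative F (v t)) (at t)"
  shows "dist (u t) (v t) \<le> exp (L * (t - s)) * dist (u s) (v s)"
proof -
  define h where "h = (\<lambda>t. exp (- (2 * L * t)) * ((u t - v t) \<bullet> (u t - v t)))"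
  have "h t \<le> h s"
  proof (rule DERIV_nonpos_imp_nonincreasing[OF assms(2)])
    fix r
    have d: "((\<lambda>t. u t - v t) has_vector_derivative F (u r) - F (v r)) (at r)"
      by (intro has_vector_derivative_diff u v)
    have d2: "((\<lambda>t. (u t - v t) \<bullet> (u t - v t)) has_real_derivative 2 * ((u r - v r) \<bullet> (F (u r) - F (v r)))) (at r)"
      using bounded_bilinear.has_vector_derivative[OF bounded_bilinear_inner d d]
      by (simp add: has_real_derivative_iff_has_vector_derivative inner_commute)
    have "(h has_real_derivative exp (- (2 * L * r)) *
        (2 * ((u r - v r) \<bullet> (F (u r) - F (v r))) - 2 * L * ((u r - v r) \<bullet> (u r - v r)))) (at r)"
    proof -
      have e: "((\<lambda>t. exp (- (2 * L * t))) has_real_derivative exp (- (2 * L * r)) * (- (2 * L))) (at r)"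
        by (auto intro!: derivative_eq_intros)
      show ?thesis unfolding h_def
        by (rule DERIV_cong[OF DERIV_mult[OF e d2]]) (simp add: algebra_simps)
    qed
    moreover have "(u r - v r) \<bullet> (F (u r) - F (v r)) \<le> L * ((u r - v r) \<bullet> (u r - v r))"
    proof -
      have "(u r - v r) \<bullet> (F (u r) - F (v r)) \<le> norm (u r - v r) * norm (F (u r) - F (v r))"
        by (rule norm_cauchy_schwarz)
      also have "\<dots> \<le> norm (u r - v r) * (L * norm (u r - v r))"
        using assms(1) by (intro mult_left_mono) (auto simp: lipschitz_on_def dist_norm)
      finally show ?thesis by (simp add: power2_norm_eq_inner[symmetric] power2_eq_square mult_ac)
    qed
    ultimately show "\<exists>y. (h has_real_derivative y) (at r) \<and> y \<le> 0"
      by (rule_tac exI, rule_tac conjI) (assumption, simp add: mult_le_0_iff)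
  qed
  then have "exp (- (2 * L * t)) * (dist (u t) (v t))\<^sup>2 \<le> exp (- (2 * L * s)) * (dist (u s) (v s))\<^sup>2"
    by (simp add: h_def dist_norm power2_norm_eq_inner)
  then have "exp (2 * L * t) * (exp (- (2 * L * t)) * (dist (u t) (v t))\<^sup>2) \<le>
     exp (2 * L * t) * (exp (- (2 * L * s)) * (dist (u s) (v s))\<^sup>2)"
    by (intro mult_left_mono) auto
  then have "(dist (u t) (v t))\<^sup>2 \<le> (exp (L * (t - s)) * dist (u s) (v s))\<^sup>2"
    unfolding mult.assoc[symmetric] by (simp add: power_mult_distrib exp_double[symmetric] algebra_simps flip: exp_add)
  then show ?thesis by (rule power2_le_imp_le) simp
qed

lemma lipschitz_solutions_dist_backward:
  fixes F :: "'a::euclidean_space \<Rightarrow> 'a"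
  assumes "L-lipschitz_on UNIV F" "s \<le> t"
    and u: "\<And>t. (u has_vector_derivative F (u t)) (at t)"
    and v: "\<And>t. (v has_vector_derivative F (v t)) (at t)"
  shows "dist (u s) (v s) \<le> exp (L * (t - s)) * dist (u t) (v t)"
proof -
  have rev: "((\<lambda>t. w (- t)) has_vector_derivative - F (w (- t))) (at t)"
    if "\<And>t. (w has_vector_derivative F (w t)) (at t)" for w t
    using vector_diff_chain_at[of uminus "-1" t w "F (w (- t))"] that
      has_vector_derivative_minus[OF has_vector_derivative_id[of "at t"]] by (simp add: o_def)
  have "L-lipschitz_on UNIV (\<lambda>x. - F x)" using assms(1) by (simp add: lipschitz_on_def dist_norm norm_minus_commute)
  from lipschitz_solutions_dist_forward[OF this, of "- t" "- s" "\<lambda>t. u (- t)" "\<lambda>t. v (- t)"] rev[OF u] rev[OF v] assms(2)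
  show ?thesis by simp
qed

lemma lipschitz_solution_unique:
  fixes F :: "'a::euclidean_space \<Rightarrow> 'a"
  assumes "L-lipschitz_on UNIV F"
    and u: "\<And>t. (u has_vector_derivative F (u t)) (at t)"
    and v: "\<And>t. (v has_vector_derivative F (v t)) (at t)"
    and "u s = v s"
  shows "u t = v t"
  using lipschitz_solutions_dist_forward[OF assms(1) _ u v, of s t]
    lipschitz_solutions_dist_backward[OF assms(1) _ u v, of t s] assms(4)
  by (cases "s \<le> t") auto

section \<open>Closed curves and rotational hypersurfaces\<close>

lemma smooth_map_on_imp_continuous_on:
  assumes "smooth_map_on S f"
  shows "continuous_on S f"
  unfolding continuous_on_eq_continuous_within
proof
  fix p assume p: "p \<in> S"
  then obtain U g where U: "open U" "p \<in> U" "smooth_on U g" "\<forall>x\<in>S \<inter> U. f x = g x"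
    using assms unfolding smooth_map_on_def by blast
  have "isCont g p" using smooth_on_imp_continuous_on[OF U(3)] U continuous_on_eq_continuous_at by blast
  then have "(g \<longlongrightarrow> g p) (at p within S)" unfolding isCont_def by (rule tendsto_within_subset) simp
  moreover have "\<forall>\<^sub>F x in at p within S. g x = f x"
    unfolding eventually_at_topological using U by (intro exI[of _ U]) auto
  ultimately have "(f \<longlongrightarrow> g p) (at p within S)" by (rule Lim_transform_eventually)
  then show "continuous (at p within S) f" using U p by (simp add: continuous_within)
qed

section \<open>Regular simple closed curves\<close>

text \<open>\<open>eq_iff\<close> encodes both periodicity and simplicity: parameters are identified
  exactly when they differ by a multiple of \<open>p\<close>, so the trace is an embedded
  circle.\<close>

locale closed_curve =
  fixes \<gamma> \<gamma>' :: "real \<Rightarrow> 'a::euclidean_space" and p :: real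
  assumes smooth: "smooth_on UNIV \<gamma>"
    and deriv: "\<And>t. (\<gamma> has_vector_derivative \<gamma>' t) (at t)"
    and regular: "\<And>t. \<gamma>' t \<noteq> 0"
    and period_pos: "p > 0"
    and eq_iff: "\<And>s t. \<gamma> s = \<gamma> t \<longleftrightarrow> (\<exists>k::int. s = t + of_int k * p)"
begin

lemma shift_into:
  obtains s where "\<gamma> s = \<gamma> t" "t0 \<le> s" "s < t0 + p"
proof
  define k where "k = \<lfloor>(t - t0) / p\<rfloor>"
  have "of_int k \<le> (t - t0) / p" "(t - t0) / p < of_int k + 1" by (simp_all add: k_def)
  then have "of_int k * p \<le> t - t0" "t - t0 < (of_int k + 1) * p"
    using period_pos by (simp_all add: field_simps)
  then show "t0 \<le> t - of_int k * p" "t - of_int k * p < t0 + p" by (simp_all add: algebra_simps)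
  have "t - of_int k * p = t + of_int (- k) * p" by simp
  then show "\<gamma> (t - of_int k * p) = \<gamma> t" using eq_iff by blast
qed

lemma eq_imp_eq:
  assumes "\<gamma> s = \<gamma> t" "\<bar>s - t\<bar> < p"
  shows "s = t"
proof -
  obtain k :: int where k: "s = t + of_int k * p" using assms eq_iff by blast
  then have "\<bar>of_int k\<bar> * p < 1 * p" using assms(2) period_pos by (simp add: abs_mult)
  then have "\<bar>of_int k :: real\<bar> < 1" using period_pos by (simp only: mult_less_cancel_right)
  then have "k = 0" by linarith
  then show ?thesis using k by simp
qed

text \<open>Along a short arc around \<open>t0\<close> the functional \<open>lf\<close> is
  injective, and its inverse is the parameter \<open>g\<close>. Other pieces of the curve may take
  the same values of \<open>lf\<close>; they form a compact set disjoint from the arc, and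
  \<open>N\<close> avoids it, so that inside \<open>N\<close> the trace is this single arc.\<close>

lemma local_parameter:
  assumes lf: "bounded_linear lf" and nz: "lf (\<gamma>' t0) \<noteq> (0::real)"
  obtains N V g I where "open N" "open V" "open I" "t0 \<in> I" "\<gamma> t0 \<in> N" "smooth_on V g"
    "\<And>v. v \<in> V \<Longrightarrow> lf (\<gamma> (g v)) = v" "\<And>z. z \<in> N \<Longrightarrow> lf z \<in> V"
    "\<And>z. z \<in> N \<Longrightarrow> z \<in> range \<gamma> \<Longrightarrow> \<gamma> (g (lf z)) = z"
    "\<And>s. s \<in> I \<Longrightarrow> g (lf (\<gamma> s)) = s"
proof -
  define f where "f = (\<lambda>t. lf (\<gamma> t))"
  define f' where "f' = (\<lambda>t. lf (\<gamma>' t))"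
  have fd: "(f has_real_derivative f' t) (at t)" for t
    unfolding f_def f'_def has_real_derivative_iff_has_vector_derivative
    by (rule bounded_linear.has_vector_derivative[OF lf deriv])
  have fs: "smooth_on UNIV f" unfolding f_def by (rule smooth_on_compose_linear[OF lf open_UNIV smooth])
  have "smooth_on UNIV f'"
    by (rule smooth_on_deriv_real[OF open_UNIV fs]) (use fd in \<open>simp add: has_real_derivative_iff_has_vector_derivative\<close>)
  then have "continuous_on UNIV f'" by (rule smooth_on_imp_continuous_on)
  then have "open (f' -` (- {0}))" by (intro open_vimage) auto
  moreover have "t0 \<in> f' -` (- {0})" using nz by (simp add: f'_def)
  ultimately obtain r where r: "r > 0" "ball t0 r \<subseteq> f' -` (- {0})" by (meson open_contains_ball)
  \<comment> \<open>With \<delta> \<le> p / 2 the open interval \<open>I\<close> and the closed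
    interval \<open>{t0 + \<delta> .. t0 + p - \<delta>}\<close> cover the circle of parameters
    without overlap, so \<open>K\<close> below is exactly the part of the trace outside the
    arc.\<close>
  define \<delta> where "\<delta> = min r (p / 2)"
  have \<delta>: "\<delta> > 0" "\<delta> \<le> p / 2" using r period_pos by (auto simp: \<delta>_def)
  define I where "I = ball t0 \<delta>"
  have f'nz: "f' t \<noteq> 0" if "t \<in> I" for t using that r by (auto simp: I_def \<delta>_def subset_eq)
  have no: False if "x \<in> I" "y \<in> I" "f x = f y" "x < y" for x y
  proof -
    have "\<exists>z. x < z \<and> z < y \<and> f y - f x = (y - x) * f' z" using MVT2[OF \<open>x < y\<close>] fd by blast
    then obtain z where "x < z" "z < y" "f' z = 0"
      using \<open>f x = f y\<close> \<open>x < y\<close> by auto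
    moreover have "z \<in> I" using that(1,2) \<open>x < z\<close> \<open>z < y\<close> by (auto simp: I_def dist_real_def)
    ultimately show False using f'nz by blast
  qed
  have inj: "inj_on f I"
    by (rule inj_onI) (metis no linorder_neqE_linordered_idom)
  have cf: "continuous_on I f" using smooth_on_imp_continuous_on[OF fs] by (rule continuous_on_subset) simp
  obtain g where g: "homeomorphism I (f ` I) f g"
    using invariance_of_domain_homeomorphism[of I f] cf inj by (auto simp: I_def)
  define V where "V = f ` I"
  have oV: "open V" unfolding V_def by (rule invariance_of_domain[OF cf _ inj]) (simp add: I_def)
  have gI: "g v \<in> I" "f (g v) = v" if "v \<in> V" for v
    using g that unfolding homeomorphism_def V_def by auto
  have gf: "g (f s) = s" if "s \<in> I" for s using g that unfolding homeomorphism_def by auto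
  have sg: "smooth_on V g"
  proof (rule smooth_on_inverse_function[of I V f f' g])
    show "continuous_on V g" using g unfolding homeomorphism_def V_def by auto
  qed (use oV fs fd f'nz gI in \<open>auto simp: I_def intro: smooth_on_subset\<close>)
  define K where "K = \<gamma> ` {t0 + \<delta> .. t0 + p - \<delta>}"
  have "compact K" unfolding K_def
    by (intro compact_continuous_image continuous_on_subset[OF smooth_on_imp_continuous_on[OF smooth]]) auto
  then have "closed K" by (rule compact_imp_closed)
  define N where "N = lf -` V \<inter> - K"
  have oN: "open N" unfolding N_def using oV \<open>closed K\<close> bounded_linear.continuous_on[OF lf continuous_on_id]
    by (intro open_Int open_vimage) auto
  have notK: "\<gamma> s \<notin> K" if "s \<in> I" for s
  proof
    assume "\<gamma> s \<in> K"
    then obtain x where x: "\<gamma> s = \<gamma> x" "t0 + \<delta> \<le> x" "x \<le> t0 + p - \<delta>" unfolding K_def by auto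
    have "t0 - \<delta> < s" "s < t0 + \<delta>" using that by (auto simp: I_def dist_real_def)
    then have "s = x" using eq_imp_eq[OF x(1)] x \<delta> by auto
    then show False using x \<open>s < t0 + \<delta>\<close> by simp
  qed
  have t0I: "t0 \<in> I" using \<delta> by (simp add: I_def)
  show ?thesis
  proof (rule that[OF oN oV _ t0I _ sg])
    show "open I" by (simp add: I_def)
    show "\<gamma> t0 \<in> N" using notK[OF t0I] t0I by (auto simp: N_def V_def f_def)
    show "lf (\<gamma> (g v)) = v" if "v \<in> V" for v using gI(2)[OF that] by (simp add: f_def)
    show "lf z \<in> V" if "z \<in> N" for z using that by (simp add: N_def)
    show "g (lf (\<gamma> s)) = s" if "s \<in> I" for s using gf[OF that] by (simp add: f_def)
    fix z assume z: "z \<in> N" "z \<in> range \<gamma>"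
    then obtain t where "z = \<gamma> t" by auto
    then obtain s where s: "\<gamma> s = z" "t0 - \<delta> \<le> s" "s < t0 - \<delta> + p" using shift_into[of t "t0 - \<delta>"] by metis
    have nK: "z \<notin> K" using z by (simp add: N_def)
    have "s < t0 + \<delta>"
    proof (rule ccontr)
      assume "\<not> ?thesis"
      then have "z \<in> K" unfolding K_def s(1)[symmetric] using s by (intro imageI) auto
      then show False using nK by simp
    qed
    moreover have "s \<noteq> t0 - \<delta>"
    proof
      assume "s = t0 - \<delta>"
      moreover have "\<gamma> (t0 + p - \<delta>) = \<gamma> (t0 - \<delta>)" using eq_iff by (metis add.commute add_diff_eq mult_1 of_int_1 diff_add_eq)
      moreover have "\<gamma> (t0 + p - \<delta>) \<in> K" unfolding K_def using \<delta> by (intro imageI) auto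
      ultimately show False using nK s(1) by simp
    qed
    ultimately have "s \<in> I" using s by (auto simp: I_def dist_real_def)
    then have "g (lf (\<gamma> s)) = s" using gf by (simp add: f_def)
    then show "\<gamma> (g (lf z)) = z" unfolding s(1) using s(1) by simp
  qed
qed

end

text \<open>The map \<eta> \<circ> \<gamma>^(-1) between the traces. The choice of t is immaterial
  for two closed curves with the same period, since both identify the same parameters.\<close>

definition transfer :: "(real \<Rightarrow> 'a) \<Rightarrow> (real \<Rightarrow> 'b) \<Rightarrow> 'a \<Rightarrow> 'b" where
  "transfer \<gamma> \<eta> z = \<eta> (SOME t. \<gamma> t = z)"

lemma transfer_apply:
  assumes "closed_curve \<gamma> \<gamma>' p" "closed_curve \<eta> \<eta>' p"
  shows "transfer \<gamma> \<eta> (\<gamma> t) = \<eta> t"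
proof -
  have "\<gamma> (SOME s. \<gamma> s = \<gamma> t) = \<gamma> t" by (rule someI) simp
  then show ?thesis unfolding transfer_def
    using closed_curve.eq_iff[OF assms(1)] closed_curve.eq_iff[OF assms(2)] by metis
qed

text \<open>The local extension is \<eta> \<circ> g \<circ> lf, where \<open>lf\<close> measures the
  position in the tangent direction at \<open>z\<close>. It is defined on an open set of the ambient
  space, as smoothness on a subset demands.\<close>

lemma transfer_smooth:
  assumes "closed_curve \<gamma> \<gamma>' p" "closed_curve \<eta> \<eta>' p" "z \<in> range \<gamma>"
  obtains N h where "open N" "z \<in> N" "smooth_on N h" "\<And>x. x \<in> N \<Longrightarrow> x \<in> range \<gamma> \<Longrightarrow> transfer \<gamma> \<eta> x = h x"
proof -
  interpret A: closed_curve \<gamma> \<gamma>' p by fact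
  interpret B: closed_curve \<eta> \<eta>' p by fact
  obtain t0 where z: "z = \<gamma> t0" using assms(3) by auto
  define lf where "lf = (\<lambda>x. x \<bullet> \<gamma>' t0)"
  have bl: "bounded_linear lf" unfolding lf_def by (rule bounded_linear_inner_left)
  have "lf (\<gamma>' t0) \<noteq> 0" using A.regular by (simp add: lf_def)
  then obtain N V g I where N: "open N" "open V" "\<gamma> t0 \<in> N" "smooth_on V g"
    "\<And>z. z \<in> N \<Longrightarrow> lf z \<in> V" "\<And>z. z \<in> N \<Longrightarrow> z \<in> range \<gamma> \<Longrightarrow> \<gamma> (g (lf z)) = z"
    using A.local_parameter[OF bl] by metis
  show ?thesis
  proof (rule that[OF N(1)])
    show "z \<in> N" using N z by simp
    have "smooth_on N (\<lambda>x. g (lf x))"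
      by (rule smooth_on_compose[OF N(1,2) _ N(4,5)]) (rule smooth_on_compose_linear[OF bl N(1) smooth_on_id[OF N(1)]])
    then show "smooth_on N (\<lambda>x. \<eta> (g (lf x)))"
      by (rule smooth_on_compose[OF N(1) open_UNIV _ B.smooth]) simp
    fix x assume "x \<in> N" "x \<in> range \<gamma>"
    then show "transfer \<gamma> \<eta> x = \<eta> (g (lf x))"
      using N(6)[of x] transfer_apply[OF assms(1,2), of "g (lf x)"] by simp
  qed
qed

section \<open>Charts of rotational hypersurfaces\<close>

text \<open>The chart is the orthogonal projection along \<open>e\<close>, and its inverse adds
  \<open>\<phi> z *\<^sub>R e\<close>. Both are restrictions of smooth maps on open subsets of the
  ambient space.\<close>

lemma graph_chart:
  fixes e q0 :: "'a::euclidean_space"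
  assumes e: "e \<noteq> 0" "e \<bullet> e = 1" and U: "open U" "q0 \<in> U" and D: "open D" "smooth_on D \<phi>"
    and fwd: "\<And>q. q \<in> S \<inter> U \<Longrightarrow> q - (q \<bullet> e) *\<^sub>R e \<in> D \<and> \<phi> (q - (q \<bullet> e) *\<^sub>R e) = q \<bullet> e"
    and bwd: "\<And>z. z \<in> D \<Longrightarrow> z \<bullet> e = 0 \<Longrightarrow> z + \<phi> z *\<^sub>R e \<in> S \<inter> U"
  shows "\<exists>U (L::'a set) W. open U \<and> q0 \<in> U \<and> subspace L \<and> dim L = DIM('a) - 1 \<and>
     openin (top_of_set L) W \<and> diffeomorphic (S \<inter> U) W"
proof -
  define L where "L = {z. e \<bullet> z = 0}"
  define f where "f = (\<lambda>q. q - (q \<bullet> e) *\<^sub>R e)"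
  define h where "h = (\<lambda>z. z + \<phi> z *\<^sub>R e)"
  have fsm: "smooth_on UNIV f" unfolding f_def by (intro smooth_on_intros open_UNIV)
  have hsm: "smooth_on D h" unfolding h_def by (intro smooth_on_intros D)
  have sf: "smooth_map_on (S \<inter> U) f" by (rule smooth_map_onI[OF open_UNIV fsm]) simp
  have sh: "smooth_map_on (L \<inter> D) h" by (rule smooth_map_onI[OF D(1) hsm]) simp
  have fL: "f q \<in> L" for q using e by (simp add: f_def L_def inner_diff_right inner_commute)
  have hf: "h (f q) = q" if "q \<in> S \<inter> U" for q using fwd[OF that] by (simp add: h_def f_def)
  have fh: "f (h z) = z" if "z \<in> L" for z
  proof -
    have "z \<bullet> e = 0" using that by (simp add: L_def inner_commute)
    then show ?thesis using e by (simp add: f_def h_def inner_add_left)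
  qed
  have "f ` (S \<inter> U) = L \<inter> D"
  proof
    show "f ` (S \<inter> U) \<subseteq> L \<inter> D" using fwd fL by (auto simp: f_def)
    show "L \<inter> D \<subseteq> f ` (S \<inter> U)"
    proof
      fix z assume z: "z \<in> L \<inter> D"
      then have "h z \<in> S \<inter> U" using bwd[of z] by (simp add: h_def L_def inner_commute)
      then show "z \<in> f ` (S \<inter> U)" using fh[of z] z by (metis IntD1 imageI)
    qed
  qed
  moreover have "h ` (L \<inter> D) = S \<inter> U"
  proof
    show "h ` (L \<inter> D) \<subseteq> S \<inter> U"
    proof
      fix q assume "q \<in> h ` (L \<inter> D)"
      then show "q \<in> S \<inter> U" using bwd by (auto simp: h_def L_def inner_commute)
    qed
    show "S \<inter> U \<subseteq> h ` (L \<inter> D)"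
    proof
      fix q assume q: "q \<in> S \<inter> U"
      then have "f q \<in> L \<inter> D" using fwd fL by (simp add: f_def)
      then show "q \<in> h ` (L \<inter> D)" using hf[OF q] by (metis imageI)
    qed
  qed
  ultimately have "homeomorphism (S \<inter> U) (L \<inter> D) f h"
    using smooth_map_on_imp_continuous_on[OF sf] smooth_map_on_imp_continuous_on[OF sh] hf fh
    unfolding homeomorphism_def by auto
  then have "diffeomorphic (S \<inter> U) (L \<inter> D)" unfolding diffeomorphic_def using sf sh by blast
  moreover have "subspace L" unfolding L_def by (rule subspace_hyperplane)
  moreover have "dim L = DIM('a) - 1" unfolding L_def by (rule dim_hyperplane[OF e(1)])
  moreover have "openin (top_of_set L) (L \<inter> D)" using D by (simp add: openin_open_Int)
  ultimately show ?thesis using U by blast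
qed

text \<open>The roles of the two factors of the product are played by \<open>Pu\<close> and \<open>Pv\<close>, so that the
  lemma can be applied both ways round.\<close>

lemma rotational_chart:
  fixes Pu Pv :: "'a::euclidean_space \<Rightarrow> 'b::euclidean_space" and Iv :: "'b \<Rightarrow> 'a"
  assumes bl: "bounded_linear Pu" "bounded_linear Pv" "bounded_linear Iv"
    and PI: "\<And>x. Pv (Iv x) = x" "\<And>x. Pu (Iv x) = 0" "\<And>z x. z \<bullet> Iv x = Pv z \<bullet> x"
    and N: "open N" "\<And>z. z \<in> N \<Longrightarrow> fst z \<in> V" and V: "open V" "smooth_on V B" "\<And>a. a \<in> V \<Longrightarrow> B a > 0"
    and S: "\<And>q. (norm (Pu q), norm (Pv q)) \<in> N \<Longrightarrow> q \<in> S \<longleftrightarrow> norm (Pv q) = B (norm (Pu q))"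
    and q0: "(norm (Pu q0), norm (Pv q0)) \<in> N" "Pu q0 \<noteq> 0" "Pv q0 \<noteq> 0"
  shows "\<exists>U (L::'a set) W. open U \<and> q0 \<in> U \<and> subspace L \<and> dim L = DIM('a) - 1 \<and>
     openin (top_of_set L) W \<and> diffeomorphic (S \<inter> U) W"
proof -
  define n where "n = Pv q0 /\<^sub>R norm (Pv q0)"
  define e where "e = Iv n"
  have n1: "norm n = 1" "n \<bullet> n = 1" using q0 by (simp_all add: n_def dot_square_norm)
  have e1: "e \<bullet> e = 1" by (simp add: e_def PI n1)
  then have e0: "e \<noteq> 0" by auto
  have ze: "z \<bullet> e = Pv z \<bullet> n" for z by (simp add: e_def PI)
  have cPu: "continuous_on T Pu" and cPv: "continuous_on T Pv" for T
    using bl by (auto intro: linear_continuous_on)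
  \<comment> \<open>A line parallel to \<open>e\<close> can meet the hypersurface on both sides of
    the hyperplane orthogonal to \<open>e\<close>; the condition \<open>Pv q \<bullet> n > 0\<close>
    selects one sheet.\<close>
  define U where "U = {q. (norm (Pu q), norm (Pv q)) \<in> N} \<inter> {q. Pu q \<noteq> 0} \<inter> {q. Pv q \<bullet> n > 0}"
  have oU: "open U" unfolding U_def
  proof (intro open_Int)
    have "continuous_on UNIV (\<lambda>q. (norm (Pu q), norm (Pv q)))" by (intro continuous_intros cPu cPv)
    then show "open {q. (norm (Pu q), norm (Pv q)) \<in> N}"
      using open_vimage[OF N(1), of "\<lambda>q. (norm (Pu q), norm (Pv q))"] by (simp add: vimage_def)
    show "open {q. Pu q \<noteq> 0}" by (intro open_Collect_neq cPu continuous_on_const)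
    show "open {q. Pv q \<bullet> n > 0}" by (intro open_Collect_less continuous_intros cPv)
  qed
  have q0U: "q0 \<in> U" using q0 by (simp add: U_def n_def inner_commute dot_square_norm)
  define D0 where "D0 = {z. norm (Pu z) \<in> V} \<inter> {z. Pu z \<noteq> 0}"
  have oD0: "open D0" unfolding D0_def
  proof (intro open_Int)
    show "open {z. norm (Pu z) \<in> V}"
      using open_vimage[OF V(1), of "\<lambda>z. norm (Pu z)"] continuous_on_norm[OF cPu] by (simp add: vimage_def)
    show "open {q. Pu q \<noteq> 0}" by (intro open_Collect_neq cPu continuous_on_const)
  qed
  \<comment> \<open>Splitting \<open>Pv q\<close> into its component along \<open>n\<close> and the
    rest turns \<open>norm (Pv q) = B (norm (Pu q))\<close> into the statement that the square of
    that component is \<psi>, evaluated at the projection of \<open>q\<close>. The positive root is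
    the graph function.\<close>
  define \<psi> where "\<psi> = (\<lambda>z. (B (norm (Pu z)))\<^sup>2 - Pv z \<bullet> Pv z)"
  have s\<psi>: "smooth_on D0 \<psi>" unfolding \<psi>_def
    by (intro smooth_on_intros oD0 smooth_on_compose[OF oD0 V(1) _ V(2)] smooth_on_compose_linear[OF bl(1) oD0]
        smooth_on_compose_linear[OF bl(2) oD0]) (auto simp: D0_def)
  define D1 where "D1 = D0 \<inter> \<psi> -` {0<..}"
  have oD1: "open D1" unfolding D1_def
    by (rule continuous_open_preimage[OF smooth_on_imp_continuous_on[OF s\<psi>] oD0]) auto
  define \<phi> where "\<phi> = (\<lambda>z. sqrt (\<psi> z))"
  have s\<phi>: "smooth_on D1 \<phi>" unfolding \<phi>_def
    by (intro smooth_on_sqrt oD1 smooth_on_subset[OF s\<psi>]) (auto simp: D1_def)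
  define D where "D = D1 \<inter> (\<lambda>z. z + \<phi> z *\<^sub>R e) -` U"
  have oD: "open D" unfolding D_def
    by (rule continuous_open_preimage[OF _ oD1 oU]) (intro continuous_intros smooth_on_imp_continuous_on[OF s\<phi>])
  have lin: "linear Pu" "linear Pv" using bl by (auto simp: bounded_linear.linear)
  show ?thesis
  proof (rule graph_chart[OF e0 e1 oU q0U oD, of \<phi>])
    show "smooth_on D \<phi>" by (rule smooth_on_subset[OF s\<phi>]) (simp add: D_def)
  next
    fix q assume q: "q \<in> S \<inter> U"
    define z where "z = q - (q \<bullet> e) *\<^sub>R e"
    have Pz: "Pu z = Pu q" "Pv z = Pv q - (Pv q \<bullet> n) *\<^sub>R n"
      by (simp_all add: z_def linear_diff[OF lin(1)] linear_diff[OF lin(2)] linear_scale[OF lin(1)]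
          linear_scale[OF lin(2)] e_def PI)
    have B: "norm (Pv q) = B (norm (Pu q))" using S[of q] q by (auto simp: U_def)
    have "\<psi> z = (norm (Pv q))\<^sup>2 - (Pv q - (Pv q \<bullet> n) *\<^sub>R n) \<bullet> (Pv q - (Pv q \<bullet> n) *\<^sub>R n)"
      by (simp add: \<psi>_def Pz B)
    also have "\<dots> = (Pv q \<bullet> n)\<^sup>2"
      unfolding power2_norm_eq_inner
      by (simp add: inner_diff_left inner_diff_right n1 inner_commute power2_eq_square)
    finally have \<psi>z: "\<psi> z = (Pv q \<bullet> n)\<^sup>2" .
    have pos: "Pv q \<bullet> n > 0" using q by (simp add: U_def)
    then have \<phi>z: "\<phi> z = q \<bullet> e" by (simp add: \<phi>_def \<psi>z ze)
    have "z \<in> D1" using \<psi>z pos q N(2)[of "(norm (Pu q), norm (Pv q))"] by (auto simp: D1_def D0_def Pz U_def)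
    moreover have "z + \<phi> z *\<^sub>R e = q" unfolding \<phi>z by (simp add: z_def)
    ultimately have "z \<in> D" using q by (simp add: D_def)
    then show "q - (q \<bullet> e) *\<^sub>R e \<in> D \<and> \<phi> (q - (q \<bullet> e) *\<^sub>R e) = q \<bullet> e" using \<phi>z by (simp add: z_def)
  next
    fix z assume z: "z \<in> D" "z \<bullet> e = 0"
    define q where "q = z + \<phi> z *\<^sub>R e"
    have Pq: "Pu q = Pu z" "Pv q = Pv z + \<phi> z *\<^sub>R n"
      by (simp_all add: q_def linear_add[OF lin(1)] linear_add[OF lin(2)] linear_scale[OF lin(1)]
          linear_scale[OF lin(2)] e_def PI)
    have qU: "q \<in> U" using z by (simp add: D_def q_def)
    have zD: "\<psi> z > 0" "norm (Pu z) \<in> V" using z by (auto simp: D_def D1_def D0_def)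
    have "(norm (Pv q))\<^sup>2 = Pv z \<bullet> Pv z + (\<phi> z)\<^sup>2"
    proof -
      have zn1: "Pv z \<bullet> n = 0" using z(2) unfolding ze .
      have zn: "Pv z \<bullet> n = 0" "n \<bullet> Pv z = 0" using zn1 by (simp_all add: inner_commute)
      show ?thesis unfolding power2_norm_eq_inner unfolding Pq(2) inner_add_left inner_add_right inner_scaleR_left inner_scaleR_right
        zn n1 power2_eq_square by simp
    qed
    also have "\<dots> = (B (norm (Pu q)))\<^sup>2" using zD by (simp add: \<phi>_def \<psi>_def Pq)
    finally have "norm (Pv q) = B (norm (Pu q))"
      using V(3)[OF zD(2)] Pq by (auto simp: power2_eq_iff_nonneg)
    then have "q \<in> S" using S[of q] qU by (auto simp: U_def)
    then show "z + \<phi> z *\<^sub>R e \<in> S \<inter> U" using qU by (simp add: q_def)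
  qed
qed

text \<open>The mean curvature is defined as a sum over distinct eigenvalues, while the curvatures
  of a rotational hypersurface may coincide at some points. Each eigenspace is spanned by the basis
  vectors with that eigenvalue, so grouping the sum over the basis by \<open>k\<close> gives the
  answer whatever coincidences occur.\<close>

lemma sum_eigenvalues:
  fixes D :: "'a::euclidean_space \<Rightarrow> 'a" and k :: "'a \<Rightarrow> real"
  assumes "linear D" and B: "finite B" "independent B" and ev: "\<And>b. b \<in> B \<Longrightarrow> D b = k b *\<^sub>R b"
  defines "E \<equiv> \<lambda>\<kappa>. {v \<in> span B. D v = \<kappa> *\<^sub>R v}"
  shows "(\<Sum>\<kappa>\<in>{\<kappa>. \<exists>v\<in>E \<kappa>. v \<noteq> 0}. real (dim (E \<kappa>)) * \<kappa>) = (\<Sum>b\<in>B. k b)"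
proof -
  have E: "E \<kappa> = span {b \<in> B. k b = \<kappa>}" for \<kappa>
  proof
    show "span {b \<in> B. k b = \<kappa>} \<subseteq> E \<kappa>"
    proof (rule span_minimal)
      show "{b \<in> B. k b = \<kappa>} \<subseteq> E \<kappa>" using ev by (auto simp: E_def span_base)
      show "subspace (E \<kappa>)" unfolding E_def subspace_def
        using \<open>linear D\<close> by (auto simp: linear_0 linear_add linear_scale span_zero span_add span_scale scaleR_add_right)
    qed
    show "E \<kappa> \<subseteq> span {b \<in> B. k b = \<kappa>}"
    proof
      fix v assume v: "v \<in> E \<kappa>"
      then obtain c where c: "v = (\<Sum>b\<in>B. c b *\<^sub>R b)" using span_finite[OF B(1)] by (auto simp: E_def)
      have "D v = (\<Sum>b\<in>B. (c b * k b) *\<^sub>R b)"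
        unfolding c using \<open>linear D\<close> ev by (simp add: linear_sum linear_scale)
      moreover have "\<kappa> *\<^sub>R v = (\<Sum>b\<in>B. (\<kappa> * c b) *\<^sub>R b)" unfolding c by (simp add: scaleR_sum_right)
      ultimately have "(\<Sum>b\<in>B. (c b * k b - \<kappa> * c b) *\<^sub>R b) = 0"
        using v by (simp add: E_def sum_subtractf scaleR_diff_left)
      then have z: "c b * k b - \<kappa> * c b = 0" if "b \<in> B" for b
        using B that unfolding independent_explicit by (auto dest!: spec[of _ "\<lambda>b. c b * k b - \<kappa> * c b"])
      have "v = (\<Sum>b\<in>{b \<in> B. k b = \<kappa>}. c b *\<^sub>R b)" unfolding c
        using z B(1) by (intro sum.mono_neutral_right) (auto simp: algebra_simps)
      also have "\<dots> \<in> span {b \<in> B. k b = \<kappa>}" by (intro span_sum span_scale span_base) auto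
      finally show "v \<in> span {b \<in> B. k b = \<kappa>}" .
    qed
  qed
  have dim: "dim (E \<kappa>) = card {b \<in> B. k b = \<kappa>}" for \<kappa>
    unfolding E using B by (rule_tac dim_span_eq_card_independent, rule_tac independent_mono[OF B(2)]) auto
  have nz: "b \<noteq> 0" if "b \<in> B" for b using B(2) that dependent_zero by blast
  have "{\<kappa>. \<exists>v\<in>E \<kappa>. v \<noteq> 0} = k ` B"
  proof
    have "b \<in> E (k b)" if "b \<in> B" for b using ev that by (simp add: E_def span_base)
    then show "k ` B \<subseteq> {\<kappa>. \<exists>v\<in>E \<kappa>. v \<noteq> 0}" using nz by blast
    show "{\<kappa>. \<exists>v\<in>E \<kappa>. v \<noteq> 0} \<subseteq> k ` B"
    proof
      fix \<kappa> assume "\<kappa> \<in> {\<kappa>. \<exists>v\<in>E \<kappa>. v \<noteq> 0}"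
      then obtain v where "v \<in> span {b \<in> B. k b = \<kappa>}" "v \<noteq> 0" unfolding E by auto
      then have "{b \<in> B. k b = \<kappa>} \<noteq> {}" by (metis singletonD span_empty)
      then show "\<kappa> \<in> k ` B" by auto
    qed
  qed
  then have "(\<Sum>\<kappa>\<in>{\<kappa>. \<exists>v\<in>E \<kappa>. v \<noteq> 0}. real (dim (E \<kappa>)) * \<kappa>) = (\<Sum>\<kappa>\<in>k ` B. \<Sum>b\<in>{b \<in> B. k b = \<kappa>}. k b)"
    by (simp add: dim)
  also have "\<dots> = (\<Sum>b\<in>B. k b)" by (rule sum.image_gen[OF B(1), symmetric])
  finally show ?thesis .
qed

text \<open>The unit circle is run through with the period \<open>p\<close> of the profile, so that
  \<open>transfer\<close> relates the two curves.\<close>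

lemma closed_curve_circle:
  assumes "p > 0"
  defines "\<omega> \<equiv> 2 * pi / p"
  shows "closed_curve (\<lambda>t. cos (\<omega> * t) *\<^sub>R axis 1 1 + sin (\<omega> * t) *\<^sub>R axis 2 1 :: real^2)
    (\<lambda>t. (- \<omega> * sin (\<omega> * t)) *\<^sub>R axis 1 1 + (\<omega> * cos (\<omega> * t)) *\<^sub>R axis 2 1) p"
    "range (\<lambda>t. cos (\<omega> * t) *\<^sub>R axis 1 1 + sin (\<omega> * t) *\<^sub>R axis 2 1 :: real^2) = sphere 0 1"
proof -
  have \<omega>: "\<omega> > 0" using assms by simp
  have comp: "(a *\<^sub>R axis 1 1 + b *\<^sub>R axis 2 1 :: real^2) $ 1 = a" "(a *\<^sub>R axis 1 1 + b *\<^sub>R axis 2 1 :: real^2) $ 2 = b" for a b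
    by (simp_all add: axis_def)
  have eq: "(a *\<^sub>R axis 1 1 + b *\<^sub>R axis 2 1 :: real^2) = c *\<^sub>R axis 1 1 + d *\<^sub>R axis 2 1 \<longleftrightarrow> a = c \<and> b = d" for a b c d
    using comp by (metis (no_types))
  show "closed_curve (\<lambda>t. cos (\<omega> * t) *\<^sub>R axis 1 1 + sin (\<omega> * t) *\<^sub>R axis 2 1 :: real^2)
    (\<lambda>t. (- \<omega> * sin (\<omega> * t)) *\<^sub>R axis 1 1 + (\<omega> * cos (\<omega> * t)) *\<^sub>R axis 2 1) p"
  proof
    show "smooth_on UNIV (\<lambda>t. cos (\<omega> * t) *\<^sub>R axis 1 1 + sin (\<omega> * t) *\<^sub>R axis 2 1 :: real^2)"
      by (intro smooth_on_intros open_UNIV)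
    show "((\<lambda>t. cos (\<omega> * t) *\<^sub>R axis 1 1 + sin (\<omega> * t) *\<^sub>R axis 2 1 :: real^2) has_vector_derivative
       (- \<omega> * sin (\<omega> * t)) *\<^sub>R axis 1 1 + (\<omega> * cos (\<omega> * t)) *\<^sub>R axis 2 1) (at t)" for t
    proof -
      have "((\<lambda>t. cos (\<omega> * t)) has_real_derivative - \<omega> * sin (\<omega> * t)) (at t)"
        "((\<lambda>t. sin (\<omega> * t)) has_real_derivative \<omega> * cos (\<omega> * t)) (at t)"
        by (auto intro!: derivative_eq_intros)
      then show ?thesis
        by (intro has_vector_derivative_add)
          (use has_vector_derivative_scaleR[OF _ has_vector_derivative_const] in fastforce)+
    qed
    show "(- \<omega> * sin (\<omega> * t)) *\<^sub>R axis 1 1 + (\<omega> * cos (\<omega> * t)) *\<^sub>R axis 2 1 \<noteq> (0 :: real^2)" for t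
    proof
      assume "(- \<omega> * sin (\<omega> * t)) *\<^sub>R axis 1 1 + (\<omega> * cos (\<omega> * t)) *\<^sub>R axis 2 1 = (0 :: real^2)"
      then have "- \<omega> * sin (\<omega> * t) = 0 \<and> \<omega> * cos (\<omega> * t) = 0" using comp by (metis zero_index)
      then show False using \<omega> sin_cos_squared_add[of "\<omega> * t"] by simp
    qed
    show "p > 0" by fact
    show "cos (\<omega> * s) *\<^sub>R axis 1 1 + sin (\<omega> * s) *\<^sub>R axis 2 1 = (cos (\<omega> * t) *\<^sub>R axis 1 1 + sin (\<omega> * t) *\<^sub>R axis 2 1 :: real^2)
       \<longleftrightarrow> (\<exists>k::int. s = t + of_int k * p)" for s t
    proof -
      have "\<omega> * s = \<omega> * t + 2 * pi * of_int k \<longleftrightarrow> s = t + of_int k * p" for k :: int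
      proof -
        have "\<omega> * p = 2 * pi" using assms(1) by (simp add: \<omega>_def)
        then have "\<omega> * t + 2 * pi * of_int k = \<omega> * (t + of_int k * p)" by (simp add: algebra_simps)
        then show ?thesis using \<omega> by simp
      qed
      then show ?thesis unfolding eq using sin_cos_eq_iff[of "\<omega> * s" "\<omega> * t"] by (auto simp: mult_ac)
    qed
  qed
  show "range (\<lambda>t. cos (\<omega> * t) *\<^sub>R axis 1 1 + sin (\<omega> * t) *\<^sub>R axis 2 1 :: real^2) = sphere 0 1"
  proof
    show "range (\<lambda>t. cos (\<omega> * t) *\<^sub>R axis 1 1 + sin (\<omega> * t) *\<^sub>R axis 2 1 :: real^2) \<subseteq> sphere 0 1"
    proof
      fix z :: "real^2" assume "z \<in> range (\<lambda>t. cos (\<omega> * t) *\<^sub>R axis 1 1 + sin (\<omega> * t) *\<^sub>R axis 2 1)"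
      then obtain t where "z = cos (\<omega> * t) *\<^sub>R axis 1 1 + sin (\<omega> * t) *\<^sub>R axis 2 1" by auto
      then have "z $ 1 = cos (\<omega> * t)" "z $ 2 = sin (\<omega> * t)" by (simp_all only: comp)
      then show "z \<in> sphere 0 1" by (simp add: norm_eq_1 inner_vec_def sum_2 flip: power2_eq_square)
    qed
    show "sphere 0 1 \<subseteq> range (\<lambda>t. cos (\<omega> * t) *\<^sub>R axis 1 1 + sin (\<omega> * t) *\<^sub>R axis 2 1 :: real^2)"
    proof
      fix z :: "real^2" assume "z \<in> sphere 0 1"
      then have "(z $ 1)\<^sup>2 + (z $ 2)\<^sup>2 = 1" by (simp add: norm_eq_1 inner_vec_def sum_2 power2_eq_square)
      then obtain x where x: "z $ 1 = cos x" "z $ 2 = sin x" using sincos_total_2pi by metis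
      have "z = cos (\<omega> * (x / \<omega>)) *\<^sub>R axis 1 1 + sin (\<omega> * (x / \<omega>)) *\<^sub>R axis 2 1"
        unfolding vec_eq_iff forall_2 comp using x \<omega> by simp
      then show "z \<in> range (\<lambda>t. cos (\<omega> * t) *\<^sub>R axis 1 1 + sin (\<omega> * t) *\<^sub>R axis 2 1)" by blast
    qed
  qed
qed

section \<open>The hypersurface swept out by a closed profile curve\<close>

text \<open>(\<open>N1\<close>, \<open>N2\<close>) is a unit normal of the profile curve (\<alpha>,
  \<beta>). The equations for its derivative are the Frenet equations in an arbitrary parameter, so
  \<open>k\<close> is the curvature of the profile and becomes the principal curvature in the
  profile direction.\<close>

locale rotation_profile =
  fixes \<alpha> \<alpha>' \<beta> \<beta>' N1 N2 k :: "real \<Rightarrow> real" and p :: real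
  assumes smooth: "smooth_on UNIV \<alpha>" "smooth_on UNIV \<beta>" "smooth_on UNIV N1" "smooth_on UNIV N2"
    and deriv: "\<And>t. (\<alpha> has_real_derivative \<alpha>' t) (at t)" "\<And>t. (\<beta> has_real_derivative \<beta>' t) (at t)"
      "\<And>t. (N1 has_real_derivative k t * \<alpha>' t) (at t)" "\<And>t. (N2 has_real_derivative k t * \<beta>' t) (at t)"
    and regular: "\<And>t. \<alpha>' t \<noteq> 0 \<or> \<beta>' t \<noteq> 0"
    and pos: "\<And>t. \<alpha> t > 0" "\<And>t. \<beta> t > 0"
    and unit: "\<And>t. (N1 t)\<^sup>2 + (N2 t)\<^sup>2 = 1" and normal: "\<And>t. N1 t * \<alpha>' t + N2 t * \<beta>' t = 0"
    and period_pos: "p > 0"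
    and eq_iff: "\<And>s t. \<alpha> s = \<alpha> t \<and> \<beta> s = \<beta> t \<longleftrightarrow> (\<exists>k::int. s = t + of_int k * p)"
begin

definition hypersurface :: "((real^'n) \<times> (real^'n)) set" where
  "hypersurface = {q. \<exists>t. norm (fst q) = \<alpha> t \<and> norm (snd q) = \<beta> t}"

lemma closed_curve_profile:
  "closed_curve (\<lambda>t. (\<alpha> t, \<beta> t)) (\<lambda>t. (\<alpha>' t, \<beta>' t)) p"
  "closed_curve (\<lambda>t. (\<beta> t, \<alpha> t)) (\<lambda>t. (\<beta>' t, \<alpha>' t)) p"
proof -
  have d: "(\<alpha> has_vector_derivative \<alpha>' t) (at t)" "(\<beta> has_vector_derivative \<beta>' t) (at t)" for t
    using deriv by (simp_all add: has_real_derivative_iff_has_vector_derivative)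
  have e: "\<beta> s = \<beta> t \<and> \<alpha> s = \<alpha> t \<longleftrightarrow> (\<exists>k::int. s = t + of_int k * p)" for s t
    using eq_iff[of s t] by blast
  show "closed_curve (\<lambda>t. (\<alpha> t, \<beta> t)) (\<lambda>t. (\<alpha>' t, \<beta>' t)) p"
    by standard (use regular period_pos in \<open>auto simp only: prod.inject eq_iff zero_prod_def
      intro!: smooth_on_Pair open_UNIV smooth has_vector_derivative_Pair d\<close>)
  show "closed_curve (\<lambda>t. (\<beta> t, \<alpha> t)) (\<lambda>t. (\<beta>' t, \<alpha>' t)) p"
    by standard (use regular period_pos in \<open>auto simp only: prod.inject e zero_prod_def
      intro!: smooth_on_Pair open_UNIV smooth has_vector_derivative_Pair d\<close>)
qed

lemma hypersurface_iff: "q \<in> hypersurface \<longleftrightarrow> (norm (fst q), norm (snd q)) \<in> range (\<lambda>t. (\<alpha> t, \<beta> t))"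
  by (auto simp: hypersurface_def)

text \<open>Since \<alpha>' and \<beta>' never vanish together, the profile is locally a graph over
  one of the axes. The two cases differ by an exchange of the factors.\<close>

lemma smooth_hypersurface: "smooth_hypersurface (hypersurface :: ((real^'n) \<times> (real^'n)) set)"
  unfolding smooth_hypersurface_def
proof
  fix q0 :: "(real^'n) \<times> (real^'n)" assume "q0 \<in> hypersurface"
  then obtain t0 where t0: "norm (fst q0) = \<alpha> t0" "norm (snd q0) = \<beta> t0" by (auto simp: hypersurface_def)
  have nz: "fst q0 \<noteq> 0" "snd q0 \<noteq> 0" using t0 pos[of t0] by auto
  let ?goal = "\<exists>U (L::((real^'n) \<times> (real^'n)) set) W. open U \<and> q0 \<in> U \<and> subspace L \<and>
        dim L = DIM((real^'n) \<times> (real^'n)) - 1 \<and> openin (top_of_set L) W \<and>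
        diffeomorphic (hypersurface \<inter> U) W"
  have bl: "bounded_linear (\<lambda>x::real^'n. (0::real^'n, x))" "bounded_linear (\<lambda>x::real^'n. (x, 0::real^'n))"
    by (intro bounded_linear_Pair bounded_linear_zero bounded_linear_ident)+
  consider "\<alpha>' t0 \<noteq> 0" | "\<beta>' t0 \<noteq> 0" using regular by blast
  then show ?goal
  proof cases
    case 1
    interpret C: closed_curve "\<lambda>t. (\<alpha> t, \<beta> t)" "\<lambda>t. (\<alpha>' t, \<beta>' t)" p by (rule closed_curve_profile)
    obtain N V g where N: "open N" "open V" "(\<alpha> t0, \<beta> t0) \<in> N" "smooth_on V g"
      "\<And>v. v \<in> V \<Longrightarrow> fst (\<alpha> (g v), \<beta> (g v)) = v" "\<And>z. z \<in> N \<Longrightarrow> fst z \<in> V"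
      "\<And>z. z \<in> N \<Longrightarrow> z \<in> range (\<lambda>t. (\<alpha> t, \<beta> t)) \<Longrightarrow> (\<alpha> (g (fst z)), \<beta> (g (fst z))) = z"
      by (rule C.local_parameter[OF bounded_linear_fst, where ?t0.0 = t0]) (simp add: 1, rule that)
    show ?thesis
    proof (rule rotational_chart[OF bounded_linear_fst bounded_linear_snd bl(1) _ _ _ N(1) N(6) N(2)])
      show "smooth_on V (\<lambda>v. \<beta> (g v))" by (rule smooth_on_compose[OF N(2) open_UNIV N(4) smooth(2)]) simp
      fix q :: "(real^'n) \<times> (real^'n)" assume q: "(norm (fst q), norm (snd q)) \<in> N"
      show "q \<in> hypersurface \<longleftrightarrow> norm (snd q) = \<beta> (g (norm (fst q)))"
      proof
        assume "q \<in> hypersurface"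
        then show "norm (snd q) = \<beta> (g (norm (fst q)))" using N(7)[OF q] by (auto simp: hypersurface_iff)
      next
        assume "norm (snd q) = \<beta> (g (norm (fst q)))"
        moreover have "norm (fst q) = \<alpha> (g (norm (fst q)))" using N(5)[OF N(6)[OF q]] by simp
        ultimately show "q \<in> hypersurface" unfolding hypersurface_def by blast
      qed
    qed (use nz t0 N(3) pos in \<open>auto simp: inner_prod_def\<close>)
  next
    case 2
    interpret C: closed_curve "\<lambda>t. (\<beta> t, \<alpha> t)" "\<lambda>t. (\<beta>' t, \<alpha>' t)" p by (rule closed_curve_profile)
    obtain N V g where N: "open N" "open V" "(\<beta> t0, \<alpha> t0) \<in> N" "smooth_on V g"
      "\<And>v. v \<in> V \<Longrightarrow> fst (\<beta> (g v), \<alpha> (g v)) = v" "\<And>z. z \<in> N \<Longrightarrow> fst z \<in> V"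
      "\<And>z. z \<in> N \<Longrightarrow> z \<in> range (\<lambda>t. (\<beta> t, \<alpha> t)) \<Longrightarrow> (\<beta> (g (fst z)), \<alpha> (g (fst z))) = z"
      by (rule C.local_parameter[OF bounded_linear_fst, where ?t0.0 = t0]) (simp add: 2, rule that)
    show ?thesis
    proof (rule rotational_chart[OF bounded_linear_snd bounded_linear_fst bl(2) _ _ _ N(1) N(6) N(2)])
      show "smooth_on V (\<lambda>v. \<alpha> (g v))" by (rule smooth_on_compose[OF N(2) open_UNIV N(4) smooth(1)]) simp
      fix q :: "(real^'n) \<times> (real^'n)" assume q: "(norm (snd q), norm (fst q)) \<in> N"
      show "q \<in> hypersurface \<longleftrightarrow> norm (fst q) = \<alpha> (g (norm (snd q)))"
      proof
        assume "q \<in> hypersurface"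
        then show "norm (fst q) = \<alpha> (g (norm (snd q)))" using N(7)[OF q] by (auto simp: hypersurface_iff)
      next
        assume "norm (fst q) = \<alpha> (g (norm (snd q)))"
        moreover have "norm (snd q) = \<beta> (g (norm (snd q)))" using N(5)[OF N(6)[OF q]] by simp
        ultimately show "q \<in> hypersurface" unfolding hypersurface_def by blast
      qed
    qed (use nz t0 N(3) pos in \<open>auto simp: inner_prod_def\<close>)
  qed
qed

text \<open>A point is sent to the directions of its two components together with the point of the
  circle that corresponds to the pair of their norms on the profile. The inverse rescales the two
  directions by \<alpha> and \<beta>, whose positivity keeps both maps well defined and
  smooth.\<close>

lemma diffeomorphic_product:
  "diffeomorphic (hypersurface :: ((real^'n) \<times> (real^'n)) set)
     (sphere (0::real^'n) 1 \<times> sphere (0::real^'n) 1 \<times> sphere (0::real^2) 1)"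
proof -
  define \<gamma> where "\<gamma> = (\<lambda>t. (\<alpha> t, \<beta> t))"
  define \<omega> where "\<omega> = 2 * pi / p"
  define c where "c = (\<lambda>t. cos (\<omega> * t) *\<^sub>R axis 1 1 + sin (\<omega> * t) *\<^sub>R axis 2 1 :: real^2)"
  obtain \<gamma>' c' where cg: "closed_curve \<gamma> \<gamma>' p" and cc: "closed_curve c c' p"
    using closed_curve_profile(1) closed_curve_circle(1)[OF period_pos] unfolding \<gamma>_def c_def \<omega>_def by blast
  have rc: "range c = sphere 0 1" unfolding c_def \<omega>_def by (rule closed_curve_circle(2)[OF period_pos])
  let ?h = "transfer \<gamma> c" let ?k = "transfer c \<gamma>"
  let ?S = "hypersurface :: ((real^'n) \<times> (real^'n)) set"
  let ?T = "sphere (0::real^'n) 1 \<times> sphere (0::real^'n) 1 \<times> sphere (0::real^2) 1"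
  define F where "F = (\<lambda>q::(real^'n) \<times> (real^'n). (fst q /\<^sub>R norm (fst q), snd q /\<^sub>R norm (snd q), ?h (norm (fst q), norm (snd q))))"
  define G where "G = (\<lambda>x::(real^'n) \<times> (real^'n) \<times> (real^2).
     (fst (?k (snd (snd x))) *\<^sub>R fst x, snd (?k (snd (snd x))) *\<^sub>R fst (snd x)))"
  have hk: "?h (\<gamma> t) = c t" "?k (c t) = \<gamma> t" for t
    using transfer_apply[OF cg cc] transfer_apply[OF cc cg] by auto
  have Sd: "\<exists>t. norm (fst q) = \<alpha> t \<and> norm (snd q) = \<beta> t \<and> (norm (fst q), norm (snd q)) = \<gamma> t \<and> fst q \<noteq> 0 \<and> snd q \<noteq> 0"
    if "q \<in> ?S" for q
  proof -
    obtain t where "norm (fst q) = \<alpha> t" "norm (snd q) = \<beta> t" using \<open>q \<in> ?S\<close> by (auto simp: hypersurface_def)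
    then show ?thesis using pos[of t] by (intro exI[of _ t]) (auto simp: \<gamma>_def)
  qed
  have FT: "F q \<in> ?T" and GF: "G (F q) = q" if q: "q \<in> ?S" for q
  proof -
    obtain t where t: "norm (fst q) = \<alpha> t" "norm (snd q) = \<beta> t" "(norm (fst q), norm (snd q)) = \<gamma> t" "fst q \<noteq> 0" "snd q \<noteq> 0"
      using Sd[OF q] by blast
    have "c t \<in> sphere 0 1" using rc by blast
    then show "F q \<in> ?T" unfolding F_def t(3) hk using t(4,5) by simp
    show "G (F q) = q" unfolding F_def G_def t(3) fst_conv snd_conv hk using t pos[of t] by (simp add: \<gamma>_def prod_eq_iff)
  qed
  have GS: "G x \<in> ?S" and FG: "F (G x) = x" if xT: "x \<in> ?T" for x
  proof -
    obtain u v z where x: "x = (u, v, z)" "norm u = 1" "norm v = 1" "z \<in> sphere 0 1" using xT by auto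
    then obtain t where t: "z = c t" using rc by blast
    have Gx: "G x = (\<alpha> t *\<^sub>R u, \<beta> t *\<^sub>R v)"
      unfolding G_def x(1) t snd_conv fst_conv hk by (simp add: \<gamma>_def)
    show "G x \<in> ?S" using x(2,3) pos[of t] by (auto simp: Gx hypersurface_def intro!: exI[of _ t])
    have nG: "(norm (\<alpha> t *\<^sub>R u), norm (\<beta> t *\<^sub>R v)) = \<gamma> t" using x pos[of t] by (simp add: \<gamma>_def)
    then show "F (G x) = x" unfolding Gx F_def fst_conv snd_conv nG hk using x(2,3) pos[of t] by (simp add: x t)
  qed
  have sF: "smooth_map_on ?S F"
    unfolding smooth_map_on_def
  proof
    fix q0 assume q0: "q0 \<in> ?S"
    then have "(norm (fst q0), norm (snd q0)) \<in> range \<gamma>" unfolding \<gamma>_def by (simp add: hypersurface_iff)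
    then obtain N h where N: "open N" "(norm (fst q0), norm (snd q0)) \<in> N" "smooth_on N h" "\<And>x. x \<in> N \<Longrightarrow> x \<in> range \<gamma> \<Longrightarrow> ?h x = h x"
      using transfer_smooth[OF cg cc] by metis
    define U where "U = {q::(real^'n) \<times> (real^'n). (norm (fst q), norm (snd q)) \<in> N} \<inter> {q. fst q \<noteq> 0} \<inter> {q. snd q \<noteq> 0}"
    have "continuous_on UNIV (\<lambda>q::(real^'n) \<times> (real^'n). (norm (fst q), norm (snd q)))" by (intro continuous_intros)
    then have oU: "open U" unfolding U_def using open_vimage[OF N(1), of "\<lambda>q::(real^'n) \<times> (real^'n). (norm (fst q), norm (snd q))"]
      by (intro open_Int open_Collect_neq continuous_intros) (simp add: vimage_def)
    let ?g = "\<lambda>q::(real^'n) \<times> (real^'n). ((1 / norm (fst q)) *\<^sub>R fst q, (1 / norm (snd q)) *\<^sub>R snd q, h (norm (fst q), norm (snd q)))"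
    have "smooth_on U ?g"
      by (intro smooth_on_intros smooth_on_compose[OF oU N(1) _ N(3)] oU) (auto simp: U_def)
    moreover have "F q = ?g q" if "q \<in> ?S \<inter> U" for q
    proof -
      have "(norm (fst q), norm (snd q)) \<in> range \<gamma>" using that unfolding \<gamma>_def by (simp add: hypersurface_iff)
      then show ?thesis using N(4) that by (simp add: F_def U_def inverse_eq_divide)
    qed
    moreover have "q0 \<in> U" using N(2) Sd[OF q0] by (auto simp: U_def)
    ultimately show "\<exists>U g. open U \<and> q0 \<in> U \<and> smooth_on U g \<and> (\<forall>x\<in>?S \<inter> U. F x = g x)" using oU by blast
  qed
  have sG: "smooth_map_on ?T G"
    unfolding smooth_map_on_def
  proof
    fix x0 assume "x0 \<in> ?T"
    then have "snd (snd x0) \<in> range c" using rc by auto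
    then obtain N h where N: "open N" "snd (snd x0) \<in> N" "smooth_on N h" "\<And>x. x \<in> N \<Longrightarrow> x \<in> range c \<Longrightarrow> ?k x = h x"
      using transfer_smooth[OF cc cg] by metis
    define U where "U = {x::(real^'n) \<times> (real^'n) \<times> (real^2). snd (snd x) \<in> N}"
    have "continuous_on UNIV (\<lambda>x::(real^'n) \<times> (real^'n) \<times> (real^2). snd (snd x))" by (intro continuous_intros)
    then have oU: "open U" unfolding U_def using open_vimage[OF N(1), of "\<lambda>x::(real^'n) \<times> (real^'n) \<times> (real^2). snd (snd x)"]
      by (simp add: vimage_def)
    let ?g = "\<lambda>x::(real^'n) \<times> (real^'n) \<times> (real^2). (fst (h (snd (snd x))) *\<^sub>R fst x, snd (h (snd (snd x))) *\<^sub>R fst (snd x))"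
    have "smooth_on U ?g"
      by (intro smooth_on_intros smooth_on_compose[OF oU N(1) _ N(3)] oU) (auto simp: U_def)
    moreover have "G x = ?g x" if "x \<in> ?T \<inter> U" for x
      using N(4)[of "snd (snd x)"] that rc by (auto simp: G_def U_def)
    moreover have "x0 \<in> U" using N(2) by (simp add: U_def)
    ultimately show "\<exists>U g. open U \<and> x0 \<in> U \<and> smooth_on U g \<and> (\<forall>x\<in>?T \<inter> U. G x = g x)" using oU by blast
  qed
  have "F ` ?S = ?T"
  proof (intro equalityI subsetI)
    fix x assume "x \<in> ?T"
    then have "F (G x) = x" "G x \<in> ?S" by (rule FG, rule GS)
    then show "x \<in> F ` ?S" by (intro image_eqI[of _ F "G x"]) simp_all
  qed (use FT in blast)
  moreover have "G ` ?T = ?S"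
  proof (intro equalityI subsetI)
    fix q assume "q \<in> ?S"
    then have "G (F q) = q" "F q \<in> ?T" by (rule GF, rule FT)
    then show "q \<in> G ` ?T" by (intro image_eqI[of _ G "F q"]) simp_all
  qed (use GS in blast)
  ultimately have "homeomorphism ?S ?T F G"
    unfolding homeomorphism_def using GF FG smooth_map_on_imp_continuous_on[OF sF] smooth_map_on_imp_continuous_on[OF sG] by blast
  then show ?thesis unfolding diffeomorphic_def using sF sG by blast
qed

lemma SO_SO_invariant: "SO_SO_invariant (hypersurface :: ((real^'n) \<times> (real^'n)) set)"
  unfolding SO_SO_invariant_def
proof (intro allI impI)
  fix A B :: "real^'n^'n" assume "rotation_matrix A \<and> rotation_matrix B"
  then have o: "orthogonal_matrix A" "orthogonal_matrix B" by (auto simp: rotation_matrix_def)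
  have nrm: "norm (M *v x) = norm x" if "orthogonal_matrix M" for M :: "real^'n^'n" and x
    using that orthogonal_transformation_matrix[of "(*v) M"] orthogonal_transformation_norm[of "(*v) M" x] by auto
  have inv: "M *v (transpose M *v x) = x" if "orthogonal_matrix M" for M :: "real^'n^'n" and x
    using that unfolding orthogonal_matrix_def by (metis matrix_vector_mul_assoc matrix_vector_mul_lid)
  let ?S = "hypersurface :: ((real^'n) \<times> (real^'n)) set"
  show "(\<lambda>(x, y). (A *v x, B *v y)) ` ?S = ?S"
  proof
    show "(\<lambda>(x, y). (A *v x, B *v y)) ` ?S \<subseteq> ?S" using nrm o by (auto simp: hypersurface_def)
    show "?S \<subseteq> (\<lambda>(x, y). (A *v x, B *v y)) ` ?S"
    proof
      fix q assume q: "q \<in> ?S"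
      have "(transpose A *v fst q, transpose B *v snd q) \<in> ?S"
        using q nrm[of "transpose A"] nrm[of "transpose B"] o by (auto simp: hypersurface_def orthogonal_matrix_transpose)
      then show "q \<in> (\<lambda>(x, y). (A *v x, B *v y)) ` ?S"
        using inv o by (intro image_eqI[of _ _ "(transpose A *v fst q, transpose B *v snd q)"]) auto
    qed
  qed
qed

end

section \<open>Mean curvature of a rotational hypersurface\<close>

definition unit :: "'a::real_normed_vector \<Rightarrow> 'a" where "unit z = (1 / norm z) *\<^sub>R z"

lemma unit_inner: "unit z \<bullet> unit z = 1" if "z \<noteq> 0"
  using that by (simp add: unit_def dot_square_norm power2_eq_square)

lemma norm_unit: "norm (unit z) = 1" if "z \<noteq> 0"
  using that by (simp add: unit_def)

lemma norm_scaleR_unit: "norm z *\<^sub>R unit z = z"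
  by (cases "z = 0") (simp_all add: unit_def)

lemma unit_scaleR_unit: "a > 0 \<Longrightarrow> z \<noteq> 0 \<Longrightarrow> unit (a *\<^sub>R unit z) = unit z"
  by (simp add: unit_def)

lemma smooth_on_unit: "open U \<Longrightarrow> smooth_on U f \<Longrightarrow> (\<And>x. x \<in> U \<Longrightarrow> f x \<noteq> 0) \<Longrightarrow> smooth_on U (\<lambda>x. unit (f x))"
  unfolding unit_def by (intro smooth_on_intros) auto

lemma perpendicular_line_nonzero:
  fixes u \<xi> :: "'a::real_inner"
  assumes "u \<noteq> 0" "u \<bullet> \<xi> = 0"
  shows "u + s *\<^sub>R \<xi> \<noteq> 0"
proof
  assume "u + s *\<^sub>R \<xi> = 0"
  then have "u \<bullet> (u + s *\<^sub>R \<xi>) = 0" by simp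
  then show False using assms by (simp add: inner_add_right)
qed

lemma norm_has_real_derivative:
  fixes x :: "real \<Rightarrow> 'a::real_inner"
  assumes "(x has_vector_derivative v) (at t)" "x t \<noteq> 0"
  shows "((\<lambda>s. norm (x s)) has_real_derivative unit (x t) \<bullet> v) (at t)"
proof -
  have "((\<lambda>s. norm (x s)) has_derivative (\<lambda>h. (h *\<^sub>R v) \<bullet> sgn (x t))) (at t)"
    using has_derivative_compose[of x "\<lambda>h. h *\<^sub>R v" t UNIV norm "\<lambda>h. h \<bullet> sgn (x t)"]
      has_derivative_norm[OF assms(2)] assms(1) unfolding has_vector_derivative_def by blast
  then show ?thesis
    unfolding has_field_derivative_def
    by (rule has_derivative_eq_rhs) (auto simp: unit_def sgn_div_norm inner_commute divide_inverse mult_ac)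
qed

text \<open>For \<xi> orthogonal to \<open>u\<close> the norm of
  \<open>u + s *\<^sub>R \<xi>\<close> is stationary at s = 0, so normalising contributes only the
  factor 1 / |u|. This differentiates both the curves on the hypersurface and the normal along
  them.\<close>

lemma unit_line_derivative:
  fixes u \<xi> :: "'a::real_inner"
  assumes "u \<noteq> 0" "u \<bullet> \<xi> = 0" "(a has_real_derivative a') (at 0)"
  shows "((\<lambda>s. a s *\<^sub>R unit (u + s *\<^sub>R \<xi>)) has_vector_derivative a' *\<^sub>R unit u + (a 0 / norm u) *\<^sub>R \<xi>) (at 0)"
proof -
  have l: "((\<lambda>s. u + s *\<^sub>R \<xi>) has_vector_derivative \<xi>) (at 0)"
    by (auto intro!: derivative_eq_intros)
  have "((\<lambda>s. norm (u + s *\<^sub>R \<xi>)) has_real_derivative unit (u + 0 *\<^sub>R \<xi>) \<bullet> \<xi>) (at 0)"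
    using norm_has_real_derivative[OF l] assms(1) by simp
  then have n: "((\<lambda>s. norm (u + s *\<^sub>R \<xi>)) has_real_derivative 0) (at 0)"
    using assms(2) by (simp add: unit_def)
  have "((\<lambda>s. a s / norm (u + s *\<^sub>R \<xi>)) has_real_derivative (a' * norm (u + 0 *\<^sub>R \<xi>) - a 0 * 0) / (norm (u + 0 *\<^sub>R \<xi>) * norm (u + 0 *\<^sub>R \<xi>))) (at 0)"
    by (rule DERIV_divide[OF assms(3) n]) (use assms(1) in simp)
  then have "((\<lambda>s. a s / norm (u + s *\<^sub>R \<xi>)) has_real_derivative a' / norm u) (at 0)" using assms(1) by simp
  from has_vector_derivative_scaleR[OF this l]
  show ?thesis by (simp add: unit_def add.commute)
qed

lemma hyperplane_basis:
  fixes u :: "real^'n"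
  assumes "u \<noteq> 0"
  obtains B where "finite B" "independent B" "span B = {\<xi>. u \<bullet> \<xi> = 0}" "card B = CARD('n) - 1"
proof -
  let ?V = "{\<xi>. u \<bullet> \<xi> = 0}"
  obtain B where B: "B \<subseteq> ?V" "independent B" "?V \<subseteq> span B" "card B = dim ?V"
    using basis_exists by metis
  have "span B = ?V" using B(1,3) span_minimal[OF B(1) subspace_hyperplane] by blast
  moreover have "dim ?V = CARD('n) - 1" using dim_hyperplane[OF assms] by simp
  ultimately show ?thesis using that B independent_imp_finite by metis
qed

context rotation_profile
begin

text \<open>A tangent vector split along the profile (coefficient \<open>l\<close>) and along the
  two spheres; it is used with \<xi> and \<eta> orthogonal to the respective components of
  \<open>q\<close>.\<close>

definition tangent :: "(real^'n) \<times> (real^'n) \<Rightarrow> real \<Rightarrow> real \<Rightarrow> real^'n \<Rightarrow> real^'n \<Rightarrow> (real^'n) \<times> (real^'n)" where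
  "tangent q t l \<xi> \<eta> = ((l * \<alpha>' t) *\<^sub>R unit (fst q) + \<xi>, (l * \<beta>' t) *\<^sub>R unit (snd q) + \<eta>)"

text \<open>The shape operator is diagonal: it has eigenvalue \<open>k\<close> along the profile and
  the eigenvalues N1 / \<alpha> and N2 / \<beta> along the two spheres, each on a space of dimension
  n - 1.\<close>

lemma mean_curvature_at:
  fixes q0 :: "(real^'n) \<times> (real^'n)"
  assumes q0: "norm (fst q0) = \<alpha> t0" "norm (snd q0) = \<beta> t0"
  obtains U \<nu> where "open U" "q0 \<in> U" "unit_normal_on hypersurface U \<nu>"
    "\<nu> q0 = (N1 t0 *\<^sub>R unit (fst q0), N2 t0 *\<^sub>R unit (snd q0))"
    "mean_curvature hypersurface \<nu> q0 = (real CARD('n) - 1) * (N1 t0 / \<alpha> t0 + N2 t0 / \<beta> t0) + k t0"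
proof -
  let ?S = "hypersurface :: ((real^'n) \<times> (real^'n)) set"
  interpret C: closed_curve "\<lambda>t. (\<alpha> t, \<beta> t)" "\<lambda>t. (\<alpha>' t, \<beta>' t)" p by (rule closed_curve_profile)
  have nz0: "fst q0 \<noteq> 0" "snd q0 \<noteq> 0" using q0 pos[of t0] by auto
  define lf where "lf = (\<lambda>z. z \<bullet> (\<alpha>' t0, \<beta>' t0))"
  have bl: "bounded_linear lf" unfolding lf_def by (rule bounded_linear_inner_left)
  have "lf (\<alpha>' t0, \<beta>' t0) \<noteq> 0" using regular[of t0] unfolding lf_def by (simp add: zero_prod_def)
  then obtain N V g I where N: "open N" "open V" "open I" "t0 \<in> I" "(\<alpha> t0, \<beta> t0) \<in> N" "smooth_on V g"
    "\<And>z. z \<in> N \<Longrightarrow> lf z \<in> V"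
    "\<And>z. z \<in> N \<Longrightarrow> z \<in> range (\<lambda>t. (\<alpha> t, \<beta> t)) \<Longrightarrow> (\<alpha> (g (lf z)), \<beta> (g (lf z))) = z"
    "\<And>s. s \<in> I \<Longrightarrow> g (lf (\<alpha> s, \<beta> s)) = s"
    by (rule C.local_parameter[OF bl, where ?t0.0 = t0]) (rule that)
  define U where "U = {q::(real^'n) \<times> (real^'n). (norm (fst q), norm (snd q)) \<in> N} \<inter> {q. fst q \<noteq> 0} \<inter> {q. snd q \<noteq> 0}"
  have "continuous_on UNIV (\<lambda>q::(real^'n) \<times> (real^'n). (norm (fst q), norm (snd q)))" by (intro continuous_intros)
  then have oU: "open U" unfolding U_def using open_vimage[OF N(1), of "\<lambda>q::(real^'n) \<times> (real^'n). (norm (fst q), norm (snd q))"]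
    by (intro open_Int open_Collect_neq continuous_intros) (simp add: vimage_def)
  have q0U: "q0 \<in> U" using N(5) nz0 q0 by (simp add: U_def)
  \<comment> \<open>The profile parameter extended off the hypersurface: \<open>T q\<close> is the
    parameter near \<open>t0\<close> at which the profile has the same value of \<open>lf\<close> as
    the pair of norms of \<open>q\<close>.\<close>
  define T where "T = (\<lambda>q::(real^'n) \<times> (real^'n). g (lf (norm (fst q), norm (snd q))))"
  define \<nu> where "\<nu> = (\<lambda>q::(real^'n) \<times> (real^'n). (N1 (T q) *\<^sub>R unit (fst q), N2 (T q) *\<^sub>R unit (snd q)))"
  have "smooth_on U (\<lambda>q::(real^'n) \<times> (real^'n). (norm (fst q), norm (snd q)))"
    by (intro smooth_on_intros oU) (auto simp: U_def)
  then have "smooth_on U (\<lambda>q::(real^'n) \<times> (real^'n). lf (norm (fst q), norm (snd q)))"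
    by (rule smooth_on_compose_linear[OF bl oU])
  then have sT: "smooth_on U T" unfolding T_def
    by (rule smooth_on_compose[OF oU N(2) _ N(6)]) (auto simp: U_def intro!: N(7))
  have s\<nu>: "smooth_on U \<nu>" unfolding \<nu>_def
    by (intro smooth_on_Pair smooth_on_scaleR smooth_on_unit oU smooth_on_compose[OF oU open_UNIV sT smooth(3)]
        smooth_on_compose[OF oU open_UNIV sT smooth(4)] smooth_on_fst smooth_on_snd smooth_on_id) (auto simp: U_def)
  have TS: "norm (fst q) = \<alpha> (T q) \<and> norm (snd q) = \<beta> (T q)" if "q \<in> ?S \<inter> U" for q
    using N(8)[of "(norm (fst q), norm (snd q))"] that by (auto simp: T_def U_def hypersurface_iff)
  have T0: "T q0 = t0" using N(9)[OF N(4)] by (simp add: T_def q0)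
  \<comment> \<open>Along any curve in the hypersurface the two norms are \<alpha> and \<beta> at
    the parameter \<open>T\<close>. The radial parts of its velocity are hence a multiple of
    (\<alpha>', \<beta>'), which is orthogonal to (N1, N2).\<close>
  have perp: "\<nu> q \<bullet> v = 0" if q: "q \<in> ?S \<inter> U" and v: "v \<in> tangent_space ?S q" for q v
  proof -
    obtain c \<epsilon> where c: "\<epsilon> > 0" "smooth_on {-\<epsilon><..<\<epsilon>} c" "c ` {-\<epsilon><..<\<epsilon>} \<subseteq> ?S" "c 0 = q"
      "(c has_vector_derivative v) (at 0)"
      using v unfolding tangent_space_def by blast
    have nz: "fst q \<noteq> 0" "snd q \<noteq> 0" using q by (auto simp: U_def)
    have dT: "(T has_derivative frechet_derivative T (at q)) (at q)"
      using smooth_on_has_derivative[OF sT, of q] q by simp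
    define \<sigma>' where "\<sigma>' = frechet_derivative T (at q) v"
    have "((\<lambda>s. T (c s)) has_derivative (\<lambda>h. frechet_derivative T (at q) (h *\<^sub>R v))) (at 0)"
      using has_derivative_compose[of c "\<lambda>h. h *\<^sub>R v" 0 UNIV T "frechet_derivative T (at q)"] c(4,5) dT
      unfolding has_vector_derivative_def by simp
    then have d\<sigma>: "((\<lambda>s. T (c s)) has_real_derivative \<sigma>') (at 0)"
      unfolding has_field_derivative_def \<sigma>'_def
      by (rule has_derivative_eq_rhs) (auto simp: linear_scale[OF has_derivative_linear[OF dT]] mult.commute)
    have "isCont c 0" using c(5) by (rule has_vector_derivative_continuous)
    then have "\<forall>\<^sub>F s in at 0. c s \<in> U" using oU q c(4) unfolding isCont_def by (auto dest: topological_tendstoD)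
    moreover have "\<forall>\<^sub>F s in at 0. s \<in> {-\<epsilon><..<\<epsilon>}"
      using c(1) by (intro eventually_at_in_open') auto
    ultimately have ev: "\<forall>\<^sub>F s in at 0. c s \<in> ?S \<inter> U"
      by eventually_elim (use c(3) in auto)
    have e0: "norm (fst (c 0)) = \<alpha> (T (c 0))" "norm (snd (c 0)) = \<beta> (T (c 0))" using TS[OF q] c(4) by auto
    have d1: "((\<lambda>s. norm (fst (c s))) has_real_derivative unit (fst q) \<bullet> fst v) (at 0)"
      using norm_has_real_derivative[OF bounded_linear.has_vector_derivative[OF bounded_linear_fst c(5)]] c(4) nz by simp
    have d2: "((\<lambda>s. norm (snd (c s))) has_real_derivative unit (snd q) \<bullet> snd v) (at 0)"
      using norm_has_real_derivative[OF bounded_linear.has_vector_derivative[OF bounded_linear_snd c(5)]] c(4) nz by simp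
    have "((\<lambda>s. norm (fst (c s))) has_real_derivative \<alpha>' (T (c 0)) * \<sigma>') (at 0)"
    proof (rule has_field_derivative_cong_eventually[where f = "\<lambda>s. \<alpha> (T (c s))", THEN iffD1, OF _ _ DERIV_chain2[OF deriv(1) d\<sigma>]])
      show "\<forall>\<^sub>F s in at 0. \<alpha> (T (c s)) = norm (fst (c s))" using ev by eventually_elim (use TS in auto)
    qed (use e0 in simp)
    then have 1: "unit (fst q) \<bullet> fst v = \<alpha>' (T q) * \<sigma>'" using DERIV_unique[OF d1] c(4) by simp
    have "((\<lambda>s. norm (snd (c s))) has_real_derivative \<beta>' (T (c 0)) * \<sigma>') (at 0)"
    proof (rule has_field_derivative_cong_eventually[where f = "\<lambda>s. \<beta> (T (c s))", THEN iffD1, OF _ _ DERIV_chain2[OF deriv(2) d\<sigma>]])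
      show "\<forall>\<^sub>F s in at 0. \<beta> (T (c s)) = norm (snd (c s))" using ev by eventually_elim (use TS in auto)
    qed (use e0 in simp)
    then have 2: "unit (snd q) \<bullet> snd v = \<beta>' (T q) * \<sigma>'" using DERIV_unique[OF d2] c(4) by simp
    have "\<nu> q \<bullet> v = (N1 (T q) * \<alpha>' (T q) + N2 (T q) * \<beta>' (T q)) * \<sigma>'"
      by (simp add: \<nu>_def inner_prod_def 1 2 algebra_simps)
    then show ?thesis by (simp add: normal)
  qed
  have un: "unit_normal_on ?S U \<nu>"
    unfolding unit_normal_on_def
  proof (intro conjI ballI s\<nu> perp)
    fix q assume "q \<in> ?S \<inter> U"
    then have "fst q \<noteq> 0" "snd q \<noteq> 0" by (auto simp: U_def)
    then show "norm (\<nu> q) = 1" by (simp add: \<nu>_def norm_Pair norm_unit unit)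
  qed
  let ?u = "unit (fst q0)" and ?v = "unit (snd q0)"
  let ?D = "frechet_derivative \<nu> (at q0)"
  have uv: "?u \<bullet> ?u = 1" "?v \<bullet> ?v = 1" using unit_inner nz0 by auto
  have dD: "(\<nu> has_derivative ?D) (at q0)" using smooth_on_has_derivative[OF s\<nu> q0U] .
  have \<nu>0: "\<nu> q0 = (N1 t0 *\<^sub>R ?u, N2 t0 *\<^sub>R ?v)" by (simp add: \<nu>_def T0)
  \<comment> \<open>An explicit curve moves the profile parameter at speed l and tilts the two
    directions along \<xi> and \<eta>. Differentiating \<nu> along it computes the shape operator on
    its velocity.\<close>
  have curves: "tangent q0 t0 l \<xi> \<eta> \<in> tangent_space ?S q0 \<and>
      ?D (tangent q0 t0 l \<xi> \<eta>) = ((l * (k t0 * \<alpha>' t0)) *\<^sub>R ?u + (N1 t0 / \<alpha> t0) *\<^sub>R \<xi>,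
         (l * (k t0 * \<beta>' t0)) *\<^sub>R ?v + (N2 t0 / \<beta> t0) *\<^sub>R \<eta>)"
    if perp': "fst q0 \<bullet> \<xi> = 0" "snd q0 \<bullet> \<eta> = 0" for l \<xi> \<eta>
  proof -
    define c where "c = (\<lambda>s. (\<alpha> (t0 + l * s) *\<^sub>R unit (fst q0 + s *\<^sub>R \<xi>), \<beta> (t0 + l * s) *\<^sub>R unit (snd q0 + s *\<^sub>R \<eta>)))"
    have nzl: "fst q0 + s *\<^sub>R \<xi> \<noteq> 0" "snd q0 + s *\<^sub>R \<eta> \<noteq> 0" for s
      using perpendicular_line_nonzero nz0 perp' by auto
    have dl: "((\<lambda>s. t0 + l * s) has_real_derivative l) (at 0)" by (auto intro!: derivative_eq_intros)
    have ch: "((\<lambda>s. f (t0 + l * s)) has_real_derivative l * f') (at 0)"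
      if "(f has_real_derivative f') (at t0)" for f f'
      using DERIV_chain2[of f f' "\<lambda>s. t0 + l * s" 0 l] that dl by (simp add: mult.commute)
    have c0: "c 0 = q0" by (simp add: c_def prod_eq_iff norm_scaleR_unit flip: q0)
    have sc: "smooth_on UNIV c"
      unfolding c_def
      by (intro smooth_on_Pair smooth_on_scaleR smooth_on_unit open_UNIV smooth_on_compose[OF open_UNIV open_UNIV _ smooth(1)]
          smooth_on_compose[OF open_UNIV open_UNIV _ smooth(2)] smooth_on_intros nzl) auto
    have cS: "c s \<in> ?S" for s
      unfolding hypersurface_def c_def using norm_unit[OF nzl(1)[of s]] norm_unit[OF nzl(2)[of s]] pos[of "t0 + l * s"] by (auto intro!: exI[of _ "t0 + l * s"])
    have cd: "(c has_vector_derivative tangent q0 t0 l \<xi> \<eta>) (at 0)"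
      unfolding c_def tangent_def
      using has_vector_derivative_Pair[OF unit_line_derivative[OF nz0(1) perp'(1) ch[OF deriv(1)]]
          unit_line_derivative[OF nz0(2) perp'(2) ch[OF deriv(2)]]] pos[of t0]
      by (simp add: q0)
    have tan: "tangent q0 t0 l \<xi> \<eta> \<in> tangent_space ?S q0"
      unfolding tangent_space_def using c0 cS cd smooth_on_subset[OF sc]
      by (intro CollectI exI[of _ c] exI[of _ "1::real"]) auto
    have "isCont (\<lambda>s. t0 + l * s) 0" by (intro continuous_intros)
    then have evI: "\<forall>\<^sub>F s in at 0. t0 + l * s \<in> I"
      using N(3,4) unfolding isCont_def by (auto dest: topological_tendstoD)
    have nuc: "\<nu> (c s) = (N1 (t0 + l * s) *\<^sub>R unit (fst q0 + s *\<^sub>R \<xi>), N2 (t0 + l * s) *\<^sub>R unit (snd q0 + s *\<^sub>R \<eta>))"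
      if "t0 + l * s \<in> I" for s
    proof -
      have "T (c s) = t0 + l * s"
        using N(9)[OF that] norm_unit[OF nzl(1)[of s]] norm_unit[OF nzl(2)[of s]] pos[of "t0 + l * s"] by (simp add: T_def c_def)
      then show ?thesis using nzl pos[of "t0 + l * s"] by (simp add: \<nu>_def) (simp add: c_def unit_scaleR_unit)
    qed
    have "((\<lambda>s. \<nu> (c s)) has_derivative (\<lambda>h. ?D (h *\<^sub>R tangent q0 t0 l \<xi> \<eta>))) (at 0)"
      using has_derivative_compose[of c "\<lambda>h. h *\<^sub>R tangent q0 t0 l \<xi> \<eta>" 0 UNIV \<nu> ?D] c0 cd dD
      unfolding has_vector_derivative_def by simp
    then have A: "((\<lambda>s. \<nu> (c s)) has_vector_derivative ?D (tangent q0 t0 l \<xi> \<eta>)) (at 0)"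
      unfolding has_vector_derivative_def by (simp add: linear_scale[OF has_derivative_linear[OF dD]])
    have "((\<lambda>s. (N1 (t0 + l * s) *\<^sub>R unit (fst q0 + s *\<^sub>R \<xi>), N2 (t0 + l * s) *\<^sub>R unit (snd q0 + s *\<^sub>R \<eta>)))
       has_vector_derivative ((l * (k t0 * \<alpha>' t0)) *\<^sub>R ?u + (N1 t0 / \<alpha> t0) *\<^sub>R \<xi>,
         (l * (k t0 * \<beta>' t0)) *\<^sub>R ?v + (N2 t0 / \<beta> t0) *\<^sub>R \<eta>)) (at 0)"
      using has_vector_derivative_Pair[OF unit_line_derivative[OF nz0(1) perp'(1) ch[OF deriv(3)]]
          unit_line_derivative[OF nz0(2) perp'(2) ch[OF deriv(4)]]]
      by (simp add: q0)
    then have "((\<lambda>s. \<nu> (c s)) has_vector_derivative ((l * (k t0 * \<alpha>' t0)) *\<^sub>R ?u + (N1 t0 / \<alpha> t0) *\<^sub>R \<xi>,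
         (l * (k t0 * \<beta>' t0)) *\<^sub>R ?v + (N2 t0 / \<beta> t0) *\<^sub>R \<eta>)) (at 0)"
      unfolding has_vector_derivative_def
      by (rule has_derivative_transform_eventually) (use evI nuc N(4) in \<open>auto elim!: eventually_mono\<close>)
    from vector_derivative_unique_at[OF A this] tan show ?thesis by blast
  qed
  define Tan where "Tan = {v. \<nu> q0 \<bullet> v = 0}"
  have q0S: "q0 \<in> ?S" using q0 by (auto simp: hypersurface_def)
  have "norm (\<nu> q0) = 1" using un q0U q0S unfolding unit_normal_on_def by blast
  then have \<nu>nz: "\<nu> q0 \<noteq> 0" by auto
  \<comment> \<open>The radial parts (a, b) of \<open>w\<close> are orthogonal to (N1, N2) in the
    plane, hence a multiple of (\<alpha>', \<beta>'); \<open>l\<close> is the projection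
    coefficient. What remains is tangent to the two spheres.\<close>
  have decomp: "\<exists>l \<xi> \<eta>. fst q0 \<bullet> \<xi> = 0 \<and> snd q0 \<bullet> \<eta> = 0 \<and> w = tangent q0 t0 l \<xi> \<eta>" if "w \<in> Tan" for w
  proof -
    define a where "a = ?u \<bullet> fst w"
    define b where "b = ?v \<bullet> snd w"
    define n where "n = (\<alpha>' t0)\<^sup>2 + (\<beta>' t0)\<^sup>2"
    have n: "n > 0" using regular[of t0] by (auto simp: n_def sum_power2_gt_zero_iff)
    have ab: "N1 t0 * a + N2 t0 * b = 0" using that by (simp add: Tan_def \<nu>0 inner_prod_def a_def b_def)
    define l where "l = (\<alpha>' t0 * a + \<beta>' t0 * b) / n"
    have ln: "l * n = \<alpha>' t0 * a + \<beta>' t0 * b" using n by (simp add: l_def)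
    have cross: "a * \<beta>' t0 = b * \<alpha>' t0"
    proof -
      have "(N1 t0)\<^sup>2 * (a * \<beta>' t0 - b * \<alpha>' t0) = N1 t0 * \<beta>' t0 * (N1 t0 * a + N2 t0 * b) - b * N1 t0 * (N1 t0 * \<alpha>' t0 + N2 t0 * \<beta>' t0)"
        by (simp add: power2_eq_square algebra_simps)
      moreover have "(N2 t0)\<^sup>2 * (a * \<beta>' t0 - b * \<alpha>' t0) = a * N2 t0 * (N1 t0 * \<alpha>' t0 + N2 t0 * \<beta>' t0) - N2 t0 * \<alpha>' t0 * (N1 t0 * a + N2 t0 * b)"
        by (simp add: power2_eq_square algebra_simps)
      ultimately have "((N1 t0)\<^sup>2 + (N2 t0)\<^sup>2) * (a * \<beta>' t0 - b * \<alpha>' t0) = 0"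
        unfolding distrib_right ab normal by linarith
      then show ?thesis by (simp add: unit)
    qed
    have "(l * \<alpha>' t0) * n = a * n"
    proof -
      have "(l * \<alpha>' t0) * n = (l * n) * \<alpha>' t0" by simp
      also have "\<dots> = a * (\<alpha>' t0)\<^sup>2 + \<beta>' t0 * (b * \<alpha>' t0)" unfolding ln by (simp add: power2_eq_square algebra_simps)
      also have "\<dots> = a * n" unfolding cross[symmetric] by (simp add: n_def power2_eq_square algebra_simps)
      finally show ?thesis .
    qed
    then have la: "l * \<alpha>' t0 = a" using n by simp
    have "(l * \<beta>' t0) * n = b * n"
    proof -
      have "(l * \<beta>' t0) * n = (l * n) * \<beta>' t0" by simp
      also have "\<dots> = b * (\<beta>' t0)\<^sup>2 + \<alpha>' t0 * (a * \<beta>' t0)" unfolding ln by (simp add: power2_eq_square algebra_simps)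
      also have "\<dots> = b * n" unfolding cross by (simp add: n_def power2_eq_square algebra_simps)
      finally show ?thesis .
    qed
    then have lb: "l * \<beta>' t0 = b" using n by simp
    have "?u \<bullet> (fst w - a *\<^sub>R ?u) = 0" "?v \<bullet> (snd w - b *\<^sub>R ?v) = 0"
      by (simp_all add: inner_diff_right uv a_def b_def)
    then have "fst q0 \<bullet> (fst w - a *\<^sub>R ?u) = 0" "snd q0 \<bullet> (snd w - b *\<^sub>R ?v) = 0"
      using nz0 by (simp_all add: unit_def)
    then show ?thesis
      by (intro exI[of _ l] exI[of _ "fst w - a *\<^sub>R ?u"] exI[of _ "snd w - b *\<^sub>R ?v"])
        (simp add: tangent_def la lb)
  qed
  have tan_eq: "tangent_space ?S q0 = Tan"
  proof
    show "tangent_space ?S q0 \<subseteq> Tan" using perp[OF IntI[OF q0S q0U]] unfolding Tan_def by blast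
    show "Tan \<subseteq> tangent_space ?S q0" using decomp curves by blast
  qed
  obtain Bu where Bu: "finite Bu" "independent Bu" "span Bu = {\<xi>. fst q0 \<bullet> \<xi> = 0}" "card Bu = CARD('n) - 1"
    using hyperplane_basis[OF nz0(1)] by blast
  obtain Bv where Bv: "finite Bv" "independent Bv" "span Bv = {\<eta>. snd q0 \<bullet> \<eta> = 0}" "card Bv = CARD('n) - 1"
    using hyperplane_basis[OF nz0(2)] by blast
  have Bu': "fst q0 \<bullet> \<xi> = 0" "\<xi> \<noteq> 0" if "\<xi> \<in> Bu" for \<xi>
    using that Bu(3) span_base[OF that] Bu(2) dependent_zero by auto
  have Bv': "snd q0 \<bullet> \<eta> = 0" "\<eta> \<noteq> 0" if "\<eta> \<in> Bv" for \<eta>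
    using that Bv(3) span_base[OF that] Bv(2) dependent_zero by auto
  define b0 where "b0 = tangent q0 t0 1 0 0"
  let ?i1 = "\<lambda>\<xi>::real^'n. (\<xi>, 0::real^'n)" and ?i2 = "\<lambda>\<eta>::real^'n. (0::real^'n, \<eta>)"
  have t1: "?i1 \<xi> = tangent q0 t0 0 \<xi> 0" "?i2 \<eta> = tangent q0 t0 0 0 \<eta>" for \<xi> \<eta> by (simp_all add: tangent_def)
  define B where "B = insert b0 (?i1 ` Bu \<union> ?i2 ` Bv)"
  have fB: "finite B" using Bu Bv by (simp add: B_def)
  have b0n: "b0 \<notin> ?i1 ` Bu \<union> ?i2 ` Bv"
  proof
    assume "b0 \<in> ?i1 ` Bu \<union> ?i2 ` Bv"
    then have "(\<exists>\<xi>. fst q0 \<bullet> \<xi> = 0 \<and> b0 = (\<xi>, 0)) \<or> (\<exists>\<eta>. snd q0 \<bullet> \<eta> = 0 \<and> b0 = (0, \<eta>))" using Bu' Bv' by auto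
    then have "?u \<bullet> fst b0 = 0" "?v \<bullet> snd b0 = 0" by (auto simp: unit_def)
    then have "\<alpha>' t0 = 0" "\<beta>' t0 = 0" by (simp_all add: b0_def tangent_def uv)
    then show False using regular[of t0] by simp
  qed
  have disj: "?i1 ` Bu \<inter> ?i2 ` Bv = {}" using Bu' by auto
  have inj: "inj_on ?i1 Bu" "inj_on ?i2 Bv" by (auto intro: inj_onI)
  have B_tan: "B \<subseteq> Tan"
    unfolding tan_eq[symmetric] B_def b0_def t1 using curves Bu' Bv' by auto
  have Tan_span: "Tan \<subseteq> span B"
  proof
    fix w assume "w \<in> Tan"
    then obtain l \<xi> \<eta> where w: "fst q0 \<bullet> \<xi> = 0" "snd q0 \<bullet> \<eta> = 0" "w = tangent q0 t0 l \<xi> \<eta>" using decomp by blast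
    have li: "linear ?i1" "linear ?i2" by (auto intro!: linearI)
    have "\<xi> \<in> span Bu" "\<eta> \<in> span Bv" using w Bu(3) Bv(3) by auto
    then have "?i1 \<xi> \<in> span (?i1 ` Bu)" "?i2 \<eta> \<in> span (?i2 ` Bv)"
      using linear_span_image[OF li(1), of Bu] linear_span_image[OF li(2), of Bv] by auto
    then have 1: "?i1 \<xi> \<in> span B" "?i2 \<eta> \<in> span B"
      using span_mono[of "?i1 ` Bu" B] span_mono[of "?i2 ` Bv" B] by (auto simp: B_def)
    have "w = l *\<^sub>R b0 + (?i1 \<xi> + ?i2 \<eta>)" by (simp add: w(3) b0_def tangent_def)
    moreover have "b0 \<in> span B" by (rule span_base) (simp add: B_def)
    ultimately show "w \<in> span B" using 1 by (simp only: span_add span_scale)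
  qed
  have span_B: "span B = Tan"
    using Tan_span span_minimal[OF B_tan] subspace_hyperplane[of "\<nu> q0"] unfolding Tan_def by blast
  \<comment> \<open>Independence comes from counting: \<open>B\<close> has at most 2n - 1 elements
    and spans a hyperplane of dimension 2n - 1.\<close>
  have cardn: "CARD('n) \<ge> 1" using zero_less_card_finite[where 'a='n] by linarith
  have "card (?i1 ` Bu \<union> ?i2 ` Bv) \<le> (CARD('n) - 1) + (CARD('n) - 1)"
    using card_Un_le[of "?i1 ` Bu" "?i2 ` Bv"] card_image[OF inj(1)] card_image[OF inj(2)] Bu Bv by simp
  then have "card B \<le> 2 * CARD('n) - 1"
    unfolding B_def using card_insert_le_m1[of "2 * CARD('n) - 1" "?i1 ` Bu \<union> ?i2 ` Bv" b0] cardn by simp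
  moreover have "dim Tan = 2 * CARD('n) - 1"
    unfolding Tan_def using dim_hyperplane[OF \<nu>nz] by simp
  ultimately have indB: "independent B"
    using card_le_dim_spanning[OF B_tan Tan_span fB] by simp
  \<comment> \<open>Once \<open>b0\<close> is set aside, \<open>snd b = 0\<close> singles out the
    vectors from \<open>Bu\<close>, because the elements of \<open>Bv\<close> are nonzero.\<close>
  define kk where "kk = (\<lambda>b. if b = b0 then k t0 else if snd b = 0 then N1 t0 / \<alpha> t0 else N2 t0 / \<beta> t0)"
  have k1: "kk (?i1 \<xi>) = N1 t0 / \<alpha> t0" if "\<xi> \<in> Bu" for \<xi> using that b0n by (auto simp: kk_def)
  have k2: "kk (?i2 \<eta>) = N2 t0 / \<beta> t0" if "\<eta> \<in> Bv" for \<eta> using that b0n Bv' by (auto simp: kk_def)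
  have ev: "?D b = kk b *\<^sub>R b" if bB: "b \<in> B" for b
  proof -
    consider "b = b0" | \<xi> where "\<xi> \<in> Bu" "b = ?i1 \<xi>" | \<eta> where "\<eta> \<in> Bv" "b = ?i2 \<eta>"
      using bB by (auto simp: B_def)
    then show ?thesis
    proof cases
      case 1
      then show ?thesis using curves[of 0 0 1] by (simp add: b0_def kk_def) (simp add: tangent_def)
    next
      case 2
      then show ?thesis using curves[of \<xi> 0 0] Bu' k1 by (simp flip: t1)
    next
      case 3
      then show ?thesis using curves[of 0 \<eta> 0] Bv' k2 by (simp flip: t1)
    qed
  qed
  have "mean_curvature ?S \<nu> q0 = (\<Sum>b\<in>B. kk b)"
    unfolding mean_curvature_def principal_curvatures_def principal_directions_def tan_eq span_B[symmetric]
    by (rule sum_eigenvalues[OF has_derivative_linear[OF dD] fB indB ev])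
  also have "\<dots> = kk b0 + (\<Sum>b\<in>?i1 ` Bu \<union> ?i2 ` Bv. kk b)"
    unfolding B_def using Bu Bv b0n by (intro sum.insert) auto
  also have "\<dots> = kk b0 + ((\<Sum>b\<in>?i1 ` Bu. kk b) + (\<Sum>b\<in>?i2 ` Bv. kk b))"
    using Bu Bv disj by (subst sum.union_disjoint) auto
  also have "\<dots> = k t0 + (real (card Bu) * (N1 t0 / \<alpha> t0) + real (card Bv) * (N2 t0 / \<beta> t0))"
    using k1 k2 by (simp add: sum.reindex[OF inj(1)] sum.reindex[OF inj(2)]) (simp add: kk_def)
  also have "\<dots> = (real CARD('n) - 1) * (N1 t0 / \<alpha> t0 + N2 t0 / \<beta> t0) + k t0"
    using cardn by (simp add: Bu(4) Bv(4) of_nat_diff algebra_simps)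
  finally show ?thesis by (rule that[OF oU q0U un \<nu>0])
qed

lemma self_shrinker:
  assumes "\<And>t. (real CARD('n) - 1) * (N1 t / \<alpha> t + N2 t / \<beta> t) + k t = (\<alpha> t * N1 t + \<beta> t * N2 t) / 2"
  shows "self_shrinker (hypersurface :: ((real^'n) \<times> (real^'n)) set)"
  unfolding self_shrinker_def
proof (intro conjI ballI smooth_hypersurface)
  fix q0 :: "(real^'n) \<times> (real^'n)" assume "q0 \<in> hypersurface"
  then obtain t where t: "norm (fst q0) = \<alpha> t" "norm (snd q0) = \<beta> t" by (auto simp: hypersurface_def)
  have nz: "fst q0 \<noteq> 0" "snd q0 \<noteq> 0" using t pos[of t] by auto
  obtain U \<nu> where U: "open U" "q0 \<in> U" "unit_normal_on hypersurface U \<nu>"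
    "\<nu> q0 = (N1 t *\<^sub>R unit (fst q0), N2 t *\<^sub>R unit (snd q0))"
    "mean_curvature hypersurface \<nu> q0 = (real CARD('n) - 1) * (N1 t / \<alpha> t + N2 t / \<beta> t) + k t"
    by (rule mean_curvature_at[OF t])
  have "z \<bullet> unit z = norm z" if "z \<noteq> 0" for z :: "real^'n"
    using that by (simp add: unit_def dot_square_norm power2_eq_square)
  then have "q0 \<bullet> \<nu> q0 = \<alpha> t * N1 t + \<beta> t * N2 t"
    using nz t by (simp add: U(4) inner_prod_def mult.commute)
  then show "\<exists>U \<nu>. open U \<and> q0 \<in> U \<and> unit_normal_on hypersurface U \<nu> \<and>
        mean_curvature hypersurface \<nu> q0 = (q0 \<bullet> \<nu> q0) / 2"
    using U assms[of t] by (intro exI[of _ U] exI[of _ \<nu>]) simp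
qed

end

section \<open>The profile equation\<close>

text \<open>Boundedness is included because Lipschitz functions alone are not closed under
  products.\<close>

definition bdd_lipschitz :: "('a::metric_space \<Rightarrow> real) \<Rightarrow> bool" where
  "bdd_lipschitz f \<longleftrightarrow> (\<exists>B. (\<forall>x. \<bar>f x\<bar> \<le> B) \<and> (\<forall>x y. \<bar>f x - f y\<bar> \<le> B * dist x y))"

lemma bdd_lipschitz_mult:
  assumes "bdd_lipschitz f" "bdd_lipschitz g"
  shows "bdd_lipschitz (\<lambda>x. f x * g x)"
proof -
  obtain A B where A: "\<And>x. \<bar>f x\<bar> \<le> A" "\<And>x y. \<bar>f x - f y\<bar> \<le> A * dist x y"
    and B: "\<And>x. \<bar>g x\<bar> \<le> B" "\<And>x y. \<bar>g x - g y\<bar> \<le> B * dist x y"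
    using assms by (auto simp: bdd_lipschitz_def)
  have A0: "A \<ge> 0" and B0: "B \<ge> 0" using A(1) B(1) abs_ge_zero order_trans by blast+
  have "\<bar>f x * g x\<bar> \<le> 2 * A * B" for x
  proof -
    have "\<bar>f x * g x\<bar> \<le> A * B" using A(1) B(1) A0 by (simp add: abs_mult mult_mono)
    also have "\<dots> \<le> 2 * A * B" using A0 B0 by simp
    finally show ?thesis .
  qed
  moreover have "\<bar>f x * g x - f y * g y\<bar> \<le> 2 * A * B * dist x y" for x y
  proof -
    have "f x * g x - f y * g y = f x * (g x - g y) + g y * (f x - f y)" by (simp add: algebra_simps)
    then have "\<bar>f x * g x - f y * g y\<bar> \<le> \<bar>f x\<bar> * \<bar>g x - g y\<bar> + \<bar>g y\<bar> * \<bar>f x - f y\<bar>"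
      by (metis abs_mult abs_triangle_ineq)
    also have "\<dots> \<le> A * (B * dist x y) + B * (A * dist x y)"
      using A B A0 B0 by (intro add_mono mult_mono) auto
    finally show ?thesis by (simp add: algebra_simps)
  qed
  ultimately show ?thesis unfolding bdd_lipschitz_def by blast
qed

lemma bdd_lipschitz_const: "bdd_lipschitz (\<lambda>x. a)"
  unfolding bdd_lipschitz_def by (intro exI[of _ "\<bar>a\<bar>"]) auto

lemma bdd_lipschitz_diff:
  assumes "bdd_lipschitz f" "bdd_lipschitz g"
  shows "bdd_lipschitz (\<lambda>x. f x - g x)"
proof -
  obtain A B where A: "\<And>x. \<bar>f x\<bar> \<le> A" "\<And>x y. \<bar>f x - f y\<bar> \<le> A * dist x y"
    and B: "\<And>x. \<bar>g x\<bar> \<le> B" "\<And>x y. \<bar>g x - g y\<bar> \<le> B * dist x y"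
    using assms by (auto simp: bdd_lipschitz_def)
  have "\<bar>f x - g x\<bar> \<le> A + B" for x using A(1)[of x] B(1)[of x] by linarith
  moreover have "\<bar>(f x - g x) - (f y - g y)\<bar> \<le> (A + B) * dist x y" for x y
    using A(2)[of x y] B(2)[of x y] unfolding distrib_right by linarith
  ultimately show ?thesis unfolding bdd_lipschitz_def by blast
qed

lemma bdd_lipschitz_power: "bdd_lipschitz f \<Longrightarrow> bdd_lipschitz (\<lambda>x. f x ^ k)"
  by (induction k) (auto intro: bdd_lipschitz_mult bdd_lipschitz_const)

lemma bdd_lipschitz_compose:
  assumes "bdd_lipschitz f" "\<And>x y. dist (h x) (h y) \<le> dist x y"
  shows "bdd_lipschitz (\<lambda>x. f (h x))"
proof -
  obtain A where A: "\<And>x. \<bar>f x\<bar> \<le> A" "\<And>x y. \<bar>f x - f y\<bar> \<le> A * dist x y"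
    using assms by (auto simp: bdd_lipschitz_def)
  have A0: "A \<ge> 0" using A(1) abs_ge_zero order_trans by blast
  have "\<bar>f (h x) - f (h y)\<bar> \<le> A * dist x y" for x y
    using A(2)[of "h x" "h y"] mult_left_mono[OF assms(2)[of x y] A0] by linarith
  then show ?thesis using A(1) unfolding bdd_lipschitz_def by blast
qed

lemma bdd_lipschitz_deriv:
  fixes f :: "real \<Rightarrow> real"
  assumes "\<And>x. \<bar>f x\<bar> \<le> A" "\<And>x. (f has_real_derivative f' x) (at x)" "\<And>x. \<bar>f' x\<bar> \<le> B"
  shows "bdd_lipschitz f"
proof -
  have "\<bar>f x - f y\<bar> \<le> B * dist x y" for x y
    using field_differentiable_bound[of UNIV f f' B x y] assms(2,3) by (auto simp: dist_norm)
  moreover have "B * dist x y \<le> max A B * dist x y" for x y :: real by (simp add: mult_right_mono)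
  ultimately have "\<bar>f x - f y\<bar> \<le> max A B * dist x y" for x y by (meson order_trans)
  then show ?thesis using assms(1) unfolding bdd_lipschitz_def by (meson max.coboundedI1)
qed

lemma exp_linear_minus_exp_bounded:
  fixes a c :: real
  assumes "a > 0" "c > 0"
  obtains B where "\<And>x. exp (a * x - c * exp (2 * x)) \<le> B"
proof
  fix x
  \<comment> \<open>The maximiser of a x - c exp (2x); the bound is the tangent line inequality for
    exp at this point.\<close>
  define s where "s = ln (a / (2 * c)) / 2"
  have es: "exp (2 * s) = a / (2 * c)" using assms by (simp add: s_def)
  have "1 + (2 * x - 2 * s) \<le> exp (2 * x - 2 * s)" by (rule exp_ge_add_one_self)
  then have "exp (2 * s) * (1 + (2 * x - 2 * s)) \<le> exp (2 * s) * exp (2 * x - 2 * s)" by simp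
  also have "exp (2 * s) * exp (2 * x - 2 * s) = exp (2 * x)" by (simp flip: exp_add)
  finally have "c * (a / (2 * c) * (1 + (2 * x - 2 * s))) \<le> c * exp (2 * x)" using assms(2) unfolding es by (rule_tac mult_left_mono) auto
  moreover have "c * (a / (2 * c) * (1 + (2 * x - 2 * s))) = a / 2 * (1 + (2 * x - 2 * s))" using assms by simp
  ultimately have "a * x - c * exp (2 * x) \<le> - (a / 2 * (1 - 2 * s))" by (simp add: algebra_simps)
  then show "exp (a * x - c * exp (2 * x)) \<le> exp (- (a / 2 * (1 - 2 * s)))" by simp
qed

lemma deriv_nonneg_le:
  fixes f f' :: "real \<Rightarrow> real"
  assumes "a \<le> b" "\<And>x. (f has_real_derivative f' x) (at x)" "\<And>x. a \<le> x \<Longrightarrow> x \<le> b \<Longrightarrow> 0 \<le> f' x"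
  shows "f a \<le> f b"
  using DERIV_nonneg_imp_nondecreasing[of a b f] assms by metis

lemma deriv_nonpos_le:
  fixes f f' :: "real \<Rightarrow> real"
  assumes "a \<le> b" "\<And>x. (f has_real_derivative f' x) (at x)" "\<And>x. a \<le> x \<Longrightarrow> x \<le> b \<Longrightarrow> f' x \<le> 0"
  shows "f b \<le> f a"
  using DERIV_nonpos_imp_nonincreasing[of a b f] assms by metis

lemma deriv_pos_less:
  fixes f f' :: "real \<Rightarrow> real"
  assumes "a < b" "\<And>x. (f has_real_derivative f' x) (at x)" "\<And>x. a < x \<Longrightarrow> x < b \<Longrightarrow> 0 < f' x"
  shows "f a < f b"
proof (rule DERIV_pos_imp_increasing_open[OF assms(1)])
  show "continuous_on {a..b} f" using DERIV_isCont[OF assms(2)] by (simp add: continuous_at_imp_continuous_on)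
qed (use assms in metis)

lemma deriv_neg_less:
  fixes f f' :: "real \<Rightarrow> real"
  assumes "a < b" "\<And>x. (f has_real_derivative f' x) (at x)" "\<And>x. a < x \<Longrightarrow> x < b \<Longrightarrow> f' x < 0"
  shows "f b < f a"
proof (rule DERIV_neg_imp_decreasing_open[OF assms(1)])
  show "continuous_on {a..b} f" using DERIV_isCont[OF assms(2)] by (simp add: continuous_at_imp_continuous_on)
qed (use assms in metis)

text \<open>Uniqueness in Gronwall form: exp (- K t) h is nonincreasing and exp (K t) h is
  nondecreasing, so a zero of a nonnegative \<open>h\<close> spreads in both directions of
  time.\<close>

lemma deriv_le_self_zero:
  fixes h h' :: "real \<Rightarrow> real"
  assumes "\<And>t. (h has_real_derivative h' t) (at t)" "\<And>t. \<bar>h' t\<bar> \<le> K * h t" "\<And>t. h t \<ge> 0" "h s = 0"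
  shows "h t = 0"
proof -
  have d: "((\<lambda>t. exp (a * t) * h t) has_real_derivative exp (a * t) * (a * h t + h' t)) (at t)" for a t
    by (rule DERIV_cong[OF DERIV_mult[OF _ assms(1)]], auto intro!: derivative_eq_intros simp: algebra_simps)
  have "h t \<le> 0"
  proof (cases "s \<le> t")
    case True
    have "exp (- K * t) * h t \<le> exp (- K * s) * h s"
      by (rule deriv_nonpos_le[OF True d[of "-K"]]) (use assms(2) in \<open>auto simp: mult_le_0_iff abs_le_iff\<close>)
    then show ?thesis using assms(4) by (simp add: mult_le_0_iff)
  next
    case False
    have "exp (K * t) * h t \<le> exp (K * s) * h s"
      by (rule deriv_nonneg_le[OF _ d[of K]]) (use False assms(2) in \<open>auto simp: zero_le_mult_iff abs_le_iff, smt (verit)\<close>)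
    then show ?thesis using assms(4) by (simp add: mult_le_0_iff)
  qed
  then show ?thesis using assms(3)[of t] by simp
qed

section \<open>The Hamiltonian system of the profile curve\<close>

locale profile =
  fixes m :: nat
  assumes m1: "1 \<le> m"
begin

definition cc :: real where "cc = 2 * real m + 1"

definition w :: "real \<Rightarrow> real" where "w x = exp (cc * x - cc / 2 * exp (2 * x))"

text \<open>The geodesic equation in conformal time: with \<open>E = w\<^sup>2\<close> the vector \<open>(P, Q) = (X', Y')\<close> satisfies
  \<open>(P', Q') = 1/2 grad (E(X) cos (2Y)\<^sup>2\<^sup>m)\<close>. In this form the singularities of the arclength equation at
  \<open>Y = \<plusminus> \<pi>/4\<close> become rest points.\<close>

definition field :: "real \<times> real \<times> real \<times> real \<Rightarrow> real \<times> real \<times> real \<times> real" where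
  "field z = (let x = fst z; y = fst (snd z); p = fst (snd (snd z)); q = snd (snd (snd z)) in
     (p, q, cc * (1 - exp (2 * x)) * (w x)\<^sup>2 * cos (2 * y) ^ (2 * m),
      - (2 * real m) * sin (2 * y) * cos (2 * y) ^ (2 * m - 1) * (w x)\<^sup>2))"

lemma cc3: "cc \<ge> 3" using m1 by (simp add: cc_def)

lemma w_pos: "w x > 0" by (simp add: w_def)

lemma w_deriv: "(w has_real_derivative cc * (1 - exp (2 * x)) * w x) (at x)"
  unfolding w_def[abs_def] by (auto intro!: derivative_eq_intros simp: algebra_simps)

lemma w_mono_neg: "x \<le> y \<Longrightarrow> y \<le> 0 \<Longrightarrow> w x \<le> w y"
  using cc3 by (intro deriv_nonneg_le[OF _ w_deriv] mult_nonneg_nonneg less_imp_le[OF w_pos]) auto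

lemma w_mono_pos: "0 \<le> x \<Longrightarrow> x \<le> y \<Longrightarrow> w y \<le> w x"
  using cc3 by (intro deriv_nonpos_le[OF _ w_deriv] mult_nonpos_nonneg mult_nonneg_nonpos less_imp_le[OF w_pos]) auto

lemma w_le_1: "w x \<le> 1"
proof -
  have "w x \<le> w 0" using w_mono_neg[of x 0] w_mono_pos[of 0 x] by (cases "x \<le> 0") auto
  also have "w 0 \<le> 1" using cc3 by (simp add: w_def)
  finally show ?thesis .
qed

lemma w_sq: "(w x)\<^sup>2 = exp (2 * cc * x - cc * exp (2 * x))"
  by (simp add: w_def power2_eq_square flip: exp_add)

text \<open>The function exp (2 k x) (w x)^2. The derivative of \<open>e k\<close> is a combination
  of \<open>e k\<close> and \<open>e (Suc k)\<close>, so boundedness of the whole family gives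
  Lipschitz bounds as well.\<close>

definition e :: "nat \<Rightarrow> real \<Rightarrow> real" where "e k x = exp ((2 * cc + 2 * real k) * x - cc * exp (2 * x))"

lemma bdd_lipschitz_e: "bdd_lipschitz (e k)"
proof -
  have "\<exists>B. \<forall>x. e k x \<le> B" for k
    using exp_linear_minus_exp_bounded[of "2 * cc + 2 * real k" cc] cc3 unfolding e_def
    by (metis add_pos_nonneg mult_nonneg_nonneg mult_pos_pos of_nat_0_le_iff order_less_le_trans zero_le_numeral zero_less_numeral)
  then obtain A B where AB: "\<And>x. e k x \<le> A" "\<And>x. e (Suc k) x \<le> B" by metis
  have pos: "e j x > 0" for j x by (simp add: e_def)
  show ?thesis
  proof (rule bdd_lipschitz_deriv)
    show "\<bar>e k x\<bar> \<le> A" for x using AB(1)[of x] pos[of k x] by simp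
    show "(e k has_real_derivative (2 * cc + 2 * real k) * e k x - 2 * cc * e (Suc k) x) (at x)" for x
    proof -
      have s: "e (Suc k) x = exp (2 * x) * e k x" by (simp add: e_def algebra_simps flip: exp_add)
      show ?thesis unfolding s unfolding e_def[abs_def] by (auto intro!: derivative_eq_intros simp: algebra_simps)
    qed
    show "\<bar>(2 * cc + 2 * real k) * e k x - 2 * cc * e (Suc k) x\<bar> \<le> (2 * cc + 2 * real k) * A + 2 * cc * B" for x
    proof -
      have "(2 * cc + 2 * real k) * e k x \<le> (2 * cc + 2 * real k) * A" "2 * cc * e (Suc k) x \<le> 2 * cc * B"
        "(2 * cc + 2 * real k) * e k x \<ge> 0" "2 * cc * e (Suc k) x \<ge> 0"
        using AB pos[of k x] pos[of "Suc k" x] cc3 by (auto intro!: mult_left_mono mult_nonneg_nonneg)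
      then show ?thesis by linarith
    qed
  qed
qed

lemma bdd_lipschitz_sin_cos: "bdd_lipschitz (\<lambda>y::real. sin (2 * y))" "bdd_lipschitz (\<lambda>y::real. cos (2 * y))"
proof -
  show "bdd_lipschitz (\<lambda>y::real. sin (2 * y))"
    by (rule bdd_lipschitz_deriv[of _ 1 "\<lambda>y. 2 * cos (2 * y)" 2]) (auto intro!: derivative_eq_intros simp: abs_mult)
  show "bdd_lipschitz (\<lambda>y::real. cos (2 * y))"
    by (rule bdd_lipschitz_deriv[of _ 1 "\<lambda>y. - 2 * sin (2 * y)" 2]) (auto intro!: derivative_eq_intros simp: abs_mult)
qed

text \<open>The growth of exp (2x) is absorbed by the double exponential decay of w^2: the product
  is a difference of functions \<open>e k\<close>. Every remaining factor is a bounded Lipschitz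
  function of one coordinate, or the entry is linear.\<close>

lemma field_lipschitz: "\<exists>L. L-lipschitz_on UNIV field"
proof -
  have w0: "(w x)\<^sup>2 = e 0 x" for x by (simp add: w_sq e_def)
  have w1: "cc * (1 - exp (2 * x)) * (w x)\<^sup>2 = cc * (e 0 x - e 1 x)" for x
    by (simp add: w_sq e_def algebra_simps flip: exp_add)
  have d1: "dist (fst z) (fst z') \<le> dist z z'" for z z' :: "real \<times> real \<times> real \<times> real" by (rule dist_fst_le)
  have d2: "dist (fst (snd z)) (fst (snd z')) \<le> dist z z'" for z z' :: "real \<times> real \<times> real \<times> real"
    by (meson dist_fst_le dist_snd_le order_trans)
  have d3: "dist (fst (snd (snd z))) (fst (snd (snd z'))) \<le> dist z z'" for z z' :: "real \<times> real \<times> real \<times> real"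
    by (meson dist_fst_le dist_snd_le order_trans)
  have d4: "dist (snd (snd (snd z))) (snd (snd (snd z'))) \<le> dist z z'" for z z' :: "real \<times> real \<times> real \<times> real"
    by (meson dist_fst_le dist_snd_le order_trans)
  have "bdd_lipschitz (\<lambda>z::real \<times> real \<times> real \<times> real. cc * (e 0 (fst z) - e 1 (fst z)) * cos (2 * fst (snd z)) ^ (2 * m))"
    by (intro bdd_lipschitz_mult bdd_lipschitz_diff bdd_lipschitz_power bdd_lipschitz_const
        bdd_lipschitz_compose[OF bdd_lipschitz_e d1] bdd_lipschitz_compose[OF bdd_lipschitz_sin_cos(2) d2])
  then obtain A where A: "\<And>z z'::real \<times> real \<times> real \<times> real. dist (cc * (1 - exp (2 * fst z)) * (w (fst z))\<^sup>2 * cos (2 * fst (snd z)) ^ (2 * m))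
     (cc * (1 - exp (2 * fst z')) * (w (fst z'))\<^sup>2 * cos (2 * fst (snd z')) ^ (2 * m)) \<le> A * dist z z'"
    unfolding bdd_lipschitz_def w1 dist_real_def by blast
  have "bdd_lipschitz (\<lambda>z::real \<times> real \<times> real \<times> real. - (2 * real m) * sin (2 * fst (snd z)) * cos (2 * fst (snd z)) ^ (2 * m - 1) * e 0 (fst z))"
    by (intro bdd_lipschitz_mult bdd_lipschitz_diff bdd_lipschitz_power bdd_lipschitz_const
        bdd_lipschitz_compose[OF bdd_lipschitz_e d1] bdd_lipschitz_compose[OF bdd_lipschitz_sin_cos(2) d2]
        bdd_lipschitz_compose[OF bdd_lipschitz_sin_cos(1) d2])
  then obtain B where B: "\<And>z z'::real \<times> real \<times> real \<times> real. dist (- (2 * real m) * sin (2 * fst (snd z)) * cos (2 * fst (snd z)) ^ (2 * m - 1) * (w (fst z))\<^sup>2)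
     (- (2 * real m) * sin (2 * fst (snd z')) * cos (2 * fst (snd z')) ^ (2 * m - 1) * (w (fst z'))\<^sup>2) \<le> B * dist z z'"
    unfolding bdd_lipschitz_def w0 dist_real_def by blast
  have A0: "A \<ge> 0" using A[of 0 "(1, 0)"] zero_le_dist order_trans[OF zero_le_dist A[of 0 "(1, 0)"]] by (simp add: zero_le_mult_iff)
  have B0: "B \<ge> 0" using order_trans[OF zero_le_dist B[of 0 "(1, 0)"]] by (simp add: zero_le_mult_iff)
  have D: "dist (a, b, r, s) (a', b', r', s') \<le> dist a a' + dist b b' + dist r r' + dist s s'" for a b r s a' b' r' s' :: real
    unfolding dist_norm using norm_Pair_le[of "a - a'" "(b - b', r - r', s - s')"]
      norm_Pair_le[of "b - b'" "(r - r', s - s')"] norm_Pair_le[of "r - r'" "s - s'"] by simp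
  have "(2 + A + B)-lipschitz_on UNIV field"
  proof (rule lipschitz_onI)
    fix z z' :: "real \<times> real \<times> real \<times> real"
    show "dist (field z) (field z') \<le> (2 + A + B) * dist z z'"
      unfolding field_def Let_def
      using D A[of z z'] B[of z z'] d3[of z z'] d4[of z z']
      by (intro order_trans[OF D]) (simp add: distrib_right)
  qed (use A0 B0 in simp)
  then show ?thesis ..
qed

text \<open>The start is at (a, 0), orthogonal to the axis; the speed \<open>w a\<close> is the one
  that puts the orbit on the zero energy level.\<close>

definition sol :: "real \<Rightarrow> real \<Rightarrow> real \<times> real \<times> real \<times> real" where
  "sol a = (SOME u. u 0 = (a, 0, 0, w a) \<and> (\<forall>t. (u has_vector_derivative field (u t)) (at t)))"

lemma sol_0: "sol a 0 = (a, 0, 0, w a)" and sol_deriv: "(sol a has_vector_derivative field (sol a t)) (at t)"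
proof -
  obtain L where L: "L-lipschitz_on UNIV field" using field_lipschitz by blast
  obtain u where "u 0 = (a, 0, 0, w a) \<and> (\<forall>t. (u has_vector_derivative field (u t)) (at t))"
    using lipschitz_solution[OF L, of "(a, 0, 0, w a)"] by metis
  then have "sol a 0 = (a, 0, 0, w a) \<and> (\<forall>t. (sol a has_vector_derivative field (sol a t)) (at t))"
    unfolding sol_def
    by (rule someI[of "\<lambda>u. u 0 = (a, 0, 0, w a) \<and> (\<forall>t. (u has_vector_derivative field (u t)) (at t))"])
  then show "sol a 0 = (a, 0, 0, w a)" "(sol a has_vector_derivative field (sol a t)) (at t)" by auto
qed

lemma sol_unique:
  assumes "\<And>t. (u has_vector_derivative field (u t)) (at t)" "u s = sol a s"
  shows "u t = sol a t"
  using field_lipschitz lipschitz_solution_unique[OF _ assms(1) sol_deriv assms(2)] by blast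

definition X where "X a t = fst (sol a t)"
definition Y where "Y a t = fst (snd (sol a t))"
definition P where "P a t = fst (snd (snd (sol a t)))"
definition Q where "Q a t = snd (snd (snd (sol a t)))"
definition W where "W a t = w (X a t)"
definition C where "C a t = cos (2 * Y a t) ^ m"
definition J where "J a t = P a t / W a t"

lemma sol_eq: "sol a t = (X a t, Y a t, P a t, Q a t)"
  by (simp add: X_def Y_def P_def Q_def)

lemma init: "X a 0 = a" "Y a 0 = 0" "P a 0 = 0" "Q a 0 = w a" "J a 0 = 0" "C a 0 = 1" "W a 0 = w a"
  by (simp_all add: X_def Y_def P_def Q_def W_def C_def J_def sol_0)

lemma W_pos: "W a t > 0" by (simp add: W_def w_pos)

lemma W_le_1: "W a t \<le> 1" by (simp add: W_def w_le_1)

lemma X_deriv: "(X a has_real_derivative P a t) (at t)"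
  and Y_deriv: "(Y a has_real_derivative Q a t) (at t)"
  and P_deriv': "(P a has_real_derivative cc * (1 - exp (2 * X a t)) * (W a t)\<^sup>2 * cos (2 * Y a t) ^ (2 * m)) (at t)"
  and Q_deriv: "(Q a has_real_derivative - (2 * real m) * sin (2 * Y a t) * cos (2 * Y a t) ^ (2 * m - 1) * (W a t)\<^sup>2) (at t)"
proof -
  note 0 = sol_deriv[of a t]
  note 1 = bounded_linear.has_vector_derivative[OF bounded_linear_snd 0]
  note 2 = bounded_linear.has_vector_derivative[OF bounded_linear_snd 1]
  show "(X a has_real_derivative P a t) (at t)"
    using bounded_linear.has_vector_derivative[OF bounded_linear_fst 0]
    unfolding X_def[abs_def] P_def has_real_derivative_iff_has_vector_derivative by (simp add: field_def Let_def)
  show "(Y a has_real_derivative Q a t) (at t)"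
    using bounded_linear.has_vector_derivative[OF bounded_linear_fst 1]
    unfolding Y_def[abs_def] Q_def has_real_derivative_iff_has_vector_derivative by (simp add: field_def Let_def)
  show "(P a has_real_derivative cc * (1 - exp (2 * X a t)) * (W a t)\<^sup>2 * cos (2 * Y a t) ^ (2 * m)) (at t)"
    using bounded_linear.has_vector_derivative[OF bounded_linear_fst 2]
    unfolding P_def[abs_def] X_def Y_def W_def has_real_derivative_iff_has_vector_derivative by (simp add: field_def Let_def)
  show "(Q a has_real_derivative - (2 * real m) * sin (2 * Y a t) * cos (2 * Y a t) ^ (2 * m - 1) * (W a t)\<^sup>2) (at t)"
    using bounded_linear.has_vector_derivative[OF bounded_linear_snd 2]
    unfolding Q_def[abs_def] X_def Y_def W_def has_real_derivative_iff_has_vector_derivative by (simp add: field_def Let_def)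
qed

lemma P_deriv: "(P a has_real_derivative cc * (1 - exp (2 * X a t)) * (W a t)\<^sup>2 * (C a t)\<^sup>2) (at t)"
  using P_deriv'[of a t] by (simp add: C_def power_even_eq power2_eq_square[symmetric] mult.commute[of 2] power_mult)

lemma W_deriv: "(W a has_real_derivative cc * (1 - exp (2 * X a t)) * W a t * P a t) (at t)"
  unfolding W_def[abs_def] using DERIV_chain2[OF w_deriv X_deriv] by simp

lemma C_deriv: "(C a has_real_derivative - (2 * real m) * sin (2 * Y a t) * cos (2 * Y a t) ^ (m - 1) * Q a t) (at t)"
  unfolding C_def[abs_def] using Y_deriv[of a t] by (auto intro!: derivative_eq_intros)

lemma pow_split: "cos (2 * Y a t) ^ (2 * m - 1) = C a t * cos (2 * Y a t) ^ (m - 1)"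
proof -
  have "2 * m - 1 = m + (m - 1)" using m1 by simp
  then show ?thesis by (simp only: C_def power_add)
qed

lemma Q_deriv2: "(Q a has_real_derivative - (2 * real m) * sin (2 * Y a t) * (C a t * cos (2 * Y a t) ^ (m - 1)) * (W a t)\<^sup>2) (at t)"
  using Q_deriv[of a t] unfolding pow_split .

lemma energy: "(P a t)\<^sup>2 + (Q a t)\<^sup>2 = (W a t)\<^sup>2 * (C a t)\<^sup>2"
proof -
  define g where "g = (\<lambda>t. (P a t)\<^sup>2 + (Q a t)\<^sup>2 - (W a t)\<^sup>2 * (C a t)\<^sup>2)"
  have "(g has_real_derivative 0) (at t)" for t
    unfolding g_def
    by (rule DERIV_cong[OF DERIV_diff[OF DERIV_add[OF DERIV_power[OF P_deriv[of a t], of 2] DERIV_power[OF Q_deriv2[of a t], of 2]]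
      DERIV_mult[OF DERIV_power[OF W_deriv[of a t], of 2] DERIV_power[OF C_deriv[of a t], of 2]]]])
      (simp add: power2_eq_square algebra_simps)
  then have "g t = g 0" using DERIV_const_ratio_const2 by (metis DERIV_isconst_all)
  then show ?thesis by (simp add: g_def init)
qed

lemma cont: "isCont (X a) t" "isCont (Y a) t" "isCont (P a) t" "isCont (Q a) t" "isCont (C a) t" "isCont (W a) t"
  using X_deriv Y_deriv P_deriv Q_deriv C_deriv W_deriv DERIV_isCont by blast+

lemma cont_on: "continuous_on S (X a)" "continuous_on S (Y a)" "continuous_on S (P a)" "continuous_on S (Q a)"
  "continuous_on S (C a)" "continuous_on S (W a)"
  using cont by (auto intro: continuous_at_imp_continuous_on)

text \<open>On the lines Y = \<plusminus> \<pi>/4 the conformal factor vanishes, so zero energy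
  forces zero velocity and the point is a rest point. By uniqueness the orbit would be constant,
  against its nonzero initial velocity.\<close>

lemma Y_ne: "\<bar>Y a t\<bar> \<noteq> pi / 4"
proof
  assume "\<bar>Y a t\<bar> = pi / 4"
  then have "2 * \<bar>Y a t\<bar> = pi / 2" by simp
  then have "cos (2 * \<bar>Y a t\<bar>) = 0" using cos_pi_half by metis
  then have c0: "cos (2 * Y a t) = 0" by (simp add: abs_if split: if_splits)
  then have C0: "C a t = 0" using m1 by (simp add: C_def)
  have PQ: "P a t = 0" "Q a t = 0"
    using energy[of a t] C0 by (auto simp: sum_power2_eq_zero_iff)
  define u where "u = (\<lambda>s::real. (X a t, Y a t, 0::real, 0::real))"
  have f0: "field (u s) = 0" for s using c0 m1 by (auto simp: field_def u_def Let_def zero_prod_def)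
  have "u 0 = sol a 0"
  proof (rule sol_unique)
    show "u t = sol a t" by (simp add: u_def sol_eq PQ)
    show "(u has_vector_derivative field (u s)) (at s)" for s unfolding f0 by (simp add: u_def)
  qed
  then show False using w_pos[of a] by (simp add: u_def sol_0)
qed

lemma Y_bound: "\<bar>Y a t\<bar> < pi / 4"
proof (rule ccontr)
  assume "\<not> \<bar>Y a t\<bar> < pi / 4"
  moreover have "continuous_on S (\<lambda>t. \<bar>Y a t\<bar>)" for S by (intro continuous_intros cont_on)
  ultimately have "\<exists>s. \<bar>Y a s\<bar> = pi / 4"
    using IVT'[of "\<lambda>t. \<bar>Y a t\<bar>" 0 "pi/4" t] IVT2'[of "\<lambda>t. \<bar>Y a t\<bar>" 0 "pi/4" t] by (cases "t \<ge> 0") (auto simp: init)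
  then show False using Y_ne by blast
qed

lemma cos_pos: "cos (2 * Y a t) > 0"
  using Y_bound[of a t] by (intro cos_gt_zero_pi) auto

lemma C_pos: "C a t > 0" by (simp add: C_def cos_pos)

lemma C_le_1: "C a t \<le> 1" unfolding C_def using cos_pos[of a t] by (intro power_le_one) auto

lemma C_le_cos: "C a t \<le> cos (2 * Y a t)"
  unfolding C_def using cos_pos[of a t] m1 power_decreasing[of 1 m "cos (2 * Y a t)"] by simp

text \<open>The energy identity removes the term with \<open>P\<close>. What is left is a square
  times a factor whose sign is opposite to that of \<open>X\<close>, the source of the monotonicity
  of J.\<close>

lemma J_deriv: "(J a has_real_derivative cc * (1 - exp (2 * X a t)) * (Q a t)\<^sup>2 / W a t) (at t)"
proof -
  have Q2: "(Q a t)\<^sup>2 = (W a t)\<^sup>2 * (C a t)\<^sup>2 - (P a t)\<^sup>2" using energy[of a t] by simp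
  show ?thesis unfolding J_def[abs_def] Q2
    by (rule DERIV_cong[OF DERIV_divide[OF P_deriv W_deriv]])
      (use W_pos[of a t] in \<open>auto simp: field_simps power2_eq_square\<close>)
qed

lemma P_eq: "P a t = W a t * J a t" using W_pos[of a t] by (simp add: J_def)

lemma Q_over_W: "(Q a t / W a t)\<^sup>2 = (C a t)\<^sup>2 - (J a t)\<^sup>2"
  using energy[of a t] W_pos[of a t] by (simp add: J_def field_simps)

lemma Q_le: "\<bar>Q a t\<bar> \<le> W a t * C a t"
proof -
  have "(Q a t)\<^sup>2 \<le> (W a t * C a t)\<^sup>2"
    using energy[of a t] zero_le_power2[of "P a t"] unfolding power_mult_distrib by linarith
  moreover have "W a t * C a t \<ge> 0" using W_pos[of a t] C_pos[of a t] by simp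
  ultimately show ?thesis using power2_le_iff_abs_le by blast
qed

lemma P_le: "\<bar>P a t\<bar> \<le> W a t * C a t"
proof -
  have "(P a t)\<^sup>2 \<le> (W a t * C a t)\<^sup>2"
    using energy[of a t] zero_le_power2[of "Q a t"] unfolding power_mult_distrib by linarith
  moreover have "W a t * C a t \<ge> 0" using W_pos[of a t] C_pos[of a t] by simp
  ultimately show ?thesis using power2_le_iff_abs_le by blast
qed

end

section \<open>Shooting from the symmetry axis\<close>

lemma continuous_pos_lower_bound:
  fixes f :: "real \<Rightarrow> real"
  assumes "continuous_on {s..t} f" "\<And>x. s \<le> x \<Longrightarrow> x \<le> t \<Longrightarrow> f x > 0"
  obtains \<eta> where "\<eta> > 0" "\<And>x. s \<le> x \<Longrightarrow> x \<le> t \<Longrightarrow> f x \<ge> \<eta>"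
proof (cases "s \<le> t")
  case True
  then obtain x where "x \<in> {s..t}" "\<And>y. y \<in> {s..t} \<Longrightarrow> f x \<le> f y"
    using continuous_attains_inf[of "{s..t}" f] assms(1) by auto
  then show ?thesis using that[of "f x"] assms(2)[of x] by auto
qed (use that[of 1] in auto)

lemma isCont_nonpos_from_left:
  fixes f :: "real \<Rightarrow> real"
  assumes "isCont f t" "r < t" "\<And>s. r < s \<Longrightarrow> s < t \<Longrightarrow> f s \<le> 0"
  shows "f t \<le> 0"
proof (rule tendsto_upperbound)
  show "(f \<longlongrightarrow> f t) (at_left t)" using assms(1) by (simp add: isCont_def filterlim_at_split)
  show "\<forall>\<^sub>F x in at_left t. f x \<le> 0"
    using assms(2,3) by (auto simp: eventually_at_left[OF assms(2)])
qed simp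

context profile
begin

lemma near:
  assumes "eps > 0"
  obtains d where "d > 0" "\<And>b t. \<bar>b - a\<bar> < d \<Longrightarrow> 0 \<le> t \<Longrightarrow> t \<le> T \<Longrightarrow>
    \<bar>X b t - X a t\<bar> < eps \<and> \<bar>Y b t - Y a t\<bar> < eps \<and> \<bar>P b t - P a t\<bar> < eps \<and> \<bar>Q b t - Q a t\<bar> < eps"
proof -
  obtain L where L: "L-lipschitz_on UNIV field" using field_lipschitz by blast
  then have L0: "L \<ge> 0" by (simp add: lipschitz_on_def)
  have "isCont (\<lambda>b. (b, 0::real, 0::real, w b)) a"
    using DERIV_isCont[OF w_deriv] by (intro continuous_intros) auto
  then obtain d where d: "d > 0" "\<And>b. \<bar>b - a\<bar> < d \<Longrightarrow> dist (sol b 0) (sol a 0) < eps / exp (L * T)"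
    using assms unfolding continuous_at_eps_delta sol_0 dist_real_def
    by (metis divide_pos_pos exp_gt_zero)
  show ?thesis
  proof (rule that[OF d(1)])
    fix b t assume b: "\<bar>b - a\<bar> < d" and t: "0 \<le> t" "t \<le> T"
    have "dist (sol b t) (sol a t) \<le> exp (L * (t - 0)) * dist (sol b 0) (sol a 0)"
      by (rule lipschitz_solutions_dist_forward[OF L t(1) sol_deriv sol_deriv])
    also have "\<dots> \<le> exp (L * T) * dist (sol b 0) (sol a 0)"
      using t L0 by (intro mult_right_mono) (auto intro: mult_left_mono)
    also have "\<dots> < eps" using d(2)[OF b] by (simp add: field_simps)
    finally have D: "dist (sol b t) (sol a t) < eps" .
    have "dist (X b t) (X a t) \<le> dist (sol b t) (sol a t)" unfolding X_def by (rule dist_fst_le)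
    moreover have "dist (Y b t) (Y a t) \<le> dist (sol b t) (sol a t)" unfolding Y_def
      by (meson dist_fst_le dist_snd_le order_trans)
    moreover have "dist (P b t) (P a t) \<le> dist (sol b t) (sol a t)" unfolding P_def
      by (meson dist_fst_le dist_snd_le order_trans)
    moreover have "dist (Q b t) (Q a t) \<le> dist (sol b t) (sol a t)" unfolding Q_def
      by (meson dist_fst_le dist_snd_le order_trans)
    ultimately show "\<bar>X b t - X a t\<bar> < eps \<and> \<bar>Y b t - Y a t\<bar> < eps \<and> \<bar>P b t - P a t\<bar> < eps \<and> \<bar>Q b t - Q a t\<bar> < eps"
      using D unfolding dist_real_def by linarith
  qed
qed

lemma P_neg_while_X_pos:
  assumes "\<And>s. 0 \<le> s \<Longrightarrow> s \<le> t \<Longrightarrow> X a s > 0" "0 < s" "s \<le> t"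
  shows "P a s < 0"
proof -
  have "P a s < P a 0"
  proof (rule deriv_neg_less[OF assms(2) P_deriv])
    fix r assume "0 < r" "r < s"
    then have "X a r > 0" using assms by simp
    then show "cc * (1 - exp (2 * X a r)) * (W a r)\<^sup>2 * (C a r)\<^sup>2 < 0"
      using cc3 W_pos[of a r] C_pos[of a r] by (intro mult_neg_pos mult_pos_neg) auto
  qed
  then show ?thesis by (simp add: init)
qed

lemma Y_pos_while_Q_pos:
  assumes "\<And>s. 0 \<le> s \<Longrightarrow> s \<le> t \<Longrightarrow> Q a s > 0" "0 < s" "s \<le> t"
  shows "Y a s > 0"
proof -
  have "Y a 0 < Y a s"
    by (rule deriv_pos_less[OF assms(2) Y_deriv]) (use assms in auto)
  then show ?thesis by (simp add: init)
qed

text \<open>P and Y vanish at time 0, so closeness of solutions cannot fix their signs just after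
  it. Instead X and Q are kept positive for all nearby starting points, and these determine the
  signs of P' and Y'.\<close>

lemma early_near:
  assumes "a > 0"
  obtains t1 d where "t1 > 0" "d > 0" "\<And>b s. \<bar>b - a\<bar> < d \<Longrightarrow> 0 < s \<Longrightarrow> s \<le> t1 \<Longrightarrow> P b s < 0 \<and> Y b s > 0"
proof -
  have "\<forall>\<^sub>F t in at 0. X a t > a / 2 \<and> Q a t > w a / 2"
    using cont(1)[of 0 a] cont(4)[of 0 a] assms w_pos[of a] unfolding isCont_def
    by (intro eventually_conj order_tendstoD) (auto simp: init)
  then obtain t0 where t0: "t0 > 0" "\<And>t. t \<noteq> 0 \<Longrightarrow> \<bar>t\<bar> < t0 \<Longrightarrow> X a t > a / 2 \<and> Q a t > w a / 2"
    unfolding eventually_at by (auto simp: dist_real_def)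
  define t1 where "t1 = t0 / 2"
  have t1: "t1 > 0" "\<And>t. 0 \<le> t \<Longrightarrow> t \<le> t1 \<Longrightarrow> X a t > a / 2 \<and> Q a t > w a / 2"
    using t0 assms w_pos[of a] by (auto simp: t1_def init dest: order_le_imp_less_or_eq)
  obtain d where d: "d > 0" "\<And>b t. \<bar>b - a\<bar> < d \<Longrightarrow> 0 \<le> t \<Longrightarrow> t \<le> t1 \<Longrightarrow>
    \<bar>X b t - X a t\<bar> < min (a/2) (w a / 2) \<and> \<bar>Y b t - Y a t\<bar> < min (a/2) (w a / 2) \<and> \<bar>P b t - P a t\<bar> < min (a/2) (w a / 2) \<and> \<bar>Q b t - Q a t\<bar> < min (a/2) (w a / 2)"
    using near[of "min (a/2) (w a / 2)" a t1] assms w_pos[of a] by auto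
  show ?thesis
  proof (rule that[OF t1(1) d(1)])
    fix b s assume b: "\<bar>b - a\<bar> < d" and s: "0 < s" "s \<le> t1"
    have 1: "X b r > 0" "Q b r > 0" if "0 \<le> r" "r \<le> t1" for r
      using d(2)[OF b that] t1(2)[OF that] by (auto simp: abs_if split: if_splits)
    show "P b s < 0 \<and> Y b s > 0"
      using P_neg_while_X_pos[of t1 b s] Y_pos_while_Q_pos[of t1 b s] 1 s by auto
  qed
qed

lemma sin_pos: "Y a t > 0 \<Longrightarrow> sin (2 * Y a t) > 0"
  using Y_bound[of a t] by (intro sin_gt_zero) auto

lemma Q_deriv_neg:
  assumes "Y a t > 0"
  shows "- (2 * real m) * sin (2 * Y a t) * cos (2 * Y a t) ^ (2 * m - 1) * (W a t)\<^sup>2 < 0"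
proof -
  have "2 * real m * sin (2 * Y a t) * cos (2 * Y a t) ^ (2 * m - 1) * (W a t)\<^sup>2 > 0"
    using sin_pos[OF assms] cos_pos[of a t] W_pos[of a t] m1 by (intro mult_pos_pos) auto
  then show ?thesis by simp
qed

lemma Q_strict_decreasing:
  assumes "r < s" "\<And>u. r < u \<Longrightarrow> u < s \<Longrightarrow> Y a u > 0"
  shows "Q a s < Q a r"
  using deriv_neg_less[OF assms(1) Q_deriv] Q_deriv_neg assms(2) by blast

text \<open>The sphere X = 0 is itself a solution curve, and no other orbit is tangent to it: X^2 +
  P^2 bounds its own derivative up to a constant, hence vanishes identically if it vanishes once,
  while \<open>X a 0 = a\<close>.\<close>

lemma X_P_nonzero:
  assumes "a \<noteq> 0"
  shows "X a t \<noteq> 0 \<or> P a t \<noteq> 0"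
proof (rule ccontr)
  assume "\<not> ?thesis"
  then have z: "X a t = 0" "P a t = 0" by auto
  have w1: "cc * (1 - exp (2 * x)) * (w x)\<^sup>2 = cc * (e 0 x - e 1 x)" for x
    by (simp add: w_sq e_def algebra_simps flip: exp_add)
  have "bdd_lipschitz (\<lambda>x. cc * (e 0 x - e 1 x))"
    by (intro bdd_lipschitz_mult bdd_lipschitz_const bdd_lipschitz_diff bdd_lipschitz_e)
  then obtain B where "\<And>x y. \<bar>cc * (1 - exp (2 * x)) * (w x)\<^sup>2 - cc * (1 - exp (2 * y)) * (w y)\<^sup>2\<bar> \<le> B * dist x y"
    unfolding bdd_lipschitz_def w1 by blast
  from this[of _ 0] have B: "\<And>x. \<bar>cc * (1 - exp (2 * x)) * (w x)\<^sup>2\<bar> \<le> B * \<bar>x\<bar>" by (simp add: dist_real_def)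
  define h where "h = (\<lambda>t. (X a t)\<^sup>2 + (P a t)\<^sup>2)"
  let ?P' = "\<lambda>t. cc * (1 - exp (2 * X a t)) * (W a t)\<^sup>2 * (C a t)\<^sup>2"
  have d: "(h has_real_derivative 2 * P a t * (X a t + ?P' t)) (at t)" for t
    unfolding h_def
    by (rule DERIV_cong[OF DERIV_add[OF DERIV_power[OF X_deriv[of a t], of 2] DERIV_power[OF P_deriv[of a t], of 2]]])
      (simp add: algebra_simps)
  have B0: "B \<ge> 0" using order_trans[OF abs_ge_zero B[of 1]] by simp
  have b: "\<bar>2 * P a t * (X a t + ?P' t)\<bar> \<le> (1 + B) * h t" for t
  proof -
    have "\<bar>?P' t\<bar> = \<bar>cc * (1 - exp (2 * X a t)) * (w (X a t))\<^sup>2\<bar> * (C a t)\<^sup>2" by (simp add: abs_mult W_def)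
    also have "\<dots> \<le> (B * \<bar>X a t\<bar>) * 1"
      using B C_le_1[of a t] C_pos[of a t] B0 by (intro mult_mono) (auto simp: power_le_one)
    finally have q: "\<bar>?P' t\<bar> \<le> B * \<bar>X a t\<bar>" by simp
    have "\<bar>2 * P a t * (X a t + ?P' t)\<bar> \<le> 2 * \<bar>P a t\<bar> * (\<bar>X a t\<bar> + B * \<bar>X a t\<bar>)"
      using q unfolding abs_mult[of "2 * P a t"] abs_mult[of 2] by (intro mult_mono order_trans[OF abs_triangle_ineq]) auto
    also have "\<dots> = (1 + B) * (2 * \<bar>X a t\<bar> * \<bar>P a t\<bar>)" by (simp add: algebra_simps)
    also have "\<dots> \<le> (1 + B) * h t"
      using sum_squares_bound[of "\<bar>X a t\<bar>" "\<bar>P a t\<bar>"] B0 by (intro mult_left_mono) (auto simp: h_def)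
    finally show ?thesis .
  qed
  have "h 0 = 0" by (rule deriv_le_self_zero[OF d b, of t]) (auto simp: h_def z)
  then show False using assms by (simp add: h_def init)
qed

section \<open>First exit from the region P < 0, Y > 0\<close>

definition ascending :: "real \<Rightarrow> real \<Rightarrow> bool" where
  "ascending a t \<longleftrightarrow> (\<forall>s. 0 < s \<and> s < t \<longrightarrow> P a s < 0 \<and> Y a s > 0)"

text \<open>Transversal crossings (P < 0) and orthogonal returns (P = 0) are both included; only the
  latter close up under reflection.\<close>

definition returns :: "real \<Rightarrow> real \<Rightarrow> bool" where
  "returns a t \<longleftrightarrow> 0 < t \<and> Y a t = 0 \<and> P a t \<le> 0 \<and> ascending a t"

lemma first_exit:
  assumes "a > 0"
  obtains (returns) t where "returns a t"
    | (turns) t where "0 < t" "P a t = 0" "Y a t > 0" "ascending a t"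
    | (forever) "\<And>t. t > 0 \<Longrightarrow> P a t < 0 \<and> Y a t > 0"
proof (cases "\<exists>t>0. P a t \<ge> 0 \<or> Y a t \<le> 0")
  case False
  then show ?thesis using forever by (meson not_le)
next
  case True
  obtain t1 d where t1: "t1 > 0" "d > 0" "\<And>b s. \<bar>b - a\<bar> < d \<Longrightarrow> 0 < s \<Longrightarrow> s \<le> t1 \<Longrightarrow> P b s < 0 \<and> Y b s > 0"
    using early_near[OF assms] by blast
  from t1(3)[of a] t1(2) have early: "\<And>s. 0 < s \<Longrightarrow> s \<le> t1 \<Longrightarrow> P a s < 0 \<and> Y a s > 0" by simp
  \<comment> \<open>Both P and Y vanish at time 0, so exit times are collected only from
    \<open>t1\<close> on. The set is then closed, and its infimum is the first exit after time
    0.\<close>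
  define S where "S = {t. t1 \<le> t \<and> (P a t \<ge> 0 \<or> Y a t \<le> 0)}"
  have "closed S" unfolding S_def
    by (intro closed_Collect_conj closed_Collect_disj closed_Collect_le continuous_intros cont_on)
  moreover have "S \<noteq> {}" using True early unfolding S_def by force
  moreover have bb: "bdd_below S" by (rule bdd_belowI[of _ t1]) (auto simp: S_def)
  ultimately have i: "Inf S \<in> S" by (intro closed_contains_Inf)
  define t where "t = Inf S"
  have t: "t1 \<le> t" "P a t \<ge> 0 \<or> Y a t \<le> 0" using i by (auto simp: t_def S_def)
  have asc: "ascending a t" unfolding ascending_def
  proof (intro allI impI)
    fix s assume s: "0 < s \<and> s < t"
    then have "s \<notin> S" using cInf_lower[OF _ bb, of s] by (auto simp: t_def)
    then show "P a s < 0 \<and> Y a s > 0" using early[of s] s by (cases "s \<le> t1") (auto simp: S_def)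
  qed
  have "P a t \<le> 0"
    by (rule isCont_nonpos_from_left[OF cont(3), of 0]) (use asc t t1 in \<open>auto simp: ascending_def less_imp_le\<close>)
  moreover have "- Y a t \<le> 0"
    by (rule isCont_nonpos_from_left[where f = "\<lambda>t. - Y a t" and r = 0])
      (use asc t t1 cont(2) in \<open>auto simp: ascending_def less_imp_le intro!: continuous_intros\<close>)
  ultimately show ?thesis
    using returns[of t] turns[of t] t asc t1(1) by (cases "Y a t = 0") (auto simp: returns_def)
qed

text \<open>While Y > 0 the component Q decreases strictly, and Y vanishes at both ends. So Q has
  exactly one zero \<open>s\<close>, the point where Y is largest.\<close>

lemma neck:
  assumes "returns a t"
  obtains s where "0 < s" "s < t" "Q a s = 0" "\<And>r. 0 \<le> r \<Longrightarrow> r < s \<Longrightarrow> Q a r > 0" "\<And>r. s < r \<Longrightarrow> r \<le> t \<Longrightarrow> Q a r < 0"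
proof -
  have t: "0 < t" "Y a t = 0" and asc: "ascending a t" using assms by (auto simp: returns_def)
  obtain s where s: "0 < s" "s < t" "Y a t - Y a 0 = (t - 0) * Q a s"
    using MVT2[OF t(1), of "Y a" "Q a"] Y_deriv by blast
  then have s0: "Q a s = 0" using t by (simp add: init)
  have dec: "Q a r' < Q a r" if "0 \<le> r" "r < r'" "r' \<le> t" for r r'
    by (rule Q_strict_decreasing) (use that asc in \<open>auto simp: ascending_def\<close>)
  show ?thesis
    by (rule that[OF s(1,2) s0]) (use dec[of _ s] dec[of s] s s0 in auto)
qed

lemma Y_antimono:
  assumes "\<And>r. s < r \<Longrightarrow> r \<le> t \<Longrightarrow> Q a r < 0" "s \<le> u" "u \<le> v" "v \<le> t" "Q a s \<le> 0"
  shows "Y a v \<le> Y a u"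
proof (rule deriv_nonpos_le[OF assms(3) Y_deriv])
  fix x assume "u \<le> x" "x \<le> v"
  then show "Q a x \<le> 0" using assms(1)[of x] assms(2,4,5) by (cases "x = s") auto
qed

section \<open>The highest point of a returning orbit\<close>

text \<open>The value of C at Y = \<pi>/8, halfway to the boundary, used as lower bound for C on the
  lower half of the strip.\<close>

definition kap :: real where "kap = cos (pi / 4) ^ m"

lemma kap_pos: "kap > 0" by (simp add: kap_def cos_45)

lemma C_ge_kap:
  assumes "\<bar>Y a t\<bar> \<le> pi / 8"
  shows "C a t \<ge> kap"
proof -
  have "cos (pi / 4) \<le> cos \<bar>2 * Y a t\<bar>" using assms by (intro cos_monotone_0_pi_le) auto
  then have "cos (pi / 4) \<le> cos (2 * Y a t)" by (simp only: cos_abs_real)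
  then show ?thesis unfolding kap_def C_def by (intro power_mono) (auto simp: cos_45)
qed

lemma C_antimono:
  assumes "0 \<le> Y a t" "Y a t \<le> Y b s"
  shows "C b s \<le> C a t"
  unfolding C_def
  using Y_bound[of b s] cos_pos[of b s] assms by (intro power_mono cos_monotone_0_pi_le) auto

text \<open>From the turning point \<open>s\<close> of \<open>Y\<close> on, \<open>J\<close> increases from \<open>- C a s\<close> at a rate bounded below in terms of
  \<open>X a s\<close>. An orbit that returns with \<open>J \<le> 0\<close> thus cannot turn too close to the boundary.\<close>

lemma neck_constraint:
  assumes ret: "returns a t" and s: "0 < s" "s < t" "Q a s = 0" "\<And>r. s < r \<Longrightarrow> r \<le> t \<Longrightarrow> Q a r < 0"
    and Xs: "X a s < 0" and Ys: "Y a s \<ge> pi / 8" and Cs: "C a s \<le> kap / 2"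
  shows "C a s \<ge> cc * kap * pi / 16 * (1 - exp (2 * X a s))"
proof -
  have t: "0 < t" "Y a t = 0" "P a t \<le> 0" and asc: "ascending a t" using ret by (auto simp: returns_def)
  have Pn: "P a r \<le> 0" if "s \<le> r" "r \<le> t" for r
    using asc t s that unfolding ascending_def by (cases "r = t") (auto simp: less_imp_le)
  have Jn: "J a r \<le> 0" if "s \<le> r" "r \<le> t" for r
    using Pn[OF that] W_pos[of a r] by (simp add: J_def divide_le_0_iff)
  have Xr: "X a r \<le> X a s" if "s \<le> r" "r \<le> t" for r
    by (rule deriv_nonpos_le[OF that(1) X_deriv]) (use Pn that in auto)
  have E: "1 - exp (2 * X a r) \<ge> 1 - exp (2 * X a s)" if "s \<le> r" "r \<le> t" for r
    using Xr[OF that] by simp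
  have Jmono: "J a s \<le> J a r" if "s \<le> r" "r \<le> t" for r
  proof (rule deriv_nonneg_le[OF that(1) J_deriv])
    fix x assume "s \<le> x" "x \<le> r"
    then have "X a x \<le> 0" using Xr[of x] Xs that by auto
    then show "0 \<le> cc * (1 - exp (2 * X a x)) * (Q a x)\<^sup>2 / W a x"
      using cc3 W_pos[of a x] by (intro divide_nonneg_pos mult_nonneg_nonneg) auto
  qed
  \<comment> \<open>At the turning point Q = 0, so the zero energy level leaves J = \<plusminus> C,
    and J \<le> 0 fixes the sign.\<close>
  have Js: "J a s = - C a s"
  proof -
    have "(J a s)\<^sup>2 = (C a s)\<^sup>2" using Q_over_W[of a s] s by simp
    then show ?thesis using Jn[of s] s C_pos[of a s] by (auto simp: power2_eq_iff)
  qed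
  have "\<exists>r\<ge>s. r \<le> t \<and> Y a r = pi / 8"
    by (rule IVT2) (use Ys t s cont in auto)
  then obtain r where r: "s \<le> r" "r \<le> t" "Y a r = pi / 8" by blast
  \<comment> \<open>Below Y = \<pi>/8 the bounds C \<ge> \<open>kap\<close> and |J| \<le>
    \<open>kap\<close> / 2 give - Q / W \<ge> \<open>kap\<close> / 2. Thus J gains at least
    \<open>k\<close> per unit of descent in Y; over the height \<pi>/8 this is the constant of the
    claim, and J must not become positive.\<close>
  define k where "k = cc * (1 - exp (2 * X a s)) * (kap / 2)"
  have "J a r + k * Y a r \<le> J a t + k * Y a t"
  proof (rule deriv_nonneg_le[OF r(2)])
    show "((\<lambda>x. J a x + k * Y a x) has_real_derivative cc * (1 - exp (2 * X a x)) * (Q a x)\<^sup>2 / W a x + k * Q a x) (at x)" for x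
      by (intro DERIV_add J_deriv DERIV_cmult Y_deriv)
    fix x assume x: "r \<le> x" "x \<le> t"
    have Qx: "Q a x \<le> 0" using s(3) s(4)[of x] x r by (cases "x = s") auto
    have "Y a x \<le> pi / 8" using Y_antimono[OF s(4), where u = r and v = x] r x s(3) by auto
    moreover have "Y a x \<ge> 0" using Y_antimono[OF s(4), where u = x and v = t] r x s(3) t by auto
    ultimately have Cx: "C a x \<ge> kap" by (intro C_ge_kap) auto
    have "(J a x)\<^sup>2 \<le> (kap / 2)\<^sup>2"
    proof -
      have "\<bar>J a x\<bar> \<le> kap / 2" using Jn[of x] Jmono[of x] Js Cs x r by auto
      then show ?thesis by (metis abs_ge_zero power2_abs power_mono)
    qed
    moreover have "(C a x)\<^sup>2 \<ge> kap\<^sup>2" using Cx kap_pos by (intro power_mono) auto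
    ultimately have "(kap / 2)\<^sup>2 \<le> (- Q a x / W a x)\<^sup>2"
    proof -
      have "(- Q a x / W a x)\<^sup>2 = (C a x)\<^sup>2 - (J a x)\<^sup>2" using Q_over_W[of a x] by (simp add: power_divide)
      moreover have "(kap / 2)\<^sup>2 = kap\<^sup>2 / 4" by (simp add: power_divide)
      ultimately show ?thesis
        using \<open>(J a x)\<^sup>2 \<le> (kap / 2)\<^sup>2\<close> \<open>(C a x)\<^sup>2 \<ge> kap\<^sup>2\<close> zero_le_power2[of kap] by linarith
    qed
    moreover have qw: "0 \<le> - Q a x / W a x" using Qx W_pos[of a x] by (intro divide_nonneg_pos) auto
    ultimately have ge: "kap / 2 \<le> - Q a x / W a x" by (rule power2_le_imp_le)
    have "k * (- Q a x) \<le> cc * (1 - exp (2 * X a x)) * (- Q a x / W a x) * (- Q a x)"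
      unfolding k_def using ge E[of x] x r cc3 kap_pos Qx Xs by (intro mult_mono mult_nonneg_nonneg) auto
    then show "0 \<le> cc * (1 - exp (2 * X a x)) * (Q a x)\<^sup>2 / W a x + k * Q a x"
      by (simp add: power2_eq_square)
  qed
  then have "k * (pi / 8) \<le> C a s"
    using Jn[of t] Jmono[OF r(1,2)] Js r t s by auto
  then show ?thesis by (simp add: k_def mult_ac)
qed

section \<open>Openness of the two kinds of starting points\<close>

definition crosses :: "real \<Rightarrow> bool" where
  "crosses a \<longleftrightarrow> (\<exists>t. returns a t \<and> P a t < 0)"

lemma returns_Q_neg: "returns a t \<Longrightarrow> Q a t < 0"
  using neck by (metis order_refl)

text \<open>The crossing is transversal, so the orbit can be followed to a time \<open>t2\<close>
  with Y < 0 while P stays negative. Nearby orbits also have P < 0 up to \<open>t2\<close> and Y < 0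
  there, which leaves crossing as their only possible first exit.\<close>

lemma crosses_near:
  assumes "a > 0" "crosses a"
  shows "\<exists>d>0. \<forall>b. \<bar>b - a\<bar> < d \<longrightarrow> crosses b"
proof -
  obtain t where t: "returns a t" "P a t < 0" using assms(2) by (auto simp: crosses_def)
  then have t0: "0 < t" "Y a t = 0" and asc: "ascending a t" by (auto simp: returns_def)
  obtain t1 d1 where t1: "t1 > 0" "d1 > 0" and early: "\<And>b s. \<bar>b - a\<bar> < d1 \<Longrightarrow> 0 < s \<Longrightarrow> s \<le> t1 \<Longrightarrow> P b s < 0 \<and> Y b s > 0"
    using early_near[OF assms(1)] by blast
  obtain h1 where h1: "h1 > 0" "\<And>h. 0 < h \<Longrightarrow> h < h1 \<Longrightarrow> Y a (t + h) < Y a t"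
    using DERIV_neg_dec_right[OF Y_deriv returns_Q_neg[OF t(1)]] by auto
  have "\<forall>\<^sub>F r in at t. P a r < 0"
    using order_tendstoD(2)[of "P a" "P a t" "at t" 0] cont(3)[of t a] t(2) by (simp add: isCont_def)
  then obtain h2 where h2: "h2 > 0" "\<And>r. r \<noteq> t \<Longrightarrow> \<bar>r - t\<bar> < h2 \<Longrightarrow> P a r < 0"
    unfolding eventually_at by (auto simp: dist_real_def)
  define t2 where "t2 = t + min h1 h2 / 2"
  have t2: "t < t2" "Y a t2 < 0" using h1 h2 t0 h1(2)[of "min h1 h2 / 2"] by (auto simp: t2_def)
  have Pneg: "P a r < 0" if "0 < r" "r \<le> t2" for r
  proof -
    consider "r < t" | "r = t" | "r > t" by linarith
    then show ?thesis
    proof cases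
      case 3
      then show ?thesis using h2(2)[of r] that h1(1) h2(1) by (auto simp: t2_def min_def split: if_splits)
    qed (use asc t that in \<open>auto simp: ascending_def\<close>)
  qed
  have t12: "t1 < t" using early[of a t] t1(2) t0 by (cases "t1 < t") auto
  obtain \<eta> where \<eta>: "\<eta> > 0" "\<And>x. t1 \<le> x \<Longrightarrow> x \<le> t2 \<Longrightarrow> - P a x \<ge> \<eta>"
    by (rule continuous_pos_lower_bound[of t1 t2 "\<lambda>x. - P a x"]) (use Pneg t1 in \<open>auto intro!: continuous_intros cont_on\<close>)
  obtain d2 where d2: "d2 > 0" "\<And>b t. \<bar>b - a\<bar> < d2 \<Longrightarrow> 0 \<le> t \<Longrightarrow> t \<le> t2 \<Longrightarrow>
    \<bar>X b t - X a t\<bar> < min \<eta> (- Y a t2) \<and> \<bar>Y b t - Y a t\<bar> < min \<eta> (- Y a t2) \<and> \<bar>P b t - P a t\<bar> < min \<eta> (- Y a t2) \<and> \<bar>Q b t - Q a t\<bar> < min \<eta> (- Y a t2)"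
    using near[of "min \<eta> (- Y a t2)" a t2] \<eta>(1) t2 by auto
  show ?thesis
  proof (intro exI[of _ "min (min d1 d2) a"] conjI allI impI)
    show "min (min d1 d2) a > 0" using t1 d2 assms by auto
    fix b assume b: "\<bar>b - a\<bar> < min (min d1 d2) a"
    then have b0: "b > 0" by auto
    have Pb: "P b r < 0" if "0 < r" "r \<le> t2" for r
    proof (cases "r \<le> t1")
      case False
      then have "\<bar>P b r - P a r\<bar> < \<eta>" using d2(2)[of b r] that b by auto
      then show ?thesis using \<eta>(2)[of r] False that by linarith
    qed (use early[of b r] that b in auto)
    have "\<bar>Y b t2 - Y a t2\<bar> < - Y a t2" using d2(2)[of b t2] t2 t0 b by auto
    then have Yb2: "Y b t2 < 0" by linarith
    show "crosses b"
    proof (rule first_exit[OF b0])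
      fix s assume s: "returns b s"
      have "s \<le> t2"
      proof (rule ccontr)
        assume "\<not> s \<le> t2"
        then have "Y b t2 > 0" using s t2 t0 unfolding returns_def ascending_def by auto
        then show False using Yb2 by simp
      qed
      then show "crosses b" using s Pb[of s] by (auto simp: crosses_def returns_def)
    next
      fix s assume s: "0 < s" "P b s = 0" "Y b s > 0" "ascending b s"
      then have "t2 < s" using Pb[of s] by (cases "t2 < s") auto
      then show "crosses b" using s(4)[unfolded ascending_def, rule_format, of t2] Yb2 t2 t0 by auto
    next
      assume "\<And>t. 0 < t \<Longrightarrow> P b t < 0 \<and> 0 < Y b t"
      from this[of t2] show "crosses b" using Yb2 t2 t0 by auto
    qed
  qed
qed

text \<open>X can stop decreasing only where X < 0: for X > 0 the derivative of P has the wrong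
  sign, and tangency to X = 0 is excluded. There P' > 0, so P becomes positive while Y > 0, and
  nearby orbits do the same before they could reach the axis.\<close>

lemma turning_not_crosses_near:
  assumes "a > 0" "0 < t" "P a t = 0" "Y a t > 0" "ascending a t"
  shows "\<exists>d>0. \<forall>b. \<bar>b - a\<bar> < d \<longrightarrow> \<not> crosses b"
proof -
  let ?P' = "cc * (1 - exp (2 * X a t)) * (W a t)\<^sup>2 * (C a t)\<^sup>2"
  have "\<not> X a t > 0"
  proof
    assume "X a t > 0"
    then have "?P' < 0" using cc3 W_pos[of a t] C_pos[of a t] by (intro mult_neg_pos mult_pos_neg) auto
    then obtain d where d: "d > 0" "\<And>h. 0 < h \<Longrightarrow> h < d \<Longrightarrow> P a t < P a (t - h)"
      using DERIV_neg_dec_left[OF P_deriv] by blast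
    define h where "h = min d t / 2"
    have "P a (t - h) < 0" using assms d(1) by (auto simp: h_def ascending_def)
    then show False using d(2)[of h] d(1) assms by (auto simp: h_def min_def split: if_splits)
  qed
  moreover have "X a t \<noteq> 0" using X_P_nonzero[of a t] assms by auto
  ultimately have "X a t < 0" by simp
  then have "?P' > 0" using cc3 W_pos[of a t] C_pos[of a t] by (intro mult_pos_pos) auto
  then obtain h1 where h1: "h1 > 0" "\<And>h. 0 < h \<Longrightarrow> h < h1 \<Longrightarrow> P a t < P a (t + h)"
    using DERIV_pos_inc_right[OF P_deriv] by blast
  obtain t1 d1 where t1: "t1 > 0" "d1 > 0" and early: "\<And>b s. \<bar>b - a\<bar> < d1 \<Longrightarrow> 0 < s \<Longrightarrow> s \<le> t1 \<Longrightarrow> P b s < 0 \<and> Y b s > 0"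
    using early_near[OF assms(1)] by blast
  have "\<forall>\<^sub>F r in at t. Y a r > 0"
    using order_tendstoD(1)[of "Y a" "Y a t" "at t" 0] cont(2)[of t a] assms(4) by (simp add: isCont_def)
  then obtain h2 where h2: "h2 > 0" "\<And>r. r \<noteq> t \<Longrightarrow> \<bar>r - t\<bar> < h2 \<Longrightarrow> Y a r > 0"
    unfolding eventually_at by (auto simp: dist_real_def)
  define t2 where "t2 = t + min h1 h2 / 2"
  have t2: "t < t2" "P a t2 > 0" using h1 h2 assms h1(2)[of "min h1 h2 / 2"] by (auto simp: t2_def)
  have Ypos: "Y a r > 0" if "0 < r" "r \<le> t2" for r
  proof -
    consider "r < t" | "r = t" | "r > t" by linarith
    then show ?thesis
    proof cases
      case 3
      then show ?thesis using h2(2)[of r] that h1(1) h2(1) by (auto simp: t2_def min_def split: if_splits)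
    qed (use assms that in \<open>auto simp: ascending_def\<close>)
  qed
  obtain \<eta> where \<eta>: "\<eta> > 0" "\<And>x. t1 \<le> x \<Longrightarrow> x \<le> t2 \<Longrightarrow> Y a x \<ge> \<eta>"
    by (rule continuous_pos_lower_bound[of t1 t2 "Y a"]) (use Ypos t1 in \<open>auto intro!: cont_on\<close>)
  obtain d2 where d2: "d2 > 0" "\<And>b t. \<bar>b - a\<bar> < d2 \<Longrightarrow> 0 \<le> t \<Longrightarrow> t \<le> t2 \<Longrightarrow>
    \<bar>X b t - X a t\<bar> < min \<eta> (P a t2) \<and> \<bar>Y b t - Y a t\<bar> < min \<eta> (P a t2) \<and> \<bar>P b t - P a t\<bar> < min \<eta> (P a t2) \<and> \<bar>Q b t - Q a t\<bar> < min \<eta> (P a t2)"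
    using near[of "min \<eta> (P a t2)" a t2] \<eta>(1) t2 by auto
  show ?thesis
  proof (intro exI[of _ "min d1 d2"] conjI allI impI notI)
    show "min d1 d2 > 0" using t1 d2 by auto
    fix b assume b: "\<bar>b - a\<bar> < min d1 d2" and "crosses b"
    then obtain s where s: "returns b s" "P b s < 0" by (auto simp: crosses_def)
    have Yb: "Y b r > 0" if "0 < r" "r \<le> t2" for r
    proof (cases "r \<le> t1")
      case False
      then have "\<bar>Y b r - Y a r\<bar> < \<eta>" using d2(2)[of b r] that b by auto
      then show ?thesis using \<eta>(2)[of r] False that by linarith
    qed (use early[of b r] that b in auto)
    have "s > t2" using Yb[of s] s by (cases "s > t2") (auto simp: returns_def)
    then have "P b t2 < 0" using s t2 assms(2) by (auto simp: returns_def ascending_def)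
    moreover have "\<bar>P b t2 - P a t2\<bar> < P a t2" using d2(2)[of b t2] t2 assms(2) b by auto
    ultimately show False by linarith
  qed
qed

text \<open>Such an orbit converges to a rest point on \<open>Y = \<pi>/4\<close>; this corresponds to a profile that closes up
  smoothly at the boundary of the strip.\<close>

lemma forever_limit:
  assumes a: "a > 0" and fe: "\<And>t. t > 0 \<Longrightarrow> P a t < 0 \<and> Y a t > 0"
  shows "\<And>t. t \<ge> 0 \<Longrightarrow> Q a t > 0"
    and "\<exists>t0>0. X a t0 < 0 \<and> (\<forall>\<epsilon>>0. \<exists>t\<ge>t0. C a t < \<epsilon>)"
proof -
  have Qdec: "Q a s < Q a r" if "0 \<le> r" "r < s" for r s
    by (rule Q_strict_decreasing) (use that fe in auto)
  \<comment> \<open>Once Q is nonpositive it soon becomes negative and keeps decreasing, so Y would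
    fall at a definite rate and reach the axis.\<close>
  show Qpos: "Q a t > 0" if "t \<ge> 0" for t
  proof (rule ccontr)
    assume "\<not> Q a t > 0"
    then have neg: "Q a (t + 1) < 0" using Qdec[of t "t + 1"] that by simp
    define k where "k = - Q a (t + 1)"
    define s where "s = t + 1 + 1 / k"
    have k: "k > 0" using neg by (simp add: k_def)
    have "Y a s + k * s \<le> Y a (t + 1) + k * (t + 1)"
    proof (rule deriv_nonpos_le[of _ _ "\<lambda>s. Y a s + k * s" "\<lambda>s. Q a s + k"])
      fix x assume "t + 1 \<le> x"
      then show "Q a x + k \<le> 0" using Qdec[of "t + 1" x] that unfolding k_def by (cases "x = t + 1") auto
    qed (use k in \<open>auto simp: s_def intro!: derivative_eq_intros Y_deriv\<close>)
    then have "Y a s \<le> Y a (t + 1) - 1" using k by (simp add: s_def algebra_simps)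
    also have "\<dots> < 0" using Y_bound[of a "t + 1"] pi_less_4 by auto
    finally show False using fe[of s] k that by (simp add: s_def add_nonneg_pos)
  qed
  have Qsmall: "\<exists>t>s. Q a t < \<epsilon>" if "\<epsilon> > 0" "s \<ge> 0" for \<epsilon> s
  proof (rule ccontr)
    assume "\<not> ?thesis"
    then have ge: "Q a t \<ge> \<epsilon>" if "t > s" for t using that by force
    define t where "t = s + 1 + 1 / \<epsilon>"
    have "Y a (s + 1) - \<epsilon> * (s + 1) \<le> Y a t - \<epsilon> * t"
      by (rule deriv_nonneg_le[of _ _ "\<lambda>s. Y a s - \<epsilon> * s" "\<lambda>s. Q a s - \<epsilon>"])
        (use ge \<open>\<epsilon> > 0\<close> in \<open>auto simp: t_def intro!: derivative_eq_intros Y_deriv\<close>)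
    then have "Y a t \<ge> Y a (s + 1) + 1" using \<open>\<epsilon> > 0\<close> by (simp add: t_def algebra_simps)
    then show False using fe[of "s + 1"] Y_bound[of a t] pi_less_4 \<open>s \<ge> 0\<close> by auto
  qed
  have Xlin: "X a t \<le> X a s - k * (t - s)" if "s \<le> t" "\<And>x. s \<le> x \<Longrightarrow> P a x \<le> - k" for s t k
  proof -
    have "X a t + k * t \<le> X a s + k * s"
      by (rule deriv_nonpos_le[of _ _ "\<lambda>s. X a s + k * s" "\<lambda>s. P a s + k"])
        (use that(2) in \<open>force simp: intro!: that(1) derivative_eq_intros X_deriv\<close>)+
    then show ?thesis by (simp add: algebra_simps)
  qed
  have unb: "\<exists>t\<ge>s. X a t < M" if "k > 0" "\<And>x. s \<le> x \<Longrightarrow> P a x \<le> - k" for s k M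
  proof -
    define t where "t = s + max 0 ((X a s - M + 1) / k)"
    have "X a t \<le> X a s - k * (t - s)" by (rule Xlin) (use that in \<open>auto simp: t_def\<close>)
    moreover have "k * (t - s) \<ge> X a s - M + 1"
      using that(1) by (simp add: t_def max_def field_simps)
    ultimately show ?thesis by (intro exI[of _ t]) (auto simp: t_def)
  qed
  have "\<exists>t0>0. X a t0 < 0"
  proof (rule ccontr)
    assume "\<not> ?thesis"
    then have nn: "X a t \<ge> 0" if "t > 0" for t using that by force
    have Pdec: "P a x \<le> - (- P a 1)" if "1 \<le> x" for x
      using deriv_nonpos_le[OF that P_deriv] nn cc3 W_pos C_pos
      by (simp add: mult_nonneg_nonpos mult_nonpos_nonneg)
    obtain t where "t \<ge> 1" "X a t < 0" using unb[of "- P a 1" 1 0] Pdec fe[of 1] by auto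
    then show False using nn[of t] by simp
  qed
  then obtain t0 where t0: "t0 > 0" "X a t0 < 0" by blast
  have Xdec: "X a t \<le> X a s" if "t0 \<le> s" "s \<le> t" for s t
    by (rule deriv_nonpos_le[OF that(2) X_deriv]) (use fe t0 that in \<open>auto simp: less_imp_le\<close>)
  have Xneg: "X a t < 0" if "t0 \<le> t" for t using Xdec[of t0 t] that t0 by auto
  have Pinc: "P a s \<le> P a t" if "t0 \<le> s" "s \<le> t" for s t
  proof (rule deriv_nonneg_le[OF that(2) P_deriv])
    fix x assume "s \<le> x"
    then have "X a x \<le> 0" using Xneg[of x] that by auto
    then show "0 \<le> cc * (1 - exp (2 * X a x)) * (W a x)\<^sup>2 * (C a x)\<^sup>2" using cc3 by (intro mult_nonneg_nonneg) auto
  qed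
  define \<delta> where "\<delta> = sin (2 * Y a t0)"
  have \<delta>: "\<delta> > 0" unfolding \<delta>_def using sin_pos fe t0 by auto
  \<comment> \<open>Since Y increases, sin (2Y) \<ge> \<delta> after \<open>t0\<close>, and Q' \<le>
    - 2 m \<delta> W^2 C^2. On the other side P' \<le> cc W^2 C^2. This \<kappa> balances the two
    rates, so that Q + \<kappa> P is nonincreasing.\<close>
  define \<kappa> where "\<kappa> = 2 * real m * \<delta> / cc"
  have \<kappa>: "\<kappa> > 0" using \<delta> cc3 m1 by (simp add: \<kappa>_def)
  have Yinc: "Y a s \<le> Y a t" if "0 \<le> s" "s \<le> t" for s t
    by (rule deriv_nonneg_le[OF that(2) Y_deriv]) (use Qpos that in \<open>auto simp: less_imp_le\<close>)
  have comb: "Q a t + \<kappa> * P a t \<le> Q a s + \<kappa> * P a s" if "t0 \<le> s" "s \<le> t" for s t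
  proof (rule deriv_nonpos_le[OF that(2), of "\<lambda>t. Q a t + \<kappa> * P a t"])
    show "((\<lambda>t. Q a t + \<kappa> * P a t) has_real_derivative
      - (2 * real m) * sin (2 * Y a x) * (C a x * cos (2 * Y a x) ^ (m - 1)) * (W a x)\<^sup>2
       + \<kappa> * (cc * (1 - exp (2 * X a x)) * (W a x)\<^sup>2 * (C a x)\<^sup>2)) (at x)" for x
      by (intro DERIV_add Q_deriv2 DERIV_cmult P_deriv)
    fix x assume x: "s \<le> x"
    have s1: "sin (2 * Y a x) \<ge> \<delta>"
      unfolding \<delta>_def using Yinc[of t0 x] Y_bound[of a x] fe[OF t0(1)] t0 x that
      by (intro sin_monotone_2pi_le) auto
    have c1: "C a x \<le> cos (2 * Y a x) ^ (m - 1)"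
      unfolding C_def using cos_pos[of a x] by (intro power_decreasing) auto
    have "\<kappa> * (cc * (1 - exp (2 * X a x)) * (W a x)\<^sup>2 * (C a x)\<^sup>2) \<le> \<kappa> * (cc * 1 * (W a x)\<^sup>2 * (C a x)\<^sup>2)"
      using \<kappa> cc3 by (intro mult_left_mono mult_right_mono) auto
    also have "\<dots> = 2 * real m * \<delta> * (C a x * C a x) * (W a x)\<^sup>2" using cc3 by (simp add: \<kappa>_def power2_eq_square)
    also have "\<dots> \<le> 2 * real m * sin (2 * Y a x) * (C a x * cos (2 * Y a x) ^ (m - 1)) * (W a x)\<^sup>2"
      using s1 c1 \<delta> C_pos[of a x] by (intro mult_mono mult_left_mono) auto
    finally show "- (2 * real m) * sin (2 * Y a x) * (C a x * cos (2 * Y a x) ^ (m - 1)) * (W a x)\<^sup>2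
       + \<kappa> * (cc * (1 - exp (2 * X a x)) * (W a x)\<^sup>2 * (C a x)\<^sup>2) \<le> 0" by simp
  qed
  \<comment> \<open>A negative value would persist and keep P below - k, as Q > 0. Then X tends to
    minus infinity and W to 0, which contradicts |P| \<le> W.\<close>
  have combpos: "Q a t + \<kappa> * P a t \<ge> 0" if "t0 \<le> t" for t
  proof (rule ccontr)
    define k where "k = - (Q a t + \<kappa> * P a t) / \<kappa>"
    assume "\<not> ?thesis"
    then have k: "k > 0" using \<kappa> by (simp add: k_def)
    have Pk: "P a x \<le> - k" if "t \<le> x" for x
    proof -
      have "\<kappa> * P a x \<le> Q a t + \<kappa> * P a t" using comb[of t x] Qpos[of x] \<open>t0 \<le> t\<close> that t0 by auto
      then show ?thesis using \<kappa> by (simp add: k_def field_simps)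
    qed
    obtain x where x: "x \<ge> t" "X a x < ln k / cc" using unb[OF k Pk, where M = "ln k / cc"] by blast
    have "k \<le> W a x"
      using Pk[OF x(1)] P_le[of a x] C_le_1[of a x] C_pos[of a x] W_pos[of a x] k
        mult_left_le[of "C a x" "W a x"] by linarith
    also have "W a x \<le> exp (cc * X a x)" unfolding W_def w_def using cc3 by simp
    also have "\<dots> < exp (ln k)" using x(2) cc3 by (subst exp_less_cancel_iff) (simp add: field_simps)
    finally show False using k by simp
  qed
  \<comment> \<open>Q + \<kappa> P \<ge> 0 means that Y + \<kappa> X is nondecreasing; as Y <
    \<pi>/4, this bounds X from below.\<close>
  define xl where "xl = (Y a t0 + \<kappa> * X a t0 - pi / 4) / \<kappa>"
  have Xlow: "X a t \<ge> xl" if "t0 \<le> t" for t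
  proof -
    have "Y a t0 + \<kappa> * X a t0 \<le> Y a t + \<kappa> * X a t"
      by (rule deriv_nonneg_le[OF that, of "\<lambda>t. Y a t + \<kappa> * X a t" "\<lambda>t. Q a t + \<kappa> * P a t"])
        (auto intro!: combpos DERIV_add DERIV_cmult Y_deriv X_deriv)
    then have "Y a t0 + \<kappa> * X a t0 - pi / 4 \<le> X a t * \<kappa>" using Y_bound[of a t] by (auto simp: mult.commute)
    then show ?thesis unfolding xl_def using \<kappa> by (simp add: pos_divide_le_eq)
  qed
  have Psmall: "\<exists>t\<ge>t0. - P a t < \<epsilon>" if "\<epsilon> > 0" for \<epsilon>
  proof (rule ccontr)
    assume "\<not> ?thesis"
    then have "P a x \<le> - \<epsilon>" if "t0 \<le> x" for x using that by force
    then obtain t where "t \<ge> t0" "X a t < xl" using unb[OF \<open>\<epsilon> > 0\<close>, where s = t0 and M = xl] by blast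
    then show False using Xlow[of t] by simp
  qed
  show "\<exists>t0>0. X a t0 < 0 \<and> (\<forall>\<epsilon>>0. \<exists>t\<ge>t0. C a t < \<epsilon>)"
  proof (rule exI[of _ t0], intro conjI allI impI t0)
    fix \<epsilon> :: real assume \<epsilon>: "\<epsilon> > 0"
    \<comment> \<open>If |P| and |Q| are below \<mu>, the energy gives W C < 2 \<mu> = \<epsilon>
      \<open>w xl\<close>, and W \<ge> \<open>w xl\<close> turns this into C < \<epsilon>.\<close>
    define \<mu> where "\<mu> = \<epsilon> * w xl / 2"
    have \<mu>: "\<mu> > 0" using \<epsilon> w_pos by (simp add: \<mu>_def)
    obtain t' where t': "t' \<ge> t0" "- P a t' < \<mu>" using Psmall[OF \<mu>] by blast
    obtain t where t: "t > t'" "Q a t < \<mu>" using Qsmall[OF \<mu>, of t'] t' t0 by auto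
    have Pt: "- P a t < \<mu>" using Pinc[of t' t] t' t by auto
    have "(- P a t)\<^sup>2 < \<mu>\<^sup>2" using Pt fe[of t] t t' t0 by (intro power_strict_mono) auto
    moreover have "(Q a t)\<^sup>2 < \<mu>\<^sup>2" using t(2) Qpos[of t] t t' t0 by (intro power_strict_mono) auto
    ultimately have "(W a t)\<^sup>2 * (C a t)\<^sup>2 < 4 * \<mu>\<^sup>2" using energy[of a t] zero_le_power2[of \<mu>]
      unfolding power2_minus by linarith
    then have "(W a t * C a t)\<^sup>2 < (2 * \<mu>)\<^sup>2" by (simp add: power_mult_distrib)
    then have "W a t * C a t < 2 * \<mu>" using \<mu> by (rule_tac power2_less_imp_less) auto
    moreover have "w xl \<le> W a t" unfolding W_def
      using Xlow[of t] Xneg[of t] t t' by (intro w_mono_neg) auto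
    ultimately have "w xl * C a t < \<epsilon> * w xl"
      using mult_right_mono[OF \<open>w xl \<le> W a t\<close> less_imp_le[OF C_pos[of a t]]] unfolding \<mu>_def by linarith
    then have "C a t < \<epsilon>" using w_pos[of xl] by (simp add: mult.commute)
    then show "\<exists>t\<ge>t0. C a t < \<epsilon>" using t t' by (intro exI[of _ t]) auto
  qed
qed

text \<open>At a late time \<tau> the limit orbit has tiny C and X clearly negative, and a nearby
  orbit still rises. If the latter crossed, it would turn after \<tau>, with C and X smaller still
  than at \<tau>, which \<open>neck_constraint\<close> forbids.\<close>

lemma forever_not_crosses_near:
  assumes a: "a > 0" and fe: "\<And>t. t > 0 \<Longrightarrow> P a t < 0 \<and> Y a t > 0"
  shows "\<exists>d>0. \<forall>b. \<bar>b - a\<bar> < d \<longrightarrow> \<not> crosses b"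
proof -
  have Qpos: "\<And>t. t \<ge> 0 \<Longrightarrow> Q a t > 0" by (rule forever_limit[OF assms])
  obtain t0 where t0: "t0 > 0" "X a t0 < 0" "\<And>\<epsilon>. \<epsilon> > 0 \<Longrightarrow> \<exists>t\<ge>t0. C a t < \<epsilon>"
    using forever_limit(2)[OF assms] by blast
  define \<eta> where "\<eta> = - X a t0 / 2"
  have \<eta>: "\<eta> > 0" using t0 by (simp add: \<eta>_def)
  \<comment> \<open>The first bound provides the hypothesis C \<le> \<open>kap\<close> / 2 of
    \<open>neck_constraint\<close>; the second contradicts its conclusion when X \<le> - \<eta> at
    the turning point.\<close>
  define \<epsilon> where "\<epsilon> = min (kap / 2) (cc * kap * pi / 16 * (1 - exp (- 2 * \<eta>)))"
  have \<epsilon>: "\<epsilon> > 0" using kap_pos cc3 \<eta> by (simp add: \<epsilon>_def)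
  obtain \<tau> where \<tau>: "\<tau> \<ge> t0" "C a \<tau> < \<epsilon>" using t0(3)[OF \<epsilon>] by blast
  have Xt: "X a \<tau> \<le> - 2 * \<eta>"
    using deriv_nonpos_le[OF \<tau>(1) X_deriv] fe t0 by (simp add: \<eta>_def less_imp_le)
  have "isCont (\<lambda>y. cos (2 * y) ^ m) (Y a \<tau>)" by (intro continuous_intros)
  then obtain \<rho> where \<rho>: "\<rho> > 0" "\<And>y. \<bar>y - Y a \<tau>\<bar> < \<rho> \<Longrightarrow> \<bar>cos (2 * y) ^ m - cos (2 * Y a \<tau>) ^ m\<bar> < \<epsilon> - C a \<tau>"
    using \<tau> unfolding continuous_at_eps_delta dist_real_def by (metis diff_gt_0_iff_gt)
  obtain q where q: "q > 0" "\<And>x. 0 \<le> x \<Longrightarrow> x \<le> \<tau> \<Longrightarrow> Q a x \<ge> q"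
    by (rule continuous_pos_lower_bound[of 0 \<tau> "Q a"]) (use Qpos in \<open>auto intro!: cont_on\<close>)
  have Yt: "Y a \<tau> > 0" using fe \<tau> t0 by auto
  define \<mu> where "\<mu> = min (min \<rho> q) (min \<eta> (Y a \<tau>))"
  have \<mu>: "\<mu> > 0" using \<rho> q \<eta> Yt by (simp add: \<mu>_def)
  obtain d where d: "d > 0" "\<And>b t. \<bar>b - a\<bar> < d \<Longrightarrow> 0 \<le> t \<Longrightarrow> t \<le> \<tau> \<Longrightarrow>
    \<bar>X b t - X a t\<bar> < \<mu> \<and> \<bar>Y b t - Y a t\<bar> < \<mu> \<and> \<bar>P b t - P a t\<bar> < \<mu> \<and> \<bar>Q b t - Q a t\<bar> < \<mu>"
    using near[OF \<mu>, of a \<tau>] by blast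
  show ?thesis
  proof (intro exI[of _ d] conjI allI impI notI d(1))
    fix b assume b: "\<bar>b - a\<bar> < d" and "crosses b"
    then obtain t where t: "returns b t" by (auto simp: crosses_def)
    obtain s where s: "0 < s" "s < t" "Q b s = 0" "\<And>r. 0 \<le> r \<Longrightarrow> r < s \<Longrightarrow> Q b r > 0" "\<And>r. s < r \<Longrightarrow> r \<le> t \<Longrightarrow> Q b r < 0"
      using neck[OF t] by blast
    have Qb: "Q b r > 0" if "0 \<le> r" "r \<le> \<tau>" for r
    proof -
      have "\<bar>Q b r - Q a r\<bar> < q" using d(2)[OF b that] by (auto simp: \<mu>_def)
      then show ?thesis using q(2)[OF that] by linarith
    qed
    have st: "\<tau> < s" using Qb[of s] s by (cases "\<tau> < s") auto
    have \<tau>0: "0 \<le> \<tau>" using \<tau> t0 by simp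
    note D = d(2)[OF b \<tau>0 order_refl]
    have Cb: "C b \<tau> < \<epsilon>" using \<rho>(2)[of "Y b \<tau>"] D by (auto simp: C_def \<mu>_def abs_if split: if_splits)
    have Yb: "Y b \<tau> > 0" using D by (auto simp: \<mu>_def abs_if split: if_splits)
    have Xs: "X b s \<le> X b \<tau>"
      by (rule deriv_nonpos_le[OF less_imp_le[OF st] X_deriv])
        (use t s st \<tau>0 \<tau> t0 in \<open>auto simp: returns_def ascending_def less_imp_le\<close>)
    have "Y b \<tau> \<le> Y b s"
    proof (rule deriv_nonneg_le[OF less_imp_le[OF st] Y_deriv])
      fix x assume "\<tau> \<le> x" "x \<le> s" then show "0 \<le> Q b x" using s(3) s(4)[of x] \<tau>0 by (cases "x = s") auto
    qed
    then have Cs: "C b s < \<epsilon>" using C_antimono[of b \<tau> b s] Yb Cb by auto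
    have "Y b s \<ge> pi / 8"
    proof (rule ccontr)
      assume "\<not> ?thesis"
      then have "C b s \<ge> kap" using Yb \<open>Y b \<tau> \<le> Y b s\<close> by (intro C_ge_kap) auto
      then show False using Cs kap_pos by (auto simp: \<epsilon>_def)
    qed
    moreover have Xs': "X b s \<le> - \<eta>"
    proof -
      have "\<bar>X b \<tau> - X a \<tau>\<bar> < \<eta>" using D by (auto simp: \<mu>_def)
      then show ?thesis using Xs Xt by linarith
    qed
    ultimately have "C b s \<ge> cc * kap * pi / 16 * (1 - exp (2 * X b s))"
      using Cs \<eta> by (intro neck_constraint[OF t s(1,2,3,5)]) (auto simp: \<epsilon>_def)
    moreover have "cc * kap * pi / 16 * (1 - exp (2 * X b s)) \<ge> cc * kap * pi / 16 * (1 - exp (- 2 * \<eta>))"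
      using Xs' kap_pos cc3 by (intro mult_left_mono) auto
    ultimately show False using Cs by (auto simp: \<epsilon>_def)
  qed
qed

lemma returning_perpendicularly:
  assumes "a0 > 0" "\<And>t. \<not> returns a0 t" and "a1 > 0" "crosses a1"
  obtains a t where "a > 0" "returns a t" "P a t = 0"
proof (rule ccontr)
  assume "\<not> thesis"
  then have none: "\<not> (returns a t \<and> P a t = 0)" if "a > 0" for a t using that \<open>\<And>a t. a > 0 \<Longrightarrow> returns a t \<Longrightarrow> P a t = 0 \<Longrightarrow> thesis\<close> by blast
  define B where "B = {a. 0 < a \<and> crosses a}"
  define N where "N = {a. 0 < a \<and> \<not> crosses a}"
  have oB: "open B" unfolding open_dist
  proof
    fix a assume a: "a \<in> B"
    then obtain d where "d > 0" "\<And>b. \<bar>b - a\<bar> < d \<Longrightarrow> crosses b" using crosses_near[of a] by (auto simp: B_def)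
    then show "\<exists>e>0. \<forall>y. dist y a < e \<longrightarrow> y \<in> B"
      using a by (intro exI[of _ "min d a"]) (auto simp: B_def dist_real_def)
  qed
  have oN: "open N" unfolding open_dist
  proof
    fix a assume "a \<in> N"
    then have a: "0 < a" "\<not> crosses a" by (auto simp: N_def)
    have "\<exists>d>0. \<forall>b. \<bar>b - a\<bar> < d \<longrightarrow> \<not> crosses b"
    proof (rule first_exit[OF a(1)])
      fix t assume "returns a t"
      then have "P a t \<noteq> 0" "P a t \<le> 0" using none[OF a(1)] by (auto simp: returns_def)
      then show ?thesis using \<open>returns a t\<close> a(2) by (auto simp: crosses_def)
    qed (use turning_not_crosses_near[OF a(1)] forever_not_crosses_near[OF a(1)] in blast)+
    then obtain d where "d > 0" "\<And>b. \<bar>b - a\<bar> < d \<Longrightarrow> \<not> crosses b" by blast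
    then show "\<exists>e>0. \<forall>y. dist y a < e \<longrightarrow> y \<in> N"
      using a by (intro exI[of _ "min d a"]) (auto simp: N_def dist_real_def)
  qed
  have "connected ({0<..} :: real set)" by simp
  moreover have "a0 \<in> N" "a1 \<in> B" using assms by (auto simp: N_def B_def crosses_def)
  moreover have "{0<..} \<subseteq> N \<union> B" "N \<inter> B \<inter> {0<..} = {}" by (auto simp: N_def B_def)
  ultimately show False using oB oN assms(1,3) unfolding connected_def by blast
qed

end

section \<open>Starting close to the sphere\<close>

context profile
begin

lemma X_le_start:
  assumes "ascending a t" "0 \<le> s" "s \<le> t"
  shows "X a s \<le> a"
proof -
  have "X a s \<le> X a 0"
  proof (cases "s = 0")
    case False
    then have "X a s < X a 0"
      by (intro deriv_neg_less[OF _ X_deriv]) (use assms in \<open>auto simp: ascending_def\<close>)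
    then show ?thesis by simp
  qed simp
  then show ?thesis by (simp add: init)
qed

lemma exp_diff_le:
  assumes "0 \<le> x" "x \<le> (1/2::real)"
  shows "exp (2 * x) - 1 \<le> 6 * x"
proof -
  have "exp (2 * x) \<le> 1 + 2 * x + (2 * x)\<^sup>2" using assms by (intro exp_bound) auto
  also have "(2 * x)\<^sup>2 \<le> 2 * x" using assms power_decreasing[of 1 2 "2 * x"] by simp
  finally show ?thesis using assms by simp
qed

text \<open>While Y rises, X \<le> a and Q \<le> W give J' \<ge> - 6 cc a Y'. As Y < \<pi>/4 < 4/5,
  the total loss of J is less than 5 cc a.\<close>

lemma J_lower_bound:
  assumes "ascending a s" "0 < a" "a \<le> 1/2" "\<And>r. 0 \<le> r \<Longrightarrow> r < s \<Longrightarrow> Q a r \<ge> 0" "0 \<le> t" "t \<le> s"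
  shows "- (5 * cc) * a \<le> J a t"
proof -
  have "J a 0 + 6 * cc * a * Y a 0 \<le> J a t + 6 * cc * a * Y a t"
  proof (rule deriv_nonneg_le[OF assms(5), of "\<lambda>t. J a t + 6 * cc * a * Y a t"])
    show "((\<lambda>t. J a t + 6 * cc * a * Y a t) has_real_derivative
      cc * (1 - exp (2 * X a x)) * (Q a x)\<^sup>2 / W a x + 6 * cc * a * Q a x) (at x)" for x
      by (intro DERIV_add J_deriv DERIV_cmult Y_deriv)
    fix x assume x: "0 \<le> x" "x \<le> t"
    have Qx: "Q a x \<ge> 0"
    proof (cases "x < s")
      case False
      then have "x = s" using x assms by simp
      show ?thesis
      proof (cases "s = 0")
        case True then show ?thesis using \<open>x = s\<close> w_pos[of a] by (simp add: init)
      next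
        case False
        then show ?thesis using isCont_nonpos_from_left[where f = "\<lambda>r. - Q a r" and r = 0 and t = s]
          assms(4) x \<open>x = s\<close> cont(4)[of s a] by auto
      qed
    qed (use assms(4)[of x] x in auto)
    have "Q a x \<le> W a x"
      using Q_le[of a x] mult_left_le[OF C_le_1[of a x] less_imp_le[OF W_pos[of a x]]] by linarith
    then have qw: "Q a x / W a x \<le> 1" "0 \<le> Q a x / W a x" using Qx W_pos[of a x] by auto
    have "exp (2 * X a x) \<le> exp (2 * a)" using X_le_start[OF assms(1) x(1)] x assms by simp
    then have "exp (2 * X a x) - 1 \<le> 6 * a" using exp_diff_le[of a] assms by linarith
    then have "cc * (exp (2 * X a x) - 1) * (Q a x * (Q a x / W a x)) \<le> cc * (6 * a) * (Q a x * (Q a x / W a x))"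
      using cc3 mult_nonneg_nonneg[OF Qx qw(2)] by (rule_tac mult_right_mono[OF mult_left_mono]) auto
    also have "\<dots> \<le> cc * (6 * a) * (Q a x * 1)"
      using cc3 assms(2) mult_left_mono[OF qw(1) Qx] by (rule_tac mult_left_mono) auto
    finally have "cc * (exp (2 * X a x) - 1) * (Q a x * (Q a x / W a x)) \<le> cc * (6 * a) * (Q a x * 1)" .
    then show "0 \<le> cc * (1 - exp (2 * X a x)) * (Q a x)\<^sup>2 / W a x + 6 * cc * a * Q a x"
      by (simp add: power2_eq_square algebra_simps diff_divide_distrib)
  qed
  then have "- (6 * cc * a * Y a t) \<le> J a t" by (simp add: init)
  moreover have "6 * cc * a * Y a t \<le> 6 * cc * a * (4/5)"
    using Y_bound[of a t] pi_less_4 assms cc3 pi_approx by (intro mult_left_mono) auto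
  moreover have "cc * a \<ge> 0" using cc3 assms by simp
  ultimately show ?thesis by linarith
qed

text \<open>Near the sphere \<open>X = 0\<close> the equation linearises to an eigenvalue equation on \<open>S\<^sup>2\<^sup>n\<^sup>-\<^sup>1\<close> with eigenvalue
  \<open>2 (2n - 1)\<close>, slightly below the eigenvalue \<open>4n\<close> of \<open>sin (2Y)\<close>. The main terms of \<open>\<Psi>\<close> are the Wronskian of these
  two functions; its monotonicity forces \<open>J \<le> - a\<close> near \<open>Y = \<pi>/4\<close>, and integrating \<open>dX/dY\<close>, which
  diverges logarithmically there, pushes \<open>X\<close> below the bound allowed by \<open>neck_constraint\<close>.\<close>

lemma no_return_small:
  "\<exists>a>0. \<forall>t. \<not> returns a t"
proof -
  \<comment> \<open>\<open>A0\<close> is the constant of \<open>J_lower_bound\<close> and \<kappa>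
    that of \<open>neck_constraint\<close>. Their quotient \<Lambda> will give X \<ge> - \<Lambda> a
    up to the turning point.\<close>
  define A0 where "A0 = 5 * cc"
  define \<kappa> where "\<kappa> = cc * kap * pi / 16"
  define \<Lambda> where "\<Lambda> = A0 / \<kappa>"
  \<comment> \<open>\<open>B0\<close> collects the coefficients of a \<mu> in the final bound for J:
    2 (1 + \<Lambda>) from a - X \<le> (1 + \<Lambda>) a, and 2 cc from Y \<le> 1. The next constant
    \<delta> is small enough that its share in \<mu> \<open>B0\<close> is at most 1/8.\<close>
  define B0 where "B0 = 2 * (1 + \<Lambda>) + 2 * cc"
  define \<delta> where "\<delta> = min (1/8) (1 / (8 * B0))"
  have pos: "A0 > 0" "\<kappa> > 0" "\<Lambda> > 0" "B0 > 0" "\<delta> > 0"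
    using cc3 kap_pos by (auto simp: A0_def \<kappa>_def \<Lambda>_def B0_def \<delta>_def intro!: add_pos_pos)
  have \<delta>: "\<delta> \<le> 1/8" "\<delta> * B0 \<le> 1/8"
  proof -
    have "\<delta> * B0 \<le> 1 / (8 * B0) * B0" using pos(4) by (intro mult_right_mono) (auto simp: \<delta>_def)
    then show "\<delta> \<le> 1/8" "\<delta> * B0 \<le> 1/8" using pos(4) by (auto simp: \<delta>_def)
  qed
  define y0 where "y0 = arccos \<delta> / 2"
  have y0: "cos (2 * y0) = \<delta>" "0 < y0" "y0 < pi / 4"
  proof -
    have "arccos \<delta> < arccos 0" "arccos 1 < arccos \<delta>" using \<delta>(1) pos(5) by (intro arccos_less_arccos; simp)+
    then show "cos (2 * y0) = \<delta>" "0 < y0" "y0 < pi / 4" using \<delta>(1) pos(5) by (auto simp: y0_def)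
  qed
  define y1 where "y1 = pi / 4 - (pi / 4 - y0) * exp (- 2 * (2 + \<Lambda>))"
  have y1: "y0 < y1" "y1 < pi / 4"
  proof -
    have "(pi / 4 - y0) * exp (- 2 * (2 + \<Lambda>)) < (pi / 4 - y0) * 1"
      using y0 pos(3) by (intro mult_strict_left_mono) auto
    moreover have "(pi / 4 - y0) * exp (- 2 * (2 + \<Lambda>)) > 0" using y0 by simp
    ultimately show "y0 < y1" "y1 < pi / 4" by (simp_all only: y1_def mult_1_right less_diff_eq)
  qed
  \<comment> \<open>An antiderivative of 1 / (\<pi>/2 - 2y), which stays below 1 / cos (2y)^m and
    whose integral diverges at the boundary. The height \<open>y1\<close> is placed so that G gains
    2 + \<Lambda> from \<open>y0\<close> to \<open>y1\<close>.\<close>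
  define G where "G = (\<lambda>y. - ln (pi / 2 - 2 * y) / 2)"
  have Gd: "(G has_real_derivative 1 / (pi / 2 - 2 * y)) (at y)" if "y < pi / 4" for y
    unfolding G_def using that by (auto intro!: derivative_eq_intros simp: field_simps)
  have Gy: "G y1 - G y0 = 2 + \<Lambda>"
  proof -
    have "pi / 2 - 2 * y1 = (pi / 2 - 2 * y0) * exp (- 2 * (2 + \<Lambda>))" by (simp add: y1_def algebra_simps)
    then have "ln (pi / 2 - 2 * y1) = ln (pi / 2 - 2 * y0) + (- 2 * (2 + \<Lambda>))"
      using y0 by (simp only:) (subst ln_mult; simp)
    then show ?thesis by (simp add: G_def field_simps)
  qed
  have c1: "cos (2 * y1) ^ m > 0" using y0 y1 by (intro zero_less_power cos_gt_zero_pi) auto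
  have "\<forall>\<^sub>F a in at_right 0. 0 < a \<and> a < 1/2 \<and> A0\<^sup>2 * a\<^sup>2 / \<delta> ^ m * B0 < 1/8 \<and> A0 * a < cos (2 * y1) ^ m
      \<and> A0 * a < kap / 2 \<and> \<Lambda> * a < 1/2"
  proof (intro eventually_conj)
    show "\<forall>\<^sub>F a::real in at_right 0. 0 < a" by (simp add: eventually_at_right_less)
    show "\<forall>\<^sub>F a::real in at_right 0. a < 1/2"
      by (rule order_tendstoD(2)[where y = 0]) (auto intro!: tendsto_eq_intros)
    have "((\<lambda>a::real. A0\<^sup>2 * a\<^sup>2 / \<delta> ^ m * B0) \<longlongrightarrow> A0\<^sup>2 * 0\<^sup>2 / \<delta> ^ m * B0) (at_right 0)"
      using pos(5) by (intro tendsto_intros) auto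
    then show "\<forall>\<^sub>F a::real in at_right 0. A0\<^sup>2 * a\<^sup>2 / \<delta> ^ m * B0 < 1/8"
      by (rule order_tendstoD(2)) simp
    have l: "((\<lambda>a::real. k * a) \<longlongrightarrow> k * 0) (at_right 0)" for k by (intro tendsto_intros)
    show "\<forall>\<^sub>F a::real in at_right 0. A0 * a < cos (2 * y1) ^ m"
      by (rule order_tendstoD(2)[OF l]) (use c1 in simp)
    show "\<forall>\<^sub>F a::real in at_right 0. A0 * a < kap / 2"
      by (rule order_tendstoD(2)[OF l]) (use kap_pos in simp)
    show "\<forall>\<^sub>F a::real in at_right 0. \<Lambda> * a < 1/2"
      by (rule order_tendstoD(2)[OF l]) simp
  qed
  then obtain a where a: "0 < a" "a < 1/2" "A0\<^sup>2 * a\<^sup>2 / \<delta> ^ m * B0 < 1/8" "A0 * a < cos (2 * y1) ^ m"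
      "A0 * a < kap / 2" "\<Lambda> * a < 1/2"
    using eventually_happens'[OF trivial_limit_at_right_real] by blast
  have False if ret: "returns a t" for t
  proof -
    have asc: "ascending a t" using ret by (simp add: returns_def)
    obtain s where s: "0 < s" "s < t" "Q a s = 0" "\<And>r. 0 \<le> r \<Longrightarrow> r < s \<Longrightarrow> Q a r > 0" "\<And>r. s < r \<Longrightarrow> r \<le> t \<Longrightarrow> Q a r < 0"
      using neck[OF ret] by blast
    have asc': "ascending a s" using asc s by (auto simp: ascending_def)
    have Qn: "Q a r \<ge> 0" if "0 \<le> r" "r \<le> s" for r using s(3) s(4)[of r] that by (cases "r = s") auto
    have Pn: "P a r \<le> 0" if "0 \<le> r" "r \<le> s" for r
      using asc s(2) that by (cases "r = 0") (auto simp: ascending_def init less_imp_le)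
    have Yn: "Y a r \<ge> 0" if "0 \<le> r" "r \<le> s" for r
      using asc s(2) that by (cases "r = 0") (auto simp: ascending_def init less_imp_le)
    have Jn: "J a r \<le> 0" if "0 \<le> r" "r \<le> s" for r
      using Pn[OF that] W_pos[of a r] by (simp add: J_def divide_le_0_iff)
    have Jl: "- (A0 * a) \<le> J a r" if "0 \<le> r" "r \<le> s" for r
      using J_lower_bound[OF asc' a(1) _ _ that] s(4) a(2) by (auto simp: A0_def less_imp_le)
    have Js: "J a s = - C a s"
    proof -
      have "(J a s)\<^sup>2 = (C a s)\<^sup>2" using Q_over_W[of a s] s by simp
      then show ?thesis using Jn[of s] s C_pos[of a s] by (auto simp: power2_eq_iff)
    qed
    then have Cs: "C a s \<le> A0 * a" using Jl[of s] s by auto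
    have Ys0: "Y a s > 0" using asc s by (auto simp: ascending_def)
    have Ys: "Y a s \<ge> pi / 8"
    proof (rule ccontr)
      assume "\<not> ?thesis"
      then have "C a s \<ge> kap" using Ys0 by (intro C_ge_kap) auto
      then show False using Cs a kap_pos by auto
    qed
    \<comment> \<open>If X were below - \<Lambda> a, then exp (2X) < 1 / (1 + 2 \<Lambda> a), while
      the constraint at the turning point gives exp (2X) \<ge> 1 - \<Lambda> a. These are
      incompatible for \<Lambda> a < 1/2.\<close>
    have Xs: "X a s \<ge> - (\<Lambda> * a)"
    proof (rule ccontr)
      assume n: "\<not> ?thesis"
      have u: "0 < \<Lambda> * a" using pos a by simp
      have "\<kappa> * (1 - exp (2 * X a s)) \<le> C a s"
        unfolding \<kappa>_def using n u Ys Cs a by (intro neck_constraint[OF ret s(1,2,3,5)]) auto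
      then have "1 - exp (2 * X a s) \<le> A0 * a / \<kappa>" using Cs pos by (simp add: field_simps)
      then have 1: "1 - \<Lambda> * a \<le> exp (2 * X a s)" by (simp add: \<Lambda>_def)
      have "exp (2 * X a s) < exp (- (2 * (\<Lambda> * a)))" using n by simp
      also have "\<dots> = inverse (exp (2 * (\<Lambda> * a)))" by (rule exp_minus)
      also have "\<dots> \<le> inverse (1 + 2 * (\<Lambda> * a))" using u by (intro le_imp_inverse_le) auto
      finally have "exp (2 * X a s) * (1 + 2 * (\<Lambda> * a)) < 1" using u by (simp add: field_simps)
      moreover have "(1 - \<Lambda> * a) * (1 + 2 * (\<Lambda> * a)) \<le> exp (2 * X a s) * (1 + 2 * (\<Lambda> * a))"
        using 1 u by (intro mult_right_mono) auto
      moreover have "(1 - \<Lambda> * a) * (1 + 2 * (\<Lambda> * a)) = 1 + (\<Lambda> * a) * (1 - 2 * (\<Lambda> * a))" by (simp add: algebra_simps)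
      moreover have "(\<Lambda> * a) * (1 - 2 * (\<Lambda> * a)) \<ge> 0" using u a pos by (intro mult_nonneg_nonneg) auto
      ultimately show False by linarith
    qed
    have Xl: "X a r \<ge> - (\<Lambda> * a)" if "0 \<le> r" "r \<le> s" for r
    proof -
      have "X a s \<le> X a r" by (rule deriv_nonpos_le[OF that(2) X_deriv]) (use Pn that in auto)
      then show ?thesis using Xs by simp
    qed
    have Xu: "X a r \<le> a" if "0 \<le> r" "r \<le> s" for r by (rule X_le_start[OF asc' that])
    \<comment> \<open>A uniform bound for C - Q / W. Where cos (2Y) \<le> \<delta>, already C \<le>
      \<delta>; elsewhere (C - Q/W) (C + Q/W) = J^2 \<le> (A0 a)^2 and C \<ge> \<delta>^m.\<close>
    define \<mu> where "\<mu> = \<delta> + A0\<^sup>2 * a\<^sup>2 / \<delta> ^ m"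
    have "\<mu> * B0 = \<delta> * B0 + A0\<^sup>2 * a\<^sup>2 / \<delta> ^ m * B0" by (simp only: \<mu>_def distrib_right)
    then have \<mu>: "\<mu> > 0" "\<mu> * B0 \<le> 1/4"
      using pos a(3) \<delta> by (linarith | simp add: \<mu>_def add_pos_nonneg)+
    have \<sigma>: "0 \<le> Q a r / W a r" "Q a r / W a r \<le> C a r" "C a r - Q a r / W a r \<le> \<mu>" if r: "0 \<le> r" "r \<le> s" for r
    proof -
      show q0: "0 \<le> Q a r / W a r" using Qn[OF r] W_pos[of a r] by simp
      show q1: "Q a r / W a r \<le> C a r" using Q_le[of a r] Qn[OF r] W_pos[of a r] by (simp add: field_simps)
      show "C a r - Q a r / W a r \<le> \<mu>"
      proof (cases "cos (2 * Y a r) \<le> \<delta>")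
        case True
        moreover have "0 \<le> A0\<^sup>2 * a\<^sup>2 / \<delta> ^ m" using pos by simp
        ultimately show ?thesis using C_le_cos[of a r] q0 unfolding \<mu>_def by linarith
      next
        case False
        then have Cd: "\<delta> ^ m \<le> C a r" unfolding C_def using pos(5) by (intro power_mono) auto
        have "(C a r - Q a r / W a r) * \<delta> ^ m \<le> (C a r - Q a r / W a r) * (C a r + Q a r / W a r)"
          using q0 q1 Cd by (intro mult_left_mono) auto
        also have "\<dots> = (J a r)\<^sup>2" using Q_over_W[of a r] by (simp add: power2_eq_square algebra_simps)
        also have "\<dots> = (- J a r)\<^sup>2" by simp
        also have "\<dots> \<le> (A0 * a)\<^sup>2" using Jl[OF r] Jn[OF r] by (intro power_mono) auto
        finally have "C a r - Q a r / W a r \<le> A0\<^sup>2 * a\<^sup>2 / \<delta> ^ m" using pos(5) by (simp add: field_simps)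
        then show ?thesis using pos(5) by (simp add: \<mu>_def)
      qed
    qed
    let ?n = "real m + 1"
    let ?E = "\<lambda>r. cos (2 * Y a r) ^ (m + 1)"
    \<comment> \<open>The first two terms are the Wronskian. Linearised, its derivative has the
      eigenvalue gap 4n - 2 (2n - 1) = 2 as a factor, in the form 2 C X; the term with a / n
      replaces X by X - a \<le> 0. The terms with \<mu> absorb the error from exchanging C and Q /
      W.\<close>
    define \<Psi> where "\<Psi> = (\<lambda>r. sin (2 * Y a r) * J a r - 2 * (?E r * X a r) + a / ?n * ?E r + 2 * \<mu> * X a r - 2 * cc * \<mu> * a * Y a r)"
    have Ed: "(?E has_real_derivative - 2 * ?n * sin (2 * Y a r) * C a r * Q a r) (at r)" for r
    proof -
      have "((\<lambda>r. cos (2 * Y a r)) has_real_derivative - 2 * sin (2 * Y a r) * Q a r) (at r)"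
        using Y_deriv[of a r] by (auto intro!: derivative_eq_intros)
      from DERIV_power[OF this, of "m + 1"] show ?thesis by (rule DERIV_cong) (simp add: C_def algebra_simps)
    qed
    have Sd: "((\<lambda>r. sin (2 * Y a r)) has_real_derivative 2 * cos (2 * Y a r) * Q a r) (at r)" for r
      using Y_deriv[of a r] by (auto intro!: derivative_eq_intros)
    have \<Psi>d: "(\<Psi> has_real_derivative
       2 * P a r * (\<mu> - cos (2 * Y a r) * (C a r - Q a r / W a r))
       + Q a r * (sin (2 * Y a r) * (4 * ?n * C a r * X a r - cc * (exp (2 * X a r) - 1) * (Q a r / W a r) - 2 * a * C a r)
          - 2 * cc * \<mu> * a)) (at r)" for r
    proof -
      have aE: "((\<lambda>r. a / ?n * ?E r) has_real_derivative - 2 * a * sin (2 * Y a r) * C a r * Q a r) (at r)"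
        by (rule DERIV_cong[OF DERIV_cmult[OF Ed]]) (simp add: field_simps)
      have E: "?E r = cos (2 * Y a r) * C a r" by (simp add: C_def)
      show ?thesis unfolding \<Psi>_def
        by (rule DERIV_cong[OF DERIV_diff[OF DERIV_add[OF DERIV_add[OF DERIV_diff[OF DERIV_mult[OF Sd J_deriv] DERIV_cmult[OF DERIV_mult[OF Ed X_deriv]]]
            aE] DERIV_cmult[OF X_deriv]] DERIV_cmult[OF Y_deriv]]], unfold E)
          (simp add: J_def power2_eq_square algebra_simps diff_divide_distrib add_divide_distrib)
    qed
    have \<Psi>le: "\<Psi> r \<le> \<Psi> 0" if r: "0 \<le> r" "r \<le> s" for r
    proof (rule deriv_nonpos_le[OF r(1) \<Psi>d])
      fix x assume "0 \<le> x" "x \<le> r"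
      then have x: "0 \<le> x" "x \<le> s" using r by auto
      note \<sigma>x = \<sigma>[OF x]
      define \<sigma>' where "\<sigma>' = Q a x / W a x"
      have "cos (2 * Y a x) * (C a x - \<sigma>') \<le> 1 * (C a x - \<sigma>')"
        using \<sigma>x unfolding \<sigma>'_def by (intro mult_right_mono) auto
      then have 1: "2 * P a x * (\<mu> - cos (2 * Y a x) * (C a x - \<sigma>')) \<le> 0"
        using Pn[OF x] \<sigma>x unfolding \<sigma>'_def by (rule_tac mult_nonpos_nonneg) auto
      have "2 * X a x * \<sigma>' \<le> (exp (2 * X a x) - 1) * \<sigma>'"
      proof (rule mult_right_mono)
        show "2 * X a x \<le> exp (2 * X a x) - 1" using exp_ge_add_one_self[of "2 * X a x"] by linarith
      qed (use \<sigma>x in \<open>simp add: \<sigma>'_def\<close>)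
      then have "cc * (2 * X a x * \<sigma>') \<le> cc * ((exp (2 * X a x) - 1) * \<sigma>')" using cc3 by (intro mult_left_mono) auto
      then have "4 * ?n * C a x * X a x - cc * (exp (2 * X a x) - 1) * \<sigma>' - 2 * a * C a x \<le>
          4 * ?n * C a x * X a x - cc * (2 * X a x * \<sigma>') - 2 * a * C a x" by simp
      also have "\<dots> = 2 * C a x * (X a x - a) + 2 * cc * (X a x * (C a x - \<sigma>'))" by (simp add: cc_def algebra_simps)
      also have "\<dots> \<le> 0 + 2 * cc * (a * \<mu>)"
      proof (intro add_mono mult_left_mono)
        show "2 * C a x * (X a x - a) \<le> 0" using Xu[OF x] C_pos[of a x] by (intro mult_nonneg_nonpos) auto
        have "X a x * (C a x - \<sigma>') \<le> a * (C a x - \<sigma>')" using Xu[OF x] \<sigma>x unfolding \<sigma>'_def by (intro mult_right_mono) auto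
        also have "\<dots> \<le> a * \<mu>" using \<sigma>x a unfolding \<sigma>'_def by (intro mult_left_mono) auto
        finally show "X a x * (C a x - \<sigma>') \<le> a * \<mu>" .
      qed (use cc3 in auto)
      finally have b: "4 * ?n * C a x * X a x - cc * (exp (2 * X a x) - 1) * \<sigma>' - 2 * a * C a x \<le> 2 * cc * \<mu> * a"
        by (simp add: mult_ac)
      have sx: "0 \<le> sin (2 * Y a x)" "sin (2 * Y a x) \<le> 1"
        using Yn[OF x] Y_bound[of a x] by (auto intro!: sin_ge_zero)
      have "sin (2 * Y a x) * (4 * ?n * C a x * X a x - cc * (exp (2 * X a x) - 1) * \<sigma>' - 2 * a * C a x) \<le> sin (2 * Y a x) * (2 * cc * \<mu> * a)"
        using b sx by (intro mult_left_mono)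
      also have "\<dots> \<le> 1 * (2 * cc * \<mu> * a)" using sx cc3 \<mu> a by (intro mult_right_mono) auto
      finally have "Q a x * (sin (2 * Y a x) * (4 * ?n * C a x * X a x - cc * (exp (2 * X a x) - 1) * \<sigma>' - 2 * a * C a x) - 2 * cc * \<mu> * a) \<le> 0"
        using Qn[OF x] by (intro mult_nonneg_nonpos) auto
      with 1 show "2 * P a x * (\<mu> - cos (2 * Y a x) * (C a x - Q a x / W a x))
       + Q a x * (sin (2 * Y a x) * (4 * ?n * C a x * X a x - cc * (exp (2 * X a x) - 1) * (Q a x / W a x) - 2 * a * C a x)
          - 2 * cc * \<mu> * a) \<le> 0" unfolding \<sigma>'_def by linarith
    qed
    \<comment> \<open>At the start \<Psi> = - 2a + a / n + 2 \<mu> a, and n \<ge> 2 makes the first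
      two terms at most - 3a/2. Near the boundary the X term costs at most a/4 and all \<mu> terms
      together at most a \<mu> \<open>B0\<close> \<le> a/4, which leaves - a.\<close>
    have Jtail: "J a r \<le> - a" if r: "0 \<le> r" "r \<le> s" and cd: "cos (2 * Y a r) \<le> \<delta>" for r
    proof -
      have E0: "0 \<le> ?E r" using cos_pos[of a r] by simp
      have "?E r \<le> cos (2 * Y a r) ^ 1" using cos_pos[of a r] by (intro power_decreasing) auto
      then have E1: "?E r \<le> 1/8" using cd \<delta> by simp
      have "\<Psi> r \<le> - 2 * a + a / ?n + 2 * \<mu> * a" using \<Psi>le[OF r] by (simp add: \<Psi>_def init)
      then have "sin (2 * Y a r) * J a r \<le> - 2 * a + a / ?n + 2 * \<mu> * (a - X a r) + 2 * (?E r * X a r) - a / ?n * ?E r + 2 * cc * \<mu> * a * Y a r"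
        by (simp add: \<Psi>_def algebra_simps)
      also have "\<dots> \<le> - 2 * a + a / 2 + 2 * \<mu> * ((1 + \<Lambda>) * a) + 2 * (1/8 * a) - 0 + 2 * cc * \<mu> * a * 1"
      proof (intro order_refl add_mono diff_mono mult_left_mono)
        show "a / ?n \<le> a / 2" using a m1 by (intro divide_left_mono) auto
        show "a - X a r \<le> (1 + \<Lambda>) * a" using Xl[OF r] by (simp add: algebra_simps)
        have "?E r * X a r \<le> ?E r * a" using Xu[OF r] E0 by (intro mult_left_mono)
        also have "\<dots> \<le> 1/8 * a" using E1 a by (intro mult_right_mono) auto
        finally show "?E r * X a r \<le> 1/8 * a" .
        show "0 \<le> a / ?n * ?E r" using a E0 by simp
        show "Y a r \<le> 1" using Y_bound[of a r] pi_less_4 by auto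
      qed (use \<mu> cc3 a in auto)
      also have "\<dots> = a * (\<mu> * B0 - 5/4)" by (simp add: B0_def algebra_simps)
      also have "\<dots> \<le> a * (- 1)" using \<mu> a by (intro mult_left_mono) auto
      finally have 1: "sin (2 * Y a r) * J a r \<le> - a" by simp
      have "J a r * 1 \<le> J a r * sin (2 * Y a r)" using Jn[OF r] by (intro mult_left_mono_neg) auto
      then show ?thesis using 1 by (simp add: mult.commute)
    qed
    have y1s: "y1 \<le> Y a s"
    proof (rule ccontr)
      assume "\<not> ?thesis"
      then have "cos (2 * y1) \<le> cos (2 * Y a s)" using Ys0 y1 by (intro cos_monotone_0_pi_le) auto
      then have "cos (2 * y1) ^ m \<le> C a s" unfolding C_def
        using y0 y1 by (intro power_mono) (auto intro!: less_imp_le cos_gt_zero_pi)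
      then show False using Cs a by simp
    qed
    have "\<exists>r\<ge>0. r \<le> s \<and> Y a r = y0"
      by (rule IVT) (use y0 y1 y1s s cont in \<open>auto simp: init\<close>)
    then obtain r0 where r0: "0 \<le> r0" "r0 \<le> s" "Y a r0 = y0" by blast
    \<comment> \<open>In the tail J \<le> - a and Q / W \<le> \<pi>/2 - 2Y, so X falls at least a
      times as fast as G rises. From \<open>y0\<close> up to the turning point this costs at least
      (2 + \<Lambda>) a, more than X \<le> a and X \<ge> - \<Lambda> a allow.\<close>
    have "X a s + a * G (Y a s) \<le> X a r0 + a * G (Y a r0)"
    proof (rule deriv_nonpos_le[OF r0(2), of "\<lambda>r. X a r + a * G (Y a r)"])
      show "((\<lambda>r. X a r + a * G (Y a r)) has_real_derivative P a x + a * (1 / (pi / 2 - 2 * Y a x) * Q a x)) (at x)" for x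
        using Y_bound[of a x] by (intro DERIV_add X_deriv DERIV_cmult DERIV_chain2[OF Gd Y_deriv]) auto
      fix x assume "r0 \<le> x" "x \<le> s"
      then have x: "0 \<le> x" "x \<le> s" "r0 \<le> x" using r0 by auto
      have "Y a r0 \<le> Y a x" by (rule deriv_nonneg_le[OF x(3) Y_deriv]) (use Qn r0 x(2) in auto)
      then have "y0 \<le> Y a x" using r0(3) by simp
      then have "cos (2 * Y a x) \<le> cos (2 * y0)" using y0 Y_bound[of a x] by (intro cos_monotone_0_pi_le) auto
      then have J1: "J a x \<le> - a" using Jtail[OF x(1,2)] y0 by simp
      have p: "pi / 2 - 2 * Y a x > 0" using Y_bound[of a x] by auto
      have "cos (2 * Y a x) = sin (pi / 2 - 2 * Y a x)" by (simp add: cos_sin_eq)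
      also have "\<dots> \<le> pi / 2 - 2 * Y a x" using p by (intro sin_x_le_x) auto
      finally have "C a x \<le> pi / 2 - 2 * Y a x" using C_le_cos[of a x] by simp
      then have "W a x * C a x \<le> W a x * (pi / 2 - 2 * Y a x)" using W_pos[of a x] by (intro mult_left_mono) auto
      then have "Q a x \<le> W a x * (pi / 2 - 2 * Y a x)" using Q_le[of a x] by linarith
      then have "1 / (pi / 2 - 2 * Y a x) * Q a x \<le> W a x" using p by (simp add: pos_divide_le_eq)
      then have "a * (1 / (pi / 2 - 2 * Y a x) * Q a x) \<le> a * W a x" using a by (intro mult_left_mono) auto
      moreover have "P a x \<le> W a x * (- a)" unfolding P_eq using J1 W_pos[of a x] by (intro mult_left_mono) auto
      ultimately show "P a x + a * (1 / (pi / 2 - 2 * Y a x) * Q a x) \<le> 0" by (simp add: mult.commute)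
    qed
    moreover have "G y1 \<le> G (Y a s)"
    proof (rule DERIV_nonneg_imp_nondecreasing[OF y1s])
      fix x assume "y1 \<le> x" "x \<le> Y a s"
      then have "x < pi / 4" using Y_bound[of a s] by auto
      then show "\<exists>y. (G has_real_derivative y) (at x) \<and> 0 \<le> y" using Gd[of x] by (intro exI[of _ "1 / (pi / 2 - 2 * x)"]) auto
    qed
    then have "a * (G y1 - G y0) \<le> a * (G (Y a s) - G y0)" using a by (intro mult_left_mono) auto
    ultimately have "X a s \<le> a - a * (2 + \<Lambda>)" using Xu[OF r0(1,2)] r0(3) Gy by (simp add: algebra_simps)
    then show False using Xs a by (simp add: algebra_simps)
  qed
  then show ?thesis using a(1) by blast
qed

end

section \<open>Starting far away\<close>

lemma first_zero:
  fixes f :: "real \<Rightarrow> real"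
  assumes "\<And>x. isCont f x" "f 0 > 0" "0 \<le> t" "f t \<le> 0"
  obtains s where "0 < s" "s \<le> t" "f s = 0" "\<And>r. 0 \<le> r \<Longrightarrow> r < s \<Longrightarrow> f r > 0"
proof -
  define S where "S = {r. 0 \<le> r \<and> f r \<le> 0}"
  have "closed S" unfolding S_def using assms(1)
    by (intro closed_Collect_conj closed_Collect_le continuous_intros) (auto intro: continuous_at_imp_continuous_on)
  moreover have "S \<noteq> {}" "bdd_below S" using assms by (auto simp: S_def bdd_below_def)
  ultimately have i: "Inf S \<in> S" by (intro closed_contains_Inf)
  define s where "s = Inf S"
  have s: "0 \<le> s" "f s \<le> 0" using i by (auto simp: s_def S_def)
  have st: "s \<le> t" unfolding s_def by (rule cInf_lower) (use assms \<open>bdd_below S\<close> in \<open>auto simp: S_def\<close>)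
  have s0: "0 < s" using s assms(2) by (cases "s = 0") auto
  have lt: "f r > 0" if "0 \<le> r" "r < s" for r
    using cInf_lower[OF _ \<open>bdd_below S\<close>, of r] that by (force simp: s_def S_def)
  have "- f s \<le> 0"
    by (rule isCont_nonpos_from_left[where f = "\<lambda>x. - f x" and r = 0])
      (use lt s0 assms(1) in \<open>auto intro!: continuous_intros less_imp_le\<close>)
  then show ?thesis using that[OF s0 st _ lt] s by auto
qed

context profile
begin

lemma J_cont: "isCont (J a) t"
  using J_deriv DERIV_isCont by blast

lemma J_neck:
  assumes "Q a s = 0" "P a s < 0"
  shows "J a s = - C a s"
proof -
  have "(J a s)\<^sup>2 = (C a s)\<^sup>2" using Q_over_W[of a s] assms by simp
  moreover have "J a s < 0" using assms W_pos[of a s] by (simp add: J_def divide_neg_pos)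
  ultimately show ?thesis using C_pos[of a s] by (auto simp: power2_eq_iff)
qed

text \<open>After the turning point \<open>J + cc Y\<close> is nonincreasing.\<close>

lemma crosses_if_low_neck:
  assumes a: "a > 0" and s: "0 < s" "Q a s = 0" "\<And>r. 0 \<le> r \<Longrightarrow> r < s \<Longrightarrow> Q a r > 0"
    and Pneg: "\<And>r. 0 < r \<Longrightarrow> r \<le> s \<Longrightarrow> P a r < 0" and low: "cc * Y a s < C a s"
  shows "crosses a"
proof -
  have Ypos: "Y a r > 0" if "0 < r" "r \<le> s" for r
  proof -
    have "Y a 0 < Y a r" by (rule deriv_pos_less[OF that(1) Y_deriv]) (use s that in auto)
    then show ?thesis by (simp add: init)
  qed
  \<comment> \<open>The momentum starts at - C after the turn and can grow by at most cc times the
    height descended. With cc Y < C at the turn, J stays negative until the axis, so X cannot turn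
    first.\<close>
  have after: "P a t < 0" if "s < t" "\<And>r. s < r \<Longrightarrow> r < t \<Longrightarrow> Y a r > 0" "Y a t \<ge> 0" for t
  proof -
    have "J a t + cc * Y a t \<le> J a s + cc * Y a s"
    proof (rule deriv_nonpos_le[of _ _ "\<lambda>t. J a t + cc * Y a t"])
      show "((\<lambda>t. J a t + cc * Y a t) has_real_derivative cc * (1 - exp (2 * X a x)) * (Q a x)\<^sup>2 / W a x + cc * Q a x) (at x)" for x
        by (intro DERIV_add J_deriv DERIV_cmult Y_deriv)
      fix x assume x: "s \<le> x" "x \<le> t"
      have Qx: "Q a x \<le> 0"
        using Q_strict_decreasing[of s x a] that(2) s(2) x by (cases "x = s") auto
      have "- Q a x \<le> W a x"
        using Q_le[of a x] mult_left_le[OF C_le_1[of a x] less_imp_le[OF W_pos[of a x]]] by linarith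
      then have "- Q a x / W a x \<le> 1" using W_pos[of a x] by (subst pos_divide_le_eq) auto
      then have "(- Q a x) * (- Q a x / W a x) \<le> (- Q a x) * 1" using Qx by (intro mult_left_mono) auto
      then have q: "(Q a x)\<^sup>2 / W a x \<le> - Q a x" by (simp add: power2_eq_square)
      have "(1 - exp (2 * X a x)) * ((Q a x)\<^sup>2 / W a x) \<le> 1 * ((Q a x)\<^sup>2 / W a x)"
        using W_pos[of a x] by (intro mult_right_mono) auto
      also have "\<dots> \<le> - Q a x" using q by simp
      finally have "cc * ((1 - exp (2 * X a x)) * ((Q a x)\<^sup>2 / W a x)) \<le> cc * (- Q a x)" using cc3 by (intro mult_left_mono) auto
      then show "cc * (1 - exp (2 * X a x)) * (Q a x)\<^sup>2 / W a x + cc * Q a x \<le> 0" by simp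
    qed (use that in auto)
    moreover have "J a s = - C a s" using J_neck s(2) Pneg[of s] s(1) by auto
    moreover have "cc * Y a t \<ge> 0" using that(3) cc3 by simp
    ultimately have "J a t < 0" using low by linarith
    then show ?thesis unfolding P_eq using W_pos[of a t] by (simp add: mult_pos_neg)
  qed
  show ?thesis
  proof (rule first_exit[OF a])
    fix t assume t: "returns a t"
    then have "s < t" using Ypos[of t] by (cases "s < t") (auto simp: returns_def)
    then have "P a t < 0" using after[of t] t s by (auto simp: returns_def ascending_def)
    then show ?thesis using t by (auto simp: crosses_def)
  next
    fix t assume t: "0 < t" "P a t = 0" "Y a t > 0" "ascending a t"
    then have "s < t" using Pneg[of t] by (cases "s < t") auto
    then show ?thesis using after[of t] t s by (auto simp: ascending_def)
  next
    assume "\<And>t. 0 < t \<Longrightarrow> P a t < 0 \<and> 0 < Y a t"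
    then show ?thesis using forever_limit(1)[OF a, of s] s by auto
  qed
qed

text \<open>As long as X > 0, P' is negative; from time 1 on X would fall at a fixed positive rate,
  so it reaches 0.\<close>

lemma X_reaches_0:
  assumes "a > 0"
  obtains t where "t > 0" "X a t = 0" "\<And>r. 0 \<le> r \<Longrightarrow> r < t \<Longrightarrow> X a r > 0"
    "\<And>r. 0 < r \<Longrightarrow> r \<le> t \<Longrightarrow> P a r < 0"
proof -
  have P'n: "cc * (1 - exp (2 * X a x)) * (W a x)\<^sup>2 * (C a x)\<^sup>2 \<le> 0" if "X a x \<ge> 0" for x
    using that cc3 by (intro mult_nonpos_nonneg mult_nonneg_nonpos) auto
  have "\<exists>t\<ge>0. X a t \<le> 0"
  proof (rule ccontr)
    assume "\<not> ?thesis"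
    then have nn: "X a t > 0" if "t \<ge> 0" for t using that by force
    have P1: "P a 1 < 0" using P_neg_while_X_pos[of 1 a 1] nn by auto
    have Pdec: "P a x \<le> P a 1" if "1 \<le> x" for x
      by (rule deriv_nonpos_le[OF that P_deriv]) (use nn P'n that in \<open>auto simp: less_imp_le\<close>)
    define t where "t = 1 + X a 1 / (- P a 1)"
    have "X a 1 / (- P a 1) > 0" using nn[of 1] P1 by (intro divide_pos_pos) auto
    then have t1: "t \<ge> 1" unfolding t_def by linarith
    have "X a t + - P a 1 * t \<le> X a 1 + - P a 1 * 1"
      by (rule deriv_nonpos_le[OF t1, of "\<lambda>t. X a t + - P a 1 * t" "\<lambda>t. P a t + - P a 1"])
        (use Pdec in \<open>auto intro!: derivative_eq_intros X_deriv\<close>)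
    moreover have "- P a 1 * t = - P a 1 + X a 1" using P1 by (simp add: t_def field_simps)
    ultimately show False using nn[of t] t1 by simp
  qed
  then obtain t' where t': "t' \<ge> 0" "X a t' \<le> 0" by blast
  obtain t where t: "0 < t" "X a t = 0" "\<And>r. 0 \<le> r \<Longrightarrow> r < t \<Longrightarrow> X a r > 0"
    using first_zero[of "X a" t'] t' cont assms by (metis init(1))
  have Pn: "P a r < 0" if "0 < r" "r < t" for r
    using P_neg_while_X_pos[of r a r] t(3) that by auto
  have "P a t \<le> P a (t / 2)"
  proof (rule deriv_nonpos_le[OF _ P_deriv])
    fix x assume "t / 2 \<le> x" "x \<le> t"
    then have "X a x \<ge> 0" using t(2) t(3)[of x] t(1) by (cases "x = t") auto
    then show "cc * (1 - exp (2 * X a x)) * (W a x)\<^sup>2 * (C a x)\<^sup>2 \<le> 0" by (rule P'n)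
  qed (use t in auto)
  then have "P a t < 0" using Pn[of "t / 2"] t by auto
  then show ?thesis using that[OF t] Pn by (metis order_le_less)
qed

lemma w_le_exp: "x \<ge> 1 \<Longrightarrow> w x \<le> exp (- x)"
proof -
  assume x: "x \<ge> 1"
  have "1 + 2 * x + (2 * x)\<^sup>2 / 2 \<le> exp (2 * x)" using x by (intro exp_lower_Taylor_quadratic) auto
  then have "cc / 2 * (1 + 2 * x + (2 * x)\<^sup>2 / 2) \<le> cc / 2 * exp (2 * x)" using cc3 by (intro mult_left_mono) auto
  then have "cc * x - cc / 2 * exp (2 * x) \<le> - (cc / 2) - cc * (x * x)" by (simp add: power2_eq_square algebra_simps)
  also have "\<dots> \<le> - (1 * (x * 1))" 
  proof -
    have "1 * (x * 1) \<le> cc * (x * x)" using x cc3 by (intro mult_mono) auto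
    then show ?thesis using cc3 by linarith
  qed
  finally show ?thesis by (simp add: w_def)
qed

lemma w_tendsto: "((\<lambda>x. x * w x) \<longlongrightarrow> 0) at_top" "(w \<longlongrightarrow> 0) at_top"
proof -
  have 1: "((\<lambda>x::real. x ^ 1 / exp x) \<longlongrightarrow> 0) at_top" by (rule tendsto_power_div_exp_0)
  have ev: "\<forall>\<^sub>F x::real in at_top. 1 \<le> x" by (rule eventually_ge_at_top)
  show x: "((\<lambda>x. x * w x) \<longlongrightarrow> 0) at_top"
  proof (rule tendsto_sandwich[OF _ _ tendsto_const 1])
    show "\<forall>\<^sub>F x in at_top. 0 \<le> x * w x" using ev by eventually_elim (simp add: less_imp_le[OF w_pos])
    show "\<forall>\<^sub>F x in at_top. x * w x \<le> x ^ 1 / exp x" using ev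
    proof eventually_elim
      case (elim x)
      then have "x * w x \<le> x * exp (- x)" using w_le_exp by (intro mult_left_mono) auto
      then show ?case by (simp add: exp_minus field_simps)
    qed
  qed
  show "(w \<longlongrightarrow> 0) at_top"
  proof (rule tendsto_sandwich[OF _ _ tendsto_const x])
    show "\<forall>\<^sub>F x in at_top. 0 \<le> w x" by (simp add: less_imp_le[OF w_pos])
    show "\<forall>\<^sub>F x in at_top. w x \<le> x * w x" using ev
    proof eventually_elim
      case (elim x)
      then show ?case using mult_right_mono[OF elim less_imp_le[OF w_pos[of x]]] by simp
    qed
  qed
qed

lemma X_decreasing:
  assumes "\<And>r. 0 < r \<Longrightarrow> r \<le> t \<Longrightarrow> P a r < 0" "0 \<le> r" "r \<le> s" "s \<le> t"
  shows "X a s \<le> X a r"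
proof (rule deriv_nonpos_le[OF assms(3) X_deriv])
  fix x assume "r \<le> x" "x \<le> s"
  then have "x = 0 \<or> 0 < x \<and> x \<le> t" using assms by auto
  then show "P a x \<le> 0" using assms(1)[of x] by (auto simp: init less_imp_le)
qed

text \<open>Until J reaches - \<open>kap\<close> / 2, vertical motion dominates: J loses at least k
  \<open>kap\<close> / 2 per unit of height, so Y \<le> 1 / k. Afterwards P \<le> -
  (\<open>kap\<close> / 2) W, and the further rise is paid for by the decrease of 1 / W where X
  \<ge> \<open>x1\<close> and of X where X < \<open>x1\<close>.\<close>

lemma ascent_height:
  assumes h: "0 < h" "h \<le> pi / 8" and x1: "0 < x1" "k = cc * (exp (2 * x1) - 1)" "1 / k + 2 / (kap * k) < h / 2"
    and a: "0 < a" "w a < kap * w x1 / 2" "w a * (2 / (kap * w x1)) * a < h / 2"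
    and \<tau>: "0 \<le> \<tau>" "\<And>r. 0 \<le> r \<Longrightarrow> r < \<tau> \<Longrightarrow> Q a r > 0" "\<And>r. 0 \<le> r \<Longrightarrow> r \<le> \<tau> \<Longrightarrow> X a r \<ge> 0"
      "\<And>r. 0 < r \<Longrightarrow> r \<le> \<tau> \<Longrightarrow> P a r < 0"
  shows "Y a \<tau> \<le> h"
proof (rule ccontr)
  assume "\<not> ?thesis"
  then have Yt: "Y a \<tau> > h" by simp
  have k: "k > 0" using x1 cc3 by simp
  have "\<exists>r\<ge>0. r \<le> \<tau> \<and> Y a r = h" by (rule IVT) (use Yt h \<tau> cont in \<open>auto simp: init\<close>)
  then obtain \<rho> where \<rho>: "0 \<le> \<rho>" "\<rho> \<le> \<tau>" "Y a \<rho> = h" by blast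
  then have \<rho>t: "\<rho> < \<tau>" using Yt by (cases "\<rho> = \<tau>") auto
  have Qp: "Q a r > 0" if "0 \<le> r" "r \<le> \<rho>" for r using \<tau>(2)[of r] that \<rho>t by auto
  have Yi: "Y a r \<le> Y a r'" if "0 \<le> r" "r \<le> r'" "r' \<le> \<rho>" for r r'
    by (rule deriv_nonneg_le[OF that(2) Y_deriv]) (use Qp that in \<open>auto simp: less_imp_le\<close>)
  have Yp: "Y a r > 0" if "0 < r" "r \<le> \<rho>" for r
    using Y_pos_while_Q_pos[of \<rho> a r] Qp that by auto
  have Qw: "Q a r \<le> w a" if "0 \<le> r" "r \<le> \<rho>" for r
    using Q_strict_decreasing[of 0 r a] Yp that by (cases "r = 0") (auto simp: init less_imp_le)
  have Ck: "C a r \<ge> kap" if "0 \<le> r" "r \<le> \<rho>" for r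
    using Yi[of 0 r] Yi[of r \<rho>] that \<rho> h by (intro C_ge_kap) (auto simp: init)
  have Xa: "X a r \<le> a" if "0 \<le> r" "r \<le> \<rho>" for r
    using X_decreasing[of \<tau> a 0 r] \<tau>(4) that \<rho> by (auto simp: init)
  have X0: "X a r \<ge> 0" if "0 \<le> r" "r \<le> \<rho>" for r using \<tau>(3)[of r] that \<rho> by auto
  have Jd: "J a r' \<le> J a r" if "0 \<le> r" "r \<le> r'" "r' \<le> \<rho>" for r r'
  proof (rule deriv_nonpos_le[OF that(2) J_deriv])
    fix x assume "r \<le> x" "x \<le> r'"
    then have "X a x \<ge> 0" using X0 that by auto
    then show "cc * (1 - exp (2 * X a x)) * (Q a x)\<^sup>2 / W a x \<le> 0"
      using cc3 W_pos[of a x] by (intro divide_nonpos_pos mult_nonpos_nonneg mult_nonneg_nonpos) auto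
  qed
  have Jn: "J a r \<le> 0" if "0 \<le> r" "r \<le> \<rho>" for r using Jd[of 0 r] that by (auto simp: init)
  have QWk: "Q a r / W a r \<ge> kap / 2" if r: "0 \<le> r" "r \<le> \<rho>" and J: "J a r \<ge> - (kap / 2)" for r
  proof -
    have "(- J a r)\<^sup>2 \<le> (kap / 2)\<^sup>2" using Jn[OF r] J by (intro power_mono) auto
    moreover have "kap\<^sup>2 \<le> (C a r)\<^sup>2" using Ck[OF r] kap_pos by (intro power_mono) auto
    moreover have "(kap / 2)\<^sup>2 = kap\<^sup>2 / 4" by (simp add: power_divide)
    ultimately have "(kap / 2)\<^sup>2 \<le> (Q a r / W a r)\<^sup>2"
      using Q_over_W[of a r] zero_le_power2[of kap] unfolding power2_minus by linarith
    then show ?thesis by (rule power2_le_imp_le) (use Qp[OF r] W_pos[of a r] in \<open>auto simp: less_imp_le\<close>)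
  qed
  \<comment> \<open>In the first phase Q \<ge> (\<open>kap\<close> / 2) W, but Q \<le>
    \<open>w a\<close> is tiny. So W is tiny, which keeps X large.\<close>
  have Xx1: "X a r \<ge> x1" if r: "0 \<le> r" "r \<le> \<rho>" and J: "J a r \<ge> - (kap / 2)" for r
  proof (rule ccontr)
    assume "\<not> ?thesis"
    then have "w x1 \<le> W a r" unfolding W_def using X0[OF r] by (intro w_mono_pos) auto
    then have "kap / 2 * w x1 \<le> kap / 2 * W a r" using kap_pos by (intro mult_left_mono) auto
    also have "\<dots> \<le> Q a r" using QWk[OF r J] W_pos[of a r] by (simp add: field_simps)
    finally show False using Qw[OF r] a by simp
  qed
  have Yk: "Y a r \<le> 1 / k" if r: "0 \<le> r" "r \<le> \<rho>" and J: "J a r \<ge> - (kap / 2)" for r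
  proof -
    have "J a r + k * (kap / 2) * Y a r \<le> J a 0 + k * (kap / 2) * Y a 0"
    proof (rule deriv_nonpos_le[OF r(1), of "\<lambda>r. J a r + k * (kap / 2) * Y a r"])
      show "((\<lambda>r. J a r + k * (kap / 2) * Y a r) has_real_derivative
          cc * (1 - exp (2 * X a x)) * (Q a x)\<^sup>2 / W a x + k * (kap / 2) * Q a x) (at x)" for x
        by (intro DERIV_add J_deriv DERIV_cmult Y_deriv)
      fix x assume x0: "0 \<le> x" "x \<le> r"
      then have x: "0 \<le> x" "x \<le> \<rho>" using r by auto
      have Jx: "J a x \<ge> - (kap / 2)" using Jd[of x r] x0 r J by auto
      have "k \<le> cc * (exp (2 * X a x) - 1)" unfolding x1(2) using Xx1[OF x Jx] cc3 by (intro mult_left_mono) auto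
      then have "k * (kap / 2) \<le> cc * (exp (2 * X a x) - 1) * (Q a x / W a x)"
        using QWk[OF x Jx] k kap_pos by (intro mult_mono) auto
      then have "k * (kap / 2) * Q a x \<le> cc * (exp (2 * X a x) - 1) * (Q a x / W a x) * Q a x"
        using Qp[OF x] by (intro mult_right_mono) auto
      then show "cc * (1 - exp (2 * X a x)) * (Q a x)\<^sup>2 / W a x + k * (kap / 2) * Q a x \<le> 0"
        by (simp add: power2_eq_square algebra_simps diff_divide_distrib)
    qed
    then have "k * (kap / 2) * Y a r \<le> kap / 2" using J by (simp add: init)
    then show ?thesis using k kap_pos by (simp add: field_simps)
  qed
  have k1: "1 / k > 0" "2 / (kap * k) > 0" using k kap_pos by auto
  have "J a \<rho> < - (kap / 2)"
  proof (rule ccontr)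
    assume "\<not> ?thesis"
    then show False using Yk[of \<rho>] \<rho> k1 x1(3) h by auto
  qed
  then have "\<exists>r\<ge>0. r \<le> \<rho> \<and> J a r = - (kap / 2)"
    by (intro IVT2) (use kap_pos \<rho> J_cont in \<open>auto simp: init\<close>)
  then obtain r where r: "0 \<le> r" "r \<le> \<rho>" "J a r = - (kap / 2)" by blast
  \<comment> \<open>A and B are the exchange rates of the second phase: A times the rate of decrease
    of 1 / W for X \<ge> \<open>x1\<close>, and B times that of X for X < \<open>x1\<close>, are
    each at least \<open>w a\<close> \<ge> Q. The sum Y + A / W + B X is thus nonincreasing.\<close>
  define A where "A = w a * (2 / (kap * k))"
  define B where "B = w a * (2 / (kap * w x1))"
  have AB: "A > 0" "B > 0" using w_pos kap_pos k by (auto simp: A_def B_def)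
  have "Y a \<rho> + A * (1 / W a \<rho>) + B * X a \<rho> \<le> Y a r + A * (1 / W a r) + B * X a r"
  proof (rule deriv_nonpos_le[OF r(2), of "\<lambda>x. Y a x + A * (1 / W a x) + B * X a x"])
    have "((\<lambda>x. 1 / W a x) has_real_derivative cc * (exp (2 * X a x) - 1) * (P a x / W a x)) (at x)" for x
      by (rule DERIV_cong[OF DERIV_divide[OF DERIV_const W_deriv]]) (use W_pos[of a x] in \<open>auto simp: field_simps\<close>)
    then show "((\<lambda>x. Y a x + A * (1 / W a x) + B * X a x) has_real_derivative
       Q a x + A * (cc * (exp (2 * X a x) - 1) * (P a x / W a x)) + B * P a x) (at x)" for x
      by (intro DERIV_add DERIV_cmult Y_deriv X_deriv)
    fix x assume x0: "r \<le> x" "x \<le> \<rho>"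
    then have x: "0 \<le> x" "x \<le> \<rho>" using r by auto
    have Jx: "J a x \<le> - (kap / 2)" using Jd[of r x] x0 r by auto
    have PW: "P a x / W a x = J a x" by (simp add: J_def)
    have e0: "exp (2 * X a x) - 1 \<ge> 0" using X0[OF x] by simp
    have P0: "P a x \<le> 0" unfolding P_eq using Jx kap_pos W_pos[of a x] by (simp add: mult_nonneg_nonpos)
    have n1: "A * (cc * (exp (2 * X a x) - 1) * (P a x / W a x)) \<le> 0" unfolding PW
      using AB cc3 e0 Jx kap_pos by (intro mult_nonneg_nonpos mult_nonneg_nonneg) auto
    have n2: "B * P a x \<le> 0" using AB P0 by (simp add: mult_nonneg_nonpos)
    show "Q a x + A * (cc * (exp (2 * X a x) - 1) * (P a x / W a x)) + B * P a x \<le> 0"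
    proof (cases "X a x \<ge> x1")
      case True
      have "k \<le> cc * (exp (2 * X a x) - 1)" unfolding x1(2) using True cc3 by (intro mult_left_mono) auto
      then have "k * (kap / 2) \<le> cc * (exp (2 * X a x) - 1) * (- J a x)" using Jx k kap_pos by (intro mult_mono) auto
      then have "A * (k * (kap / 2)) \<le> A * (cc * (exp (2 * X a x) - 1) * (- J a x))" using AB by (intro mult_left_mono) auto
      moreover have "A * (k * (kap / 2)) = w a" using k kap_pos by (simp add: A_def)
      moreover have "A * (cc * (exp (2 * X a x) - 1) * (- J a x)) = - (A * (cc * (exp (2 * X a x) - 1) * J a x))"
        by (simp only: mult_minus_right)
      ultimately have "A * (cc * (exp (2 * X a x) - 1) * (P a x / W a x)) \<le> - w a" unfolding PW by linarith
      then show ?thesis using n2 Qw[OF x] by linarith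
    next
      case False
      then have "w x1 \<le> W a x" unfolding W_def using X0[OF x] by (intro w_mono_pos) auto
      then have "w x1 * (kap / 2) \<le> W a x * (- J a x)" using Jx w_pos[of x1] kap_pos W_pos[of a x] by (intro mult_mono) auto
      then have "B * (w x1 * (kap / 2)) \<le> B * (W a x * (- J a x))" using AB by (intro mult_left_mono) auto
      moreover have "B * (w x1 * (kap / 2)) = w a" using w_pos[of x1] kap_pos by (simp add: B_def)
      moreover have "B * (W a x * (- J a x)) = - (B * P a x)" by (simp only: P_eq mult_minus_right)
      ultimately have "B * P a x \<le> - w a" by linarith
      then show ?thesis using n1 Qw[OF x] by linarith
    qed
  qed
  moreover have "A * (1 / W a \<rho>) \<ge> 0" "B * X a \<rho> \<ge> 0" using AB W_pos[of a \<rho>] X0[of \<rho>] \<rho> by auto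
  moreover have "Y a r \<le> 1 / k" using Yk[of r] r by auto
  moreover have "A * (1 / W a r) \<le> 2 / (kap * k)"
  proof -
    have "w a \<le> W a r" unfolding W_def using X0[OF r(1,2)] Xa[OF r(1,2)] by (intro w_mono_pos) auto
    then have "w a * (1 / W a r) \<le> 1" using W_pos[of a r] by simp
    then have "2 / (kap * k) * (w a * (1 / W a r)) \<le> 2 / (kap * k) * 1" using k1 by (intro mult_left_mono) auto
    moreover have "A * (1 / W a r) = 2 / (kap * k) * (w a * (1 / W a r))" by (simp add: A_def)
    ultimately show ?thesis by linarith
  qed
  moreover have "B * X a r \<le> B * a" using AB Xa[OF r(1,2)] by (intro mult_left_mono) auto
  ultimately have "h \<le> 1 / k + 2 / (kap * k) + B * a" using \<rho>(3) by linarith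
  then show False using x1(3) a(3) by (simp add: B_def)
qed

text \<open>If \<open>Y\<close> were still increasing at \<open>X = 0\<close>, comparing \<open>Q'\<close> with \<open>P'\<close> for \<open>X \<le> xb\<close> would bound \<open>Y\<close> by a
  multiple of \<open>w a\<close>, while the long time spent at \<open>X \<ge> x2\<close> makes \<open>Y\<close> a larger multiple of \<open>w a\<close>.\<close>

lemma crosses_large: "\<exists>a>0. crosses a"
proof -
  \<comment> \<open>At y = 0 the difference cos (2y)^m - cc y equals 1. It therefore stays positive
    up to some height h, which is the condition of \<open>crosses_if_low_neck\<close>.\<close>
  have "isCont (\<lambda>y. cos (2 * y) ^ m - cc * y) 0" by (intro continuous_intros)
  then obtain d where d: "d > 0" "\<And>y. \<bar>y\<bar> < d \<Longrightarrow> \<bar>(cos (2 * y) ^ m - cc * y) - 1\<bar> < 1"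
    unfolding continuous_at_eps_delta dist_real_def by (metis cos_zero diff_zero mult_zero_right power_one zero_less_one)
  define h where "h = min (d / 2) (pi / 8)"
  have h: "0 < h" "h \<le> pi / 8" "\<And>y. 0 \<le> y \<Longrightarrow> y \<le> h \<Longrightarrow> cc * y < cos (2 * y) ^ m"
  proof -
    fix y assume "0 \<le> y" "y \<le> h"
    then have "\<bar>y\<bar> < d" using d(1) by (auto simp: h_def)
    from d(2)[OF this] show "cc * y < cos (2 * y) ^ m" by linarith
  qed (use d in \<open>auto simp: h_def\<close>)
  \<comment> \<open>Chosen so that k = cc \<open>K0\<close> and (1 + 2 / \<open>kap\<close>) / k = h
    / cc, which is below h / 2 because cc \<ge> 3.\<close>
  define K0 where "K0 = (1 + 2 / kap) / h"
  have K0: "K0 > 0" using h kap_pos by (simp add: K0_def add_pos_pos)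
  define x1 where "x1 = ln (1 + K0) / 2"
  define k where "k = cc * (exp (2 * x1) - 1)"
  have x1: "0 < x1" "k = cc * K0" using K0 by (simp_all add: x1_def k_def)
  have kk: "1 / k + 2 / (kap * k) < h / 2"
  proof -
    have "1 / k + 2 / (kap * k) = (1 + 2 / kap) / k" using kap_pos by (simp add: add_divide_distrib)
    also have "\<dots> = h / cc" 
    proof -
      have "1 + 2 / kap > 0" using kap_pos by (simp add: add_pos_pos)
      then show ?thesis unfolding x1(2) K0_def using h cc3 by simp
    qed
    also have "\<dots> < h / 2" using h cc3 by (intro divide_strict_left_mono) auto
    finally show ?thesis .
  qed
  have ev: "\<forall>\<^sub>F x in at_top. w x < \<epsilon>" if "\<epsilon> > 0" for \<epsilon>
    by (rule order_tendstoD(2)[OF w_tendsto(2) that])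
  have w0: "kap * w 0 / 4 > 0" using kap_pos w_pos by simp
  \<comment> \<open>At X = \<open>xb\<close> this gives |P| < \<open>kap\<close> \<open>w 0\<close>
    / 4, whereas |P| \<ge> \<open>kap\<close> \<open>w 0\<close> / 2 when X = 0. The comparison of Q
    with P exploits this gain.\<close>
  obtain xb where xb: "xb > 0" "w xb < kap * w 0 / 4"
    using eventually_happens'[OF _ eventually_conj[OF ev[OF w0] eventually_gt_at_top[of 0]]] by auto
  define b1 where "b1 = exp (2 * xb) - 1"
  have b1: "b1 > 0" using xb by (simp add: b1_def)
  \<comment> \<open>The constant in the bound \<sigma> \<le> \<open>k2\<close> \<open>w a\<close> to
    come. It does not depend on \<open>a\<close>, which is chosen after it.\<close>
  define k2 where "k2 = 2 * cc * b1 / (m * kap * w 0)"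
  have k2: "k2 > 0" using b1 cc3 m1 kap_pos w_pos by (simp add: k2_def)
  \<comment> \<open>Beyond \<open>x2\<close> the factor exp (2X) - 1 is so large that the
    coefficient p below is at most \<open>w a\<close> / 2.\<close>
  define x2 where "x2 = xb + ln (1 + 8 * m * k2 / cc) / 2"
  have x2: "x2 \<ge> xb" "8 * m * k2 \<le> cc * (exp (2 * x2) - 1)"
  proof -
    have p: "8 * m * k2 / cc \<ge> 0" using k2 cc3 by simp
    then show "x2 \<ge> xb" by (simp add: x2_def)
    have "exp (2 * x2) = exp (2 * xb) * (1 + 8 * m * k2 / cc)"
      using p by (simp add: x2_def exp_add distrib_left)
    also have "\<dots> \<ge> 1 * (1 + 8 * m * k2 / cc)" using p xb by (intro mult_right_mono) auto
    finally have "8 * m * k2 / cc \<le> exp (2 * x2) - 1" by simp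
    then show "8 * m * k2 \<le> cc * (exp (2 * x2) - 1)" using cc3 by (simp add: field_simps)
  qed
  have e3: "\<forall>\<^sub>F a in at_top. w a * (2 / (kap * w x1)) * a < h / 2"
  proof -
    have "((\<lambda>a. 2 / (kap * w x1) * (a * w a)) \<longlongrightarrow> 2 / (kap * w x1) * 0) at_top"
      by (intro tendsto_intros w_tendsto)
    then have "\<forall>\<^sub>F a in at_top. 2 / (kap * w x1) * (a * w a) < h / 2"
      by (rule order_tendstoD(2)) (use h in simp)
    then show ?thesis by (simp add: mult_ac)
  qed
  have e1: "kap * w x1 / 2 > 0" "kap * w 0 / 2 > 0" using kap_pos w_pos by auto
  obtain a where a: "w a < kap * w x1 / 2" "w a < kap * w 0 / 2" "w a * (2 / (kap * w x1)) * a < h / 2" "a > x2 + 2 * k2"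
    using eventually_happens'[OF _ eventually_conj[OF ev[OF e1(1)] eventually_conj[OF ev[OF e1(2)]
      eventually_conj[OF e3 eventually_gt_at_top[of "x2 + 2 * k2"]]]]] by auto
  have a0: "a > 0" using a(4) x2 xb k2 by linarith
  obtain t where t: "t > 0" "X a t = 0" "\<And>r. 0 \<le> r \<Longrightarrow> r < t \<Longrightarrow> X a r > 0" "\<And>r. 0 < r \<Longrightarrow> r \<le> t \<Longrightarrow> P a r < 0"
    using X_reaches_0[OF a0] by blast
  have X0: "X a r \<ge> 0" if "0 \<le> r" "r \<le> t" for r using t(2) t(3)[of r] that by (cases "r = t") auto
  have height: "Y a \<tau> \<le> h" if "0 \<le> \<tau>" "\<tau> \<le> t" "\<And>r. 0 \<le> r \<Longrightarrow> r < \<tau> \<Longrightarrow> Q a r > 0" for \<tau>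
    by (rule ascent_height[OF h(1,2) x1(1) k_def kk a0 a(1,3) that(1,3)]) (use X0 t(4) that in auto)
  have "\<exists>s\<ge>0. s \<le> t \<and> Q a s \<le> 0"
  proof (rule ccontr)
    assume "\<not> ?thesis"
    then have Qp: "Q a r > 0" if "0 \<le> r" "r \<le> t" for r using that by force
    have Yi: "Y a r \<le> Y a r'" if "0 \<le> r" "r \<le> r'" "r' \<le> t" for r r'
      by (rule deriv_nonneg_le[OF that(2) Y_deriv]) (use Qp that in \<open>auto simp: less_imp_le\<close>)
    have Yh: "0 \<le> Y a r" "Y a r \<le> pi / 8" if "0 \<le> r" "r \<le> t" for r
      using Yi[of 0 r] Yi[of r t] that height[of t] Qp t(1) h(2) by (auto simp: init)
    have Yp: "Y a r > 0" if "0 < r" "r \<le> t" for r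
      using Y_pos_while_Q_pos[of t a r] Qp that by auto
    have Qw: "Q a r \<le> w a" if "0 \<le> r" "r \<le> t" for r
      using Q_strict_decreasing[of 0 r a] Yp that by (cases "r = 0") (auto simp: init less_imp_le)
    have si: "sin (2 * Y a r) \<le> sin (2 * Y a r')" if "0 \<le> r" "r \<le> r'" "r' \<le> t" for r r'
      using Yi[OF that] Yh[of r] Yh[of r'] that by (intro sin_monotone_2pi_le) auto
    have chalf: "cos (2 * Y a r) \<ge> 1 / 2" if "0 \<le> r" "r \<le> t" for r
    proof -
      have "cos (pi / 3) \<le> cos (2 * Y a r)" using Yh[OF that] by (intro cos_monotone_0_pi_le) auto
      then show ?thesis by (simp add: cos_60)
    qed
    have Xd: "X a s \<le> X a r" if "0 \<le> r" "r \<le> s" "s \<le> t" for r s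
      by (rule X_decreasing[OF t(4) that]) auto
    have "\<exists>s\<ge>0. s \<le> t \<and> X a s = xb"
      by (rule IVT2) (use t xb x2 k2 a(4) cont in \<open>auto simp: init\<close>)
    then obtain s1 where s1: "0 \<le> s1" "s1 \<le> t" "X a s1 = xb" by blast
    have "\<exists>s\<ge>0. s \<le> s1 \<and> X a s = x2"
      by (rule IVT2) (use s1 xb x2 k2 a(4) cont in \<open>auto simp: init\<close>)
    then obtain s2 where s2: "0 \<le> s2" "s2 \<le> s1" "X a s2 = x2" by blast
    define \<sigma> where "\<sigma> = sin (2 * Y a s1)"
    have \<sigma>0: "\<sigma> \<ge> 0" unfolding \<sigma>_def using Yh[OF s1(1,2)] by (intro sin_ge_zero) auto
    \<comment> \<open>For X \<le> \<open>xb\<close> one has Q' \<le> - 2 m \<sigma> W^2 C^2 and P'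
      \<ge> - cc b1 W^2 C^2, so Q - q P is nonincreasing. The gain of |P| between \<open>s1\<close>
      and \<open>t\<close> must then be paid from Q \<le> \<open>w a\<close>.\<close>
    define q where "q = 2 * m * \<sigma> / (cc * b1)"
    have q0: "q \<ge> 0" using \<sigma>0 cc3 b1 by (simp add: q_def)
    have "Q a t - q * P a t \<le> Q a s1 - q * P a s1"
    proof (rule deriv_nonpos_le[OF s1(2), of "\<lambda>t. Q a t - q * P a t"])
      show "((\<lambda>t. Q a t - q * P a t) has_real_derivative
         - (2 * real m) * sin (2 * Y a x) * (C a x * cos (2 * Y a x) ^ (m - 1)) * (W a x)\<^sup>2
         - q * (cc * (1 - exp (2 * X a x)) * (W a x)\<^sup>2 * (C a x)\<^sup>2)) (at x)" for x
        by (intro DERIV_diff Q_deriv2 DERIV_cmult P_deriv)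
      fix x assume x: "s1 \<le> x" "x \<le> t"
      have c1: "C a x \<le> cos (2 * Y a x) ^ (m - 1)"
        unfolding C_def using cos_pos[of a x] by (intro power_decreasing) auto
      have sx: "\<sigma> \<le> sin (2 * Y a x)" unfolding \<sigma>_def using si[of s1 x] s1 x by auto
      have ex: "exp (2 * X a x) - 1 \<le> b1" using Xd[of s1 x] s1 x by (simp add: b1_def)
      have "q * (cc * (exp (2 * X a x) - 1) * (W a x)\<^sup>2 * (C a x)\<^sup>2) \<le> q * (cc * b1 * (W a x)\<^sup>2 * (C a x)\<^sup>2)"
        using q0 cc3 ex by (intro mult_left_mono mult_right_mono) auto
      also have "\<dots> = 2 * real m * \<sigma> * (C a x * C a x) * (W a x)\<^sup>2" using cc3 b1 by (simp add: q_def power2_eq_square)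
      also have "\<dots> \<le> 2 * real m * sin (2 * Y a x) * (C a x * cos (2 * Y a x) ^ (m - 1)) * (W a x)\<^sup>2"
        using sx c1 \<sigma>0 C_pos[of a x] by (intro mult_mono mult_left_mono) auto
      finally show "- (2 * real m) * sin (2 * Y a x) * (C a x * cos (2 * Y a x) ^ (m - 1)) * (W a x)\<^sup>2
         - q * (cc * (1 - exp (2 * X a x)) * (W a x)\<^sup>2 * (C a x)\<^sup>2) \<le> 0" by (simp add: algebra_simps)
    qed
    moreover have "P a s1 \<ge> - (kap * w 0 / 4)"
      using P_le[of a s1] mult_left_le[OF C_le_1[of a s1] less_imp_le[OF W_pos[of a s1]]] xb(2)
      unfolding W_def s1(3) by linarith
    moreover have "P a t \<le> - (kap * w 0 / 2)"
    proof -
      have "(P a t)\<^sup>2 = (w 0)\<^sup>2 * (C a t)\<^sup>2 - (Q a t)\<^sup>2" using energy[of a t] t(2) by (simp add: W_def)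
      moreover have "(Q a t)\<^sup>2 \<le> (kap * w 0 / 2)\<^sup>2"
        using Qw[of t] Qp[of t] t(1) a(2) by (intro power_mono) auto
      moreover have "(kap * w 0)\<^sup>2 \<le> (w 0 * C a t)\<^sup>2"
        using C_ge_kap[of a t] Yh[of t] t(1) kap_pos w_pos[of 0]
        by (intro power_mono) (auto simp: mult.commute[of kap] intro!: mult_left_mono less_imp_le[OF mult_pos_pos])
      moreover have "(kap * w 0 / 2)\<^sup>2 = (kap * w 0)\<^sup>2 / 4" by (simp add: power_divide)
      ultimately have "(kap * w 0 / 2)\<^sup>2 \<le> (- P a t)\<^sup>2"
        using zero_le_power2[of "kap * w 0"] unfolding power2_minus power_mult_distrib[of "w 0" "C a t"] by linarith
      then have "kap * w 0 / 2 \<le> - P a t"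
        by (rule power2_le_imp_le) (use t(4)[of t] t(1) in auto)
      then show ?thesis by simp
    qed
    then have "q * P a t \<le> q * (- (kap * w 0 / 2))" using q0 by (intro mult_left_mono)
    moreover have "q * P a s1 \<ge> q * (- (kap * w 0 / 4))" using q0 calculation(2) by (intro mult_left_mono)
    ultimately have "q * (kap * w 0 / 4) \<le> Q a s1" using Qp[of t] t(1) by (simp add: algebra_simps)
    also have "\<dots> \<le> w a" using Qw s1 by auto
    finally have "q * (kap * w 0 / 4) \<le> w a" .
    then have \<sigma>k: "\<sigma> \<le> k2 * w a"
      using m1 kap_pos w_pos[of 0] cc3 b1 by (simp add: q_def k2_def field_simps)
    define b2 where "b2 = exp (2 * x2) - 1"
    have b2: "b2 > 0" using xb x2 by (simp add: b2_def)
    \<comment> \<open>The reverse comparison on X \<ge> \<open>x2\<close>: sin (2Y) \<le> \<sigma>,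
      and cos (2Y) \<ge> 1/2 bounds cos^(m-1) by 2 C, which doubles the coefficient to 4 m \<sigma>.
      Now Q - p P is nondecreasing and Q loses at most half of \<open>w a\<close>.\<close>
    define p where "p = 4 * m * \<sigma> / (cc * b2)"
    have p0: "p \<ge> 0" using \<sigma>0 cc3 b2 by (simp add: p_def)
    have Qlow: "Q a r \<ge> w a / 2" if r: "0 \<le> r" "r \<le> s2" for r
    proof -
      have "Q a 0 - p * P a 0 \<le> Q a r - p * P a r"
      proof (rule deriv_nonneg_le[OF r(1), of "\<lambda>t. Q a t - p * P a t"])
        show "((\<lambda>t. Q a t - p * P a t) has_real_derivative
           - (2 * real m) * sin (2 * Y a x) * (C a x * cos (2 * Y a x) ^ (m - 1)) * (W a x)\<^sup>2
           - p * (cc * (1 - exp (2 * X a x)) * (W a x)\<^sup>2 * (C a x)\<^sup>2)) (at x)" for x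
          by (intro DERIV_diff Q_deriv2 DERIV_cmult P_deriv)
        fix x assume x0: "0 \<le> x" "x \<le> r"
        then have x: "0 \<le> x" "x \<le> t" "x \<le> s2" "x \<le> s1" using r s2 s1 by auto
        have c1: "cos (2 * Y a x) ^ (m - 1) \<le> 2 * C a x"
        proof -
          have "C a x = cos (2 * Y a x) * cos (2 * Y a x) ^ (m - 1)"
            unfolding C_def using m1 by (simp add: power_eq_if)
          moreover have "1 / 2 * cos (2 * Y a x) ^ (m - 1) \<le> cos (2 * Y a x) * cos (2 * Y a x) ^ (m - 1)"
            using chalf[OF x(1,2)] cos_pos[of a x] by (intro mult_right_mono) auto
          ultimately show ?thesis by simp
        qed
        have sx: "sin (2 * Y a x) \<le> \<sigma>" unfolding \<sigma>_def using si[of x s1] s1 x by auto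
        have s0: "0 \<le> sin (2 * Y a x)" using Yh[OF x(1,2)] by (intro sin_ge_zero) auto
        have ex: "b2 \<le> exp (2 * X a x) - 1" using Xd[of x s2] s2 s1 x by (simp add: b2_def)
        have "2 * real m * sin (2 * Y a x) * (C a x * cos (2 * Y a x) ^ (m - 1)) * (W a x)\<^sup>2
          \<le> 2 * real m * \<sigma> * (C a x * (2 * C a x)) * (W a x)\<^sup>2"
          using sx c1 s0 \<sigma>0 C_pos[of a x] cos_pos[of a x] by (intro mult_right_mono mult_mono mult_nonneg_nonneg) auto
        also have "\<dots> = p * (cc * b2 * (W a x)\<^sup>2 * (C a x)\<^sup>2)" using cc3 b2 by (simp add: p_def power2_eq_square)
        also have "\<dots> \<le> p * (cc * (exp (2 * X a x) - 1) * (W a x)\<^sup>2 * (C a x)\<^sup>2)"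
          using p0 cc3 ex by (intro mult_left_mono mult_right_mono) auto
        finally show "0 \<le> - (2 * real m) * sin (2 * Y a x) * (C a x * cos (2 * Y a x) ^ (m - 1)) * (W a x)\<^sup>2
           - p * (cc * (1 - exp (2 * X a x)) * (W a x)\<^sup>2 * (C a x)\<^sup>2)" by (simp add: algebra_simps)
      qed
      then have 1: "w a + p * P a r \<le> Q a r" by (simp add: init)
      have "- 1 \<le> P a r"
        using P_le[of a r] mult_left_le[OF C_le_1[of a r] less_imp_le[OF W_pos[of a r]]] W_le_1[of a r] by linarith
      then have 2: "p * (- 1) \<le> p * P a r" using p0 by (intro mult_left_mono)
      have "p * (cc * b2) = 4 * m * \<sigma>" using cc3 b2 by (simp add: p_def)
      also have "\<dots> \<le> 4 * m * (k2 * w a)" using \<sigma>k by (intro mult_left_mono) auto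
      also have "\<dots> = 8 * m * k2 * (w a / 2)" by simp
      also have "\<dots> \<le> cc * b2 * (w a / 2)" using x2(2) w_pos[of a] unfolding b2_def by (intro mult_right_mono) auto
      finally have "(cc * b2) * p \<le> (cc * b2) * (w a / 2)" by (simp add: mult.commute)
      then have "p \<le> w a / 2" by (rule mult_left_le_imp_le) (use cc3 b2 in simp)
      then show ?thesis using 1 2 by linarith
    qed
    have "sin (2 * Y a 0) - w a / 2 * 0 \<le> sin (2 * Y a s2) - w a / 2 * s2"
    proof (rule deriv_nonneg_le[OF s2(1), of "\<lambda>r. sin (2 * Y a r) - w a / 2 * r"])
      show "((\<lambda>r. sin (2 * Y a r) - w a / 2 * r) has_real_derivative 2 * cos (2 * Y a x) * Q a x - w a / 2) (at x)" for x
        using Y_deriv[of a x] by (auto intro!: derivative_eq_intros)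
      fix x assume x: "0 \<le> x" "x \<le> s2"
      have "1 * (w a / 2) \<le> (2 * cos (2 * Y a x)) * Q a x"
        using Qlow[OF x] chalf[of x] x s2 s1 w_pos[of a] by (intro mult_mono) auto
      then show "0 \<le> 2 * cos (2 * Y a x) * Q a x - w a / 2" by simp
    qed
    then have 1: "w a / 2 * s2 \<le> \<sigma>" using si[of s2 s1] s1 s2 by (simp add: init \<sigma>_def)
    \<comment> \<open>X moves at speed at most 1, so descending from \<open>a\<close> to
      \<open>x2\<close> takes longer than 2 \<open>k2\<close>. At vertical speed at least
      \<open>w a\<close> / 2 this lifts sin (2Y) above \<open>k2\<close> \<open>w a\<close>.\<close>
    have "X a 0 + 1 * 0 \<le> X a s2 + 1 * s2"
    proof (rule deriv_nonneg_le[OF s2(1), of "\<lambda>r. X a r + 1 * r" "\<lambda>r. P a r + 1"])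
      show "((\<lambda>r. X a r + 1 * r) has_real_derivative P a x + 1) (at x)" for x
        using X_deriv[of a x] by (auto intro!: derivative_eq_intros)
      show "0 \<le> P a x + 1" for x
        using P_le[of a x] mult_left_le[OF C_le_1[of a x] less_imp_le[OF W_pos[of a x]]] W_le_1[of a x] by linarith
    qed
    then have "a - x2 \<le> s2" using s2 by (simp add: init)
    then have "2 * k2 < s2" using a(4) by linarith
    then have "w a / 2 * (2 * k2) < w a / 2 * s2" using w_pos[of a] by (intro mult_strict_left_mono) auto
    then show False using 1 \<sigma>k by (simp add: mult.commute)
  qed
  then obtain s' where s': "0 \<le> s'" "s' \<le> t" "Q a s' \<le> 0" by blast
  obtain s where s: "0 < s" "s \<le> s'" "Q a s = 0" "\<And>r. 0 \<le> r \<Longrightarrow> r < s \<Longrightarrow> Q a r > 0"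
    using first_zero[of "Q a" s'] s' cont w_pos[of a] by (metis init(4))
  have st: "s \<le> t" using s s' by simp
  have "0 \<le> Y a s"
  proof -
    have "Y a 0 \<le> Y a s"
      by (rule less_imp_le[OF deriv_pos_less[OF s(1) Y_deriv]]) (use s(4) in auto)
    then show ?thesis by (simp add: init)
  qed
  then have "cc * Y a s < C a s" unfolding C_def using height[of s] s st by (intro h(3)) auto
  then have "crosses a" using crosses_if_low_neck[OF a0 s(1,3,4)] t(4) st by auto
  then show ?thesis using a0 by blast
qed

end

section \<open>Closing up the profile\<close>

lemma periodic_int:
  fixes f :: "real \<Rightarrow> 'a"
  assumes "\<And>t. f (t + p) = f t"
  shows "f (t + of_int k * p) = f t"
proof (induction k rule: int_induct[where k = 0])
  case (step1 i)
  then show ?case using assms[of "t + of_int i * p"] by (simp add: algebra_simps)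
next
  case (step2 i)
  then show ?case using assms[of "t + of_int (i - 1) * p"] by (simp add: algebra_simps)
qed simp

context profile
begin

text \<open>The system is invariant under time reversal combined with the reflection Y to - Y, and
  an orthogonal hit of the axis is fixed by this symmetry. Applied at the start and at the return it
  yields periodicity.\<close>

lemma reflection:
  assumes "Y a s = 0" "P a s = 0"
  shows "X a (2 * s - t) = X a t" "Y a (2 * s - t) = - Y a t"
    "P a (2 * s - t) = - P a t" "Q a (2 * s - t) = Q a t"
proof -
  define u where "u = (\<lambda>t. (X a (2 * s - t), - Y a (2 * s - t), - P a (2 * s - t), Q a (2 * s - t)))"
  have ch: "((\<lambda>t. f (2 * s - t)) has_real_derivative - f') (at t)"
    if "(f has_real_derivative f') (at (2 * s - t))" for f f' t
  proof -
    have "((\<lambda>t. 2 * s - t) has_real_derivative - 1) (at t)" by (auto intro!: derivative_eq_intros)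
    from DERIV_chain2[OF that this] show ?thesis by simp
  qed
  have "(u has_vector_derivative field (u t)) (at t)" for t
  proof -
    have "((\<lambda>t. X a (2 * s - t)) has_vector_derivative - P a (2 * s - t)) (at t)"
      using ch[OF X_deriv] by (simp add: has_real_derivative_iff_has_vector_derivative)
    moreover have "((\<lambda>t. - Y a (2 * s - t)) has_vector_derivative Q a (2 * s - t)) (at t)"
      using DERIV_minus[OF ch[OF Y_deriv]] by (simp add: has_real_derivative_iff_has_vector_derivative)
    moreover have "((\<lambda>t. - P a (2 * s - t)) has_vector_derivative
        cc * (1 - exp (2 * X a (2 * s - t))) * (W a (2 * s - t))\<^sup>2 * cos (2 * Y a (2 * s - t)) ^ (2 * m)) (at t)"
      using DERIV_minus[OF ch[OF P_deriv']] by (simp add: has_real_derivative_iff_has_vector_derivative)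
    moreover have "((\<lambda>t. Q a (2 * s - t)) has_vector_derivative
        - (- (2 * real m) * sin (2 * Y a (2 * s - t)) * cos (2 * Y a (2 * s - t)) ^ (2 * m - 1) * (W a (2 * s - t))\<^sup>2)) (at t)"
      using ch[OF Q_deriv] by (simp only: has_real_derivative_iff_has_vector_derivative)
    ultimately show ?thesis
      unfolding u_def field_def Let_def W_def
      by (auto intro!: has_vector_derivative_Pair)
  qed
  then have "u t = sol a t" by (rule sol_unique[where s = s]) (simp add: u_def sol_eq assms)
  then show "X a (2 * s - t) = X a t" "Y a (2 * s - t) = - Y a t"
    "P a (2 * s - t) = - P a t" "Q a (2 * s - t) = Q a t" by (auto simp: u_def sol_eq)
qed

lemma smooth_sol: "smooth_on UNIV (sol a)"
proof (rule smooth_on_autonomous_solution[OF _ sol_deriv])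
  show "smooth_on UNIV field"
    unfolding field_def Let_def w_def by (intro smooth_on_intros open_UNIV)
qed

lemma smooth_components:
  "smooth_on UNIV (X a)" "smooth_on UNIV (Y a)" "smooth_on UNIV (P a)" "smooth_on UNIV (Q a)"
  unfolding X_def[abs_def] Y_def[abs_def] P_def[abs_def] Q_def[abs_def]
  by (intro smooth_on_fst smooth_on_snd open_UNIV smooth_sol)+

section \<open>Speed and rotation of the velocity\<close>

text \<open>The square root of the conformal factor, and by zero energy also the Euclidean speed of
  the orbit in the (X, Y) plane.\<close>

definition V where "V a t = W a t * C a t"

definition tn where "tn a t = sin (2 * Y a t) / cos (2 * Y a t)"

lemma V_pos: "V a t > 0" unfolding V_def using W_pos C_pos by simp

lemma V_sq: "(V a t)\<^sup>2 = (P a t)\<^sup>2 + (Q a t)\<^sup>2"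
  using energy[of a t] by (simp add: V_def power_mult_distrib)

lemma smooth_V: "smooth_on UNIV (V a)"
  unfolding V_def[abs_def] W_def C_def w_def by (intro smooth_on_intros open_UNIV smooth_components)

lemma C_step: "C a t = cos (2 * Y a t) * cos (2 * Y a t) ^ (m - 1)"
  using m1 by (simp add: C_def power_eq_if)

lemma V_deriv: "(V a has_real_derivative V a t * (cc * (1 - exp (2 * X a t)) * P a t - 2 * m * tn a t * Q a t)) (at t)"
proof -
  have "cos (2 * Y a t) ^ (m - 1) * sin (2 * Y a t) = tn a t * C a t"
    using cos_pos[of a t] by (simp add: tn_def C_step)
  then have c: "- (2 * real m) * sin (2 * Y a t) * cos (2 * Y a t) ^ (m - 1) * Q a t = - (2 * real m) * (tn a t * C a t) * Q a t"
    by (simp add: mult_ac)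
  show ?thesis unfolding V_def[abs_def]
    by (rule DERIV_cong[OF DERIV_mult[OF W_deriv C_deriv]], unfold c) (simp add: algebra_simps)
qed

lemma P_deriv_V: "(P a has_real_derivative cc * (1 - exp (2 * X a t)) * (V a t)\<^sup>2) (at t)"
  using P_deriv[of a t] by (simp add: V_def power_mult_distrib mult.assoc)

lemma Q_deriv_V: "(Q a has_real_derivative - (2 * m * tn a t) * (V a t)\<^sup>2) (at t)"
proof -
  have "sin (2 * Y a t) * cos (2 * Y a t) ^ (m - 1) = tn a t * C a t"
    using cos_pos[of a t] by (simp add: tn_def C_step)
  then have eq: "- (2 * real m) * sin (2 * Y a t) * (C a t * cos (2 * Y a t) ^ (m - 1)) * (W a t)\<^sup>2 = - (2 * m * tn a t) * (V a t)\<^sup>2"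
    by (simp add: V_def power2_eq_square mult_ac)
  show ?thesis by (rule DERIV_cong[OF Q_deriv2 eq])
qed

text \<open>The angular velocity of the direction (P, Q) / V.\<close>

definition turning where "turning a t = cc * (exp (2 * X a t) - 1) * Q a t - 2 * m * tn a t * P a t"

lemma direction_deriv:
  "((\<lambda>t. P a t / V a t) has_real_derivative - turning a t * (Q a t / V a t)) (at t)"
  "((\<lambda>t. Q a t / V a t) has_real_derivative turning a t * (P a t / V a t)) (at t)"
proof -
  have V0: "V a t \<noteq> 0" using V_pos[of a t] by simp
  have Q2: "V a t * V a t = P a t * P a t + Q a t * Q a t" using V_sq[of a t] by (simp add: power2_eq_square)
  have q: "x / (V a t * V a t) = y / V a t" if "x = y * V a t" for x y using V0 that by simp
  show "((\<lambda>t. P a t / V a t) has_real_derivative - turning a t * (Q a t / V a t)) (at t)"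
  proof (rule DERIV_cong[OF DERIV_divide[OF P_deriv_V V_deriv V0]])
    have "cc * (1 - exp (2 * X a t)) * (V a t)\<^sup>2 * V a t - P a t * (V a t * (cc * (1 - exp (2 * X a t)) * P a t - 2 * m * tn a t * Q a t))
      = V a t * (cc * (1 - exp (2 * X a t)) * (V a t * V a t) - P a t * (cc * (1 - exp (2 * X a t)) * P a t - 2 * m * tn a t * Q a t))"
      by (simp add: power2_eq_square algebra_simps)
    also have "\<dots> = (- turning a t * Q a t) * V a t" unfolding Q2 turning_def by (simp add: algebra_simps)
    finally show "(cc * (1 - exp (2 * X a t)) * (V a t)\<^sup>2 * V a t - P a t * (V a t * (cc * (1 - exp (2 * X a t)) * P a t - 2 * m * tn a t * Q a t))) / (V a t * V a t)
      = - turning a t * (Q a t / V a t)" by (subst q[of _ "- turning a t * Q a t"]) simp_all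
  qed
  show "((\<lambda>t. Q a t / V a t) has_real_derivative turning a t * (P a t / V a t)) (at t)"
  proof (rule DERIV_cong[OF DERIV_divide[OF Q_deriv_V V_deriv V0]])
    have "- (2 * m * tn a t) * (V a t)\<^sup>2 * V a t - Q a t * (V a t * (cc * (1 - exp (2 * X a t)) * P a t - 2 * m * tn a t * Q a t))
      = V a t * (- (2 * m * tn a t) * (V a t * V a t) - Q a t * (cc * (1 - exp (2 * X a t)) * P a t - 2 * m * tn a t * Q a t))"
      by (simp add: power2_eq_square algebra_simps)
    also have "\<dots> = (turning a t * P a t) * V a t" unfolding Q2 turning_def by (simp add: algebra_simps)
    finally show "(- (2 * m * tn a t) * (V a t)\<^sup>2 * V a t - Q a t * (V a t * (cc * (1 - exp (2 * X a t)) * P a t - 2 * m * tn a t * Q a t))) / (V a t * V a t)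
      = turning a t * (P a t / V a t)" by (subst q[of _ "turning a t * P a t"]) simp_all
  qed
qed

end

section \<open>The closed profile curve and its hypersurface\<close>

locale closed_profile = profile +
  fixes a T :: real
  assumes a_pos: "a > 0" and ret: "returns a T" and PT: "P a T = 0"
begin

lemma T: "T > 0" "Y a T = 0" "\<And>s. 0 < s \<Longrightarrow> s < T \<Longrightarrow> P a s < 0 \<and> Y a s > 0"
  using ret by (auto simp: returns_def ascending_def)

lemma neg: "X a (- t) = X a t" "Y a (- t) = - Y a t"
  using reflection[of a 0 t] by (simp_all add: init)

lemma period: "X a (t + 2 * T) = X a t" "Y a (t + 2 * T) = Y a t"
  using reflection[OF T(2) PT, of "- t"] neg[of t] by (simp_all add: algebra_simps)

lemma X_strict: "0 \<le> r \<Longrightarrow> r < s \<Longrightarrow> s \<le> T \<Longrightarrow> X a s < X a r"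
  by (rule deriv_neg_less[OF _ X_deriv]) (use T(3) in auto)

text \<open>X is even and strictly decreasing on [0, T], so it determines |t|. Y is odd and positive
  on (0, T), so it determines the sign of t; the half-open interval keeps only one of the endpoints
  - T and T.\<close>

lemma fundamental_injective:
  assumes "- T \<le> s" "s < T" "- T \<le> t" "t < T" "X a s = X a t" "Y a s = Y a t"
  shows "s = t"
proof -
  have "X a \<bar>s\<bar> = X a \<bar>t\<bar>" using assms(5) neg by (simp add: abs_if)
  moreover have "\<bar>s\<bar> \<le> T" "\<bar>t\<bar> \<le> T" using assms(1-4) by (simp_all add: abs_le_iff)
  ultimately have abs: "\<bar>s\<bar> = \<bar>t\<bar>"
    using X_strict[of "\<bar>s\<bar>" "\<bar>t\<bar>"] X_strict[of "\<bar>t\<bar>" "\<bar>s\<bar>"] by (cases "\<bar>s\<bar>" "\<bar>t\<bar>" rule: linorder_cases) auto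
  show ?thesis
  proof (rule ccontr)
    assume "s \<noteq> t"
    then have st: "s = - t" using abs by (auto simp: abs_if split: if_splits)
    then have "Y a t = 0" using assms(6) neg(2)[of t] by simp
    then have "Y a \<bar>t\<bar> = 0" using neg(2)[of t] by (auto simp: abs_if)
    moreover have "0 < \<bar>t\<bar>" "\<bar>t\<bar> < T" using st \<open>s \<noteq> t\<close> assms(1-4) by auto
    ultimately show False using T(3)[of "\<bar>t\<bar>"] by simp
  qed
qed

lemma X_Y_eq_iff: "X a s = X a t \<and> Y a s = Y a t \<longleftrightarrow> (\<exists>k::int. s = t + of_int k * (2 * T))"
proof
  assume eq: "X a s = X a t \<and> Y a s = Y a t"
  have red: "\<exists>r (k::int). - T \<le> r \<and> r < T \<and> x = r + of_int k * (2 * T)" for x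
  proof -
    define k where "k = \<lfloor>(x + T) / (2 * T)\<rfloor>"
    have "of_int k \<le> (x + T) / (2 * T)" "(x + T) / (2 * T) < of_int k + 1" by (simp_all add: k_def)
    then have "of_int k * (2 * T) \<le> x + T" "x + T < (of_int k + 1) * (2 * T)"
      using T(1) by (simp_all add: field_simps)
    then show ?thesis by (intro exI[of _ "x - of_int k * (2 * T)"] exI[of _ k]) (simp add: algebra_simps)
  qed
  obtain s' ks where s': "- T \<le> s'" "s' < T" "s = s' + of_int ks * (2 * T)" using red by blast
  obtain t' kt where t': "- T \<le> t'" "t' < T" "t = t' + of_int kt * (2 * T)" using red by blast
  have "X a s' = X a t'" "Y a s' = Y a t'"
    using eq periodic_int[of "X a" "2 * T" s' ks] periodic_int[of "X a" "2 * T" t' kt]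
      periodic_int[of "Y a" "2 * T" s' ks] periodic_int[of "Y a" "2 * T" t' kt] period s'(3) t'(3) by auto
  then have "s' = t'" using fundamental_injective s' t' by blast
  then have "s = t + of_int (ks - kt) * (2 * T)" unfolding s'(3) t'(3) by (simp add: algebra_simps)
  then show "\<exists>k::int. s = t + of_int k * (2 * T)" by blast
next
  assume "\<exists>k::int. s = t + of_int k * (2 * T)"
  then show "X a s = X a t \<and> Y a s = Y a t"
    using periodic_int[of "X a" "2 * T"] periodic_int[of "Y a" "2 * T"] period by auto
qed

text \<open>The factor sqrt (2 cc) is the radius of the self-shrinking sphere of dimension 2n -
  1.\<close>

definition r where "r t = sqrt (2 * cc) * exp (X a t)"
definition co where "co t = cos (Y a t + pi / 4)"
definition si where "si t = sin (Y a t + pi / 4)"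
text \<open>(\<open>N1\<close>, \<open>N2\<close>) is the unit tangent of the profile in the quarter
  plane turned clockwise by a right angle; at time 0 it points away from the origin.\<close>

definition N1 where "N1 t = P a t / V a t * si t + Q a t / V a t * co t"
definition N2 where "N2 t = Q a t / V a t * si t - P a t / V a t * co t"

lemma r_pos: "r t > 0" using cc3 by (simp add: r_def)

lemma r_sq: "(r t)\<^sup>2 = 2 * cc * exp (2 * X a t)"
  using cc3 by (simp add: r_def power_mult_distrib exp_double)

lemma co_pos: "co t > 0" and si_pos: "si t > 0"
  unfolding co_def si_def using Y_bound[of a t] by (auto intro!: cos_gt_zero_pi sin_gt_zero)

lemma si_co: "(si t)\<^sup>2 + (co t)\<^sup>2 = 1" by (simp add: si_def co_def)

lemma derivs: "(r has_real_derivative r t * P a t) (at t)"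
  "(co has_real_derivative - si t * Q a t) (at t)" "(si has_real_derivative co t * Q a t) (at t)"
  unfolding r_def[abs_def] co_def[abs_def] si_def[abs_def] using X_deriv[of a t] Y_deriv[of a t]
  by (auto intro!: derivative_eq_intros)

lemma smooths: "smooth_on UNIV r" "smooth_on UNIV co" "smooth_on UNIV si"
  unfolding r_def[abs_def] co_def[abs_def] si_def[abs_def]
  by (intro smooth_on_intros open_UNIV smooth_components)+

lemma polar_inject:
  "r s * co s = r t * co t \<and> r s * si s = r t * si t \<longleftrightarrow> X a s = X a t \<and> Y a s = Y a t"
proof
  assume eq: "r s * co s = r t * co t \<and> r s * si s = r t * si t"
  have sq: "(r x)\<^sup>2 = (r x * co x)\<^sup>2 + (r x * si x)\<^sup>2" for x
  proof -
    have "(r x * co x)\<^sup>2 + (r x * si x)\<^sup>2 = (r x)\<^sup>2 * ((si x)\<^sup>2 + (co x)\<^sup>2)" by (simp add: power_mult_distrib algebra_simps)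
    then show ?thesis by (simp add: si_co)
  qed
  have "(r s)\<^sup>2 = (r t)\<^sup>2" using sq[of s] sq[of t] eq by simp
  then have rr: "r s = r t" using r_pos[of s] r_pos[of t] by (simp add: power2_eq_iff_nonneg)
  then have "X a s = X a t" using cc3 by (simp add: r_def)
  moreover have "co s = co t" using eq rr r_pos[of t] by simp
  then have "Y a s + pi / 4 = Y a t + pi / 4"
    unfolding co_def using Y_bound[of a s] Y_bound[of a t] by (rule_tac cos_inj_pi) auto
  ultimately show "X a s = X a t \<and> Y a s = Y a t" by simp
qed (auto simp: r_def co_def si_def)

text \<open>With \<theta> = Y + \<pi>/4 one has tan (2Y) = - cot (2\<theta>), and - 2 cot
  (2\<theta>) = tan \<theta> - cot \<theta>. This is the combination produced by the curvatures
  along the two spheres.\<close>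

lemma tn_eq: "2 * tn a t = si t / co t - co t / si t"
proof -
  have shift: "cos (2 * \<theta> - pi / 2) = sin (2 * \<theta>)" "sin (2 * \<theta> - pi / 2) = - cos (2 * \<theta>)" for \<theta> :: real
    by (simp_all add: cos_diff sin_diff)
  define \<theta> where "\<theta> = Y a t + pi / 4"
  have e: "2 * Y a t = 2 * \<theta> - pi / 2" by (simp add: \<theta>_def)
  have "cos (2 * Y a t) = 2 * sin \<theta> * cos \<theta>" unfolding e shift by (rule sin_double)
  moreover have "sin (2 * Y a t) = (sin \<theta>)\<^sup>2 - (cos \<theta>)\<^sup>2" unfolding e shift by (simp add: cos_double)
  ultimately have "cos (2 * Y a t) = 2 * si t * co t" "sin (2 * Y a t) = (si t)\<^sup>2 - (co t)\<^sup>2"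
    by (simp_all add: si_def co_def \<theta>_def)
  then show ?thesis using co_pos[of t] si_pos[of t] by (simp add: tn_def field_simps power2_eq_square)
qed

text \<open>The normal rotates at the angular velocity \<open>turning\<close> of the velocity in the
  (X, Y) plane plus the rate Q at which the polar frame itself rotates. Dividing by the speed r V of
  the profile gives the curvature.\<close>

sublocale rotation_profile "\<lambda>t. r t * co t" "\<lambda>t. r t * (P a t * co t - Q a t * si t)"
  "\<lambda>t. r t * si t" "\<lambda>t. r t * (P a t * si t + Q a t * co t)" N1 N2
  "\<lambda>t. (turning a t + Q a t) / (r t * V a t)" "2 * T"
proof
  show "smooth_on UNIV (\<lambda>t. r t * co t)" "smooth_on UNIV (\<lambda>t. r t * si t)"
    by (intro smooth_on_intros open_UNIV smooths)+
  have V0: "V a t \<noteq> 0" for t using V_pos[of a t] by simp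
  show "smooth_on UNIV N1" "smooth_on UNIV N2" unfolding N1_def[abs_def] N2_def[abs_def]
    by (intro smooth_on_intros open_UNIV smooths smooth_components smooth_V V0)+
  fix t
  show "((\<lambda>t. r t * co t) has_real_derivative r t * (P a t * co t - Q a t * si t)) (at t)"
    by (rule DERIV_cong[OF DERIV_mult[OF derivs(1,2)]]) (simp add: algebra_simps)
  show "((\<lambda>t. r t * si t) has_real_derivative r t * (P a t * si t + Q a t * co t)) (at t)"
    by (rule DERIV_cong[OF DERIV_mult[OF derivs(1,3)]]) (simp add: algebra_simps)
  have k: "(turning a t + Q a t) / (r t * V a t) * (r t * z) = (turning a t + Q a t) * (z / V a t)" for z
    using r_pos[of t] by simp
  show "(N1 has_real_derivative (turning a t + Q a t) / (r t * V a t) * (r t * (P a t * co t - Q a t * si t))) (at t)"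
    unfolding N1_def[abs_def] k
    by (rule DERIV_cong[OF DERIV_add[OF DERIV_mult[OF direction_deriv(1) derivs(3)] DERIV_mult[OF direction_deriv(2) derivs(2)]]])
      (simp add: algebra_simps diff_divide_distrib add_divide_distrib)
  show "(N2 has_real_derivative (turning a t + Q a t) / (r t * V a t) * (r t * (P a t * si t + Q a t * co t))) (at t)"
    unfolding N2_def[abs_def] k
    by (rule DERIV_cong[OF DERIV_diff[OF DERIV_mult[OF direction_deriv(2) derivs(3)] DERIV_mult[OF direction_deriv(1) derivs(2)]]])
      (simp add: algebra_simps diff_divide_distrib add_divide_distrib)
  have "(P a t * co t - Q a t * si t)\<^sup>2 + (P a t * si t + Q a t * co t)\<^sup>2 = (V a t)\<^sup>2 * ((si t)\<^sup>2 + (co t)\<^sup>2)"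
    unfolding V_sq by (simp add: power2_eq_square algebra_simps)
  then have "(P a t * co t - Q a t * si t)\<^sup>2 + (P a t * si t + Q a t * co t)\<^sup>2 = (V a t)\<^sup>2" by (simp add: si_co)
  then show "r t * (P a t * co t - Q a t * si t) \<noteq> 0 \<or> r t * (P a t * si t + Q a t * co t) \<noteq> 0"
    using r_pos[of t] V0[of t] by auto
  show "r t * co t > 0" "r t * si t > 0" using r_pos co_pos si_pos by simp_all
  have "(N1 t)\<^sup>2 + (N2 t)\<^sup>2 = ((P a t / V a t)\<^sup>2 + (Q a t / V a t)\<^sup>2) * ((si t)\<^sup>2 + (co t)\<^sup>2)"
  proof -
    have "(x * u + y * v)\<^sup>2 + (y * u - x * v)\<^sup>2 = (x\<^sup>2 + y\<^sup>2) * (u\<^sup>2 + v\<^sup>2)" for x y u v :: real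
      by (simp add: power2_eq_square algebra_simps)
    then show ?thesis unfolding N1_def N2_def .
  qed
  also have "(P a t / V a t)\<^sup>2 + (Q a t / V a t)\<^sup>2 = ((P a t)\<^sup>2 + (Q a t)\<^sup>2) / (V a t)\<^sup>2"
    by (simp add: power_divide add_divide_distrib)
  finally show "(N1 t)\<^sup>2 + (N2 t)\<^sup>2 = 1" using V0[of t] by (simp add: si_co flip: V_sq)
  show "N1 t * (r t * (P a t * co t - Q a t * si t)) + N2 t * (r t * (P a t * si t + Q a t * co t)) = 0"
    by (simp add: N1_def N2_def algebra_simps)
  show "2 * T > 0" using T(1) by simp
  show "r s * co s = r t * co t \<and> r s * si s = r t * si t \<longleftrightarrow> (\<exists>k::int. s = t + of_int k * (2 * T))" for s t
    unfolding polar_inject by (rule X_Y_eq_iff)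
qed

text \<open>Over the common denominator r V the terms with \<open>tn\<close> cancel against those in
  \<open>turning\<close>, and cc = 2m + 1 removes the plain multiples of Q. What remains is cc exp
  (2X) Q = r^2 Q / 2, while position times normal is r Q / V.\<close>

lemma shrinker_equation:
  "real m * (N1 t / (r t * co t) + N2 t / (r t * si t)) + (turning a t + Q a t) / (r t * V a t) =
    (r t * co t * N1 t + r t * si t * N2 t) / 2"
proof -
  have nz: "r t \<noteq> 0" "V a t \<noteq> 0" "co t \<noteq> 0" "si t \<noteq> 0" using r_pos[of t] V_pos[of a t] co_pos[of t] si_pos[of t] by auto
  have n: "N1 t = (P a t * si t + Q a t * co t) / V a t" "N2 t = (Q a t * si t - P a t * co t) / V a t"
    by (simp_all add: N1_def N2_def add_divide_distrib diff_divide_distrib)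
  have "N1 t / (r t * co t) + N2 t / (r t * si t) = (P a t * (si t / co t - co t / si t) + 2 * Q a t) / (r t * V a t)"
    unfolding n using nz by (simp add: field_simps)
  also have "\<dots> = (2 * tn a t * P a t + 2 * Q a t) / (r t * V a t)" by (simp add: tn_eq[symmetric] mult.commute)
  finally have E: "N1 t / (r t * co t) + N2 t / (r t * si t) = (2 * tn a t * P a t + 2 * Q a t) / (r t * V a t)" .
  have g: "real m * (z / d) + (u + v) / d = (real m * z + u + v) / d" for z d u v by (simp add: add_divide_distrib)
  have "real m * (N1 t / (r t * co t) + N2 t / (r t * si t)) + (turning a t + Q a t) / (r t * V a t)
      = (real m * (2 * tn a t * P a t + 2 * Q a t) + turning a t + Q a t) / (r t * V a t)"
    unfolding E by (rule g)
  also have "real m * (2 * tn a t * P a t + 2 * Q a t) + turning a t + Q a t = cc * exp (2 * X a t) * Q a t"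
    by (simp add: turning_def cc_def algebra_simps)
  also have "\<dots> = (r t)\<^sup>2 * Q a t / 2" by (simp add: r_sq)
  finally have L: "real m * (N1 t / (r t * co t) + N2 t / (r t * si t)) + (turning a t + Q a t) / (r t * V a t)
      = r t * Q a t / (2 * V a t)" using nz by (simp add: power2_eq_square)
  have "r t * co t * N1 t + r t * si t * N2 t = r t * (Q a t * ((si t)\<^sup>2 + (co t)\<^sup>2)) / V a t"
    unfolding n using nz by (simp add: field_simps power2_eq_square)
  then show ?thesis unfolding L by (simp add: si_co)
qed

end

theorem theorem1:
  assumes "CARD('n::finite) \<ge> 2"
  shows "\<exists>S :: ((real^'n) \<times> (real^'n)) set.
           self_shrinker S \<and>
           diffeomorphic S
             (sphere (0::real^'n) 1 \<times> sphere (0::real^'n) 1 \<times> sphere (0::real^2) 1) \<and>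
           SO_SO_invariant S"
proof -
  interpret profile "CARD('n) - 1" by standard (use assms in simp)
  obtain a0 where "a0 > 0" "\<And>t. \<not> returns a0 t" using no_return_small by blast
  moreover obtain a1 where "a1 > 0" "crosses a1" using crosses_large by blast
  ultimately obtain a T where aT: "a > 0" "returns a T" "P a T = 0"
    using returning_perpendicularly by metis
  interpret closed_profile "CARD('n) - 1" a T by standard (use aT in simp_all)
  have "real (CARD('n) - 1) = real CARD('n) - 1" using assms by (simp add: of_nat_diff)
  then have "self_shrinker (hypersurface :: ((real^'n) \<times> (real^'n)) set)"
    using shrinker_equation by (intro self_shrinker) simp
  then show ?thesis using diffeomorphic_product SO_SO_invariant by blast
qed

end
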